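(* Let $\mathcal X$ and $\mathcal Y$ be infinite dimensional complex Banach spaces, let $A\in L(\mathcal X)$ and $B\in L(\mathcal Y)$, and let $\rho\in L(L(\mathcal Y,\mathcal X))$ be the generalized derivation defined by $A$ and $B$, i.e. $\rho(U)=AU-UB$ for $U\in L(\mathcal Y,\mathcal X)$. Then: (i) $I(\rho)=\big((I(A)-\mathrm{iso}\,\sigma(B))\cup(\mathrm{iso}\,\sigma(A)-I(B))\big)\setminus\mathrm{acc}\,\sigma(\rho)$. (ii) $\Pi(\rho)=(\Pi(A)-\Pi(B))\setminus\sigma_{DR}(\rho)$.
   Context: $L(\mathcal Y,\mathcal X)$ is the Banach space of bounded linear maps from $\mathcal Y$ to $\mathcal X$ and $L(\mathcal X)=L(\mathcal X,\mathcal X)$. For $S,T\subseteq\mathbb C$, $S-T=\{s-t: s\in S,\ t\in T\}$ (empty if $S$ or $T$ is empty). For $K\subseteq\mathbb C$, $\mathrm{acc}\,K$ is the set of limit points of $K$ and $\mathrm{iso}\,K=K\setminus\mathrm{acc}\,K$. For a bounded operator $T$ on a Banach space, $N(T)$ and $R(T)$ are its null space and range; $\mathrm{asc}(T)$ is the smallest integer $a\ge0$ with $N(T^a)=N(T^{a+1})$, and $\mathrm{dsc}(T)$ the smallest integer $d\ge 0$ with $R(T^d)=R(T^{d+1})$ (each $\infty$ if no such integer exists). $\sigma(T)$ is the spectrum, $\Pi(T)=\{\lambda\in\sigma(T): \mathrm{asc}(T-\lambda)=\mathrm{dsc}(T-\lambda)<\infty\}$ is the set of poles of $T$, and $I(T)=\mathrm{iso}\,\sigma(T)\setminus\Pi(T)$.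 $T$ is Drazin invertible if there are a bounded operator $S$ on the same space and $m\in\mathbb N$ with $T^m=T^mST$, $STS=S$, $TS=ST$; the Drazin spectrum is $\sigma_{DR}(T)=\{\lambda\in\mathbb C: T-\lambda$ is not Drazin invertible$\}$. *)

theory Defs
  imports "HOL-Analysis.Analysis" "HOL-Library.Extended_Nat"
begin

section \<open>Complex Banach spaces\<close>

class complex_normed_vector = real_normed_vector +
  fixes scaleC :: "complex \<Rightarrow> 'a \<Rightarrow> 'a" (infixr "*\<^sub>C" 75)
  assumes scaleC_add_right: "a *\<^sub>C (x + y) = a *\<^sub>C x + a *\<^sub>C y"
    and scaleC_add_left: "(a + b) *\<^sub>C x = a *\<^sub>C x + b *\<^sub>C x"
    and scaleC_scaleC: "a *\<^sub>C (b *\<^sub>C x) = (a * b) *\<^sub>C x"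
    and scaleC_of_real: "of_real r *\<^sub>C x = r *\<^sub>R x"
    and norm_scaleC: "norm (a *\<^sub>C x) = cmod a * norm x"

class complex_banach = complex_normed_vector + banach

lemma scaleC_one [simp]: "1 *\<^sub>C (x :: 'a::complex_normed_vector) = x"
  using scaleC_of_real[of 1 x] by simp

global_interpretation complex_vector:
  vector_space "scaleC :: complex \<Rightarrow> 'a \<Rightarrow> 'a::complex_normed_vector"
  by unfold_locales (simp_all add: scaleC_add_right scaleC_add_left scaleC_scaleC)

lemma bounded_linear_scaleC: "bounded_linear (scaleC c :: 'a::complex_normed_vector \<Rightarrow> 'a)"
proof (rule bounded_linear_intro[where K = "cmod c"])
  fix r and x :: 'a
  show "c *\<^sub>C (r *\<^sub>R x) = r *\<^sub>R (c *\<^sub>C x)"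
    by (simp add: scaleC_of_real[symmetric] scaleC_scaleC mult.commute)
qed (simp_all add: scaleC_add_right norm_scaleC mult.commute)

definition infinite_dimensional :: "'a::complex_normed_vector itself \<Rightarrow> bool" where
  "infinite_dimensional _ \<longleftrightarrow> \<not> (\<exists>S :: 'a set. finite S \<and> complex_vector.span S = UNIV)"


section \<open>The Banach space of bounded complex-linear maps\<close>

typedef (overloaded) ('a, 'b) cblinfun ("(_ \<Rightarrow>\<^sub>C\<^sub>L /_)" [22, 21] 21) =
  "{f :: 'a::complex_normed_vector \<Rightarrow> 'b::complex_normed_vector.
      bounded_linear f \<and> (\<forall>c x. f (c *\<^sub>C x) = c *\<^sub>C f x)}"
  morphisms capply CBlinfun
  by (rule exI[where x = "\<lambda>_. 0"]) (simp add: bounded_linear_zero)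

setup_lifting type_definition_cblinfun

lemma bounded_linear_capply: "bounded_linear (capply f)"
  using capply[of f] by simp

lemma capply_scaleC: "capply f (c *\<^sub>C x) = c *\<^sub>C capply f x"
  using capply[of f] by simp

lemma cblinfun_eqI: "(\<And>x. capply f x = capply g x) \<Longrightarrow> f = g"
  by (metis capply_inject ext)

instantiation cblinfun :: (complex_normed_vector, complex_normed_vector) complex_normed_vector
begin

lift_definition zero_cblinfun :: "'a \<Rightarrow>\<^sub>C\<^sub>L 'b" is "\<lambda>_. 0"
  by (simp add: bounded_linear_zero)

lift_definition plus_cblinfun :: "'a \<Rightarrow>\<^sub>C\<^sub>L 'b \<Rightarrow> 'a \<Rightarrow>\<^sub>C\<^sub>L 'b \<Rightarrow> 'a \<Rightarrow>\<^sub>C\<^sub>L 'b" is "\<lambda>f g x. f x + g x"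
  by (simp add: bounded_linear_add scaleC_add_right)

lift_definition minus_cblinfun :: "'a \<Rightarrow>\<^sub>C\<^sub>L 'b \<Rightarrow> 'a \<Rightarrow>\<^sub>C\<^sub>L 'b \<Rightarrow> 'a \<Rightarrow>\<^sub>C\<^sub>L 'b" is "\<lambda>f g x. f x - g x"
  by (simp add: bounded_linear_sub complex_vector.scale_right_diff_distrib)

lift_definition uminus_cblinfun :: "'a \<Rightarrow>\<^sub>C\<^sub>L 'b \<Rightarrow> 'a \<Rightarrow>\<^sub>C\<^sub>L 'b" is "\<lambda>f x. - f x"
  by (simp add: bounded_linear_minus)

lift_definition scaleC_cblinfun :: "complex \<Rightarrow> 'a \<Rightarrow>\<^sub>C\<^sub>L 'b \<Rightarrow> 'a \<Rightarrow>\<^sub>C\<^sub>L 'b" is "\<lambda>c f x. c *\<^sub>C f x"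
  by (auto simp: scaleC_scaleC mult.commute
      intro: bounded_linear_compose[OF bounded_linear_scaleC])

lift_definition scaleR_cblinfun :: "real \<Rightarrow> 'a \<Rightarrow>\<^sub>C\<^sub>L 'b \<Rightarrow> 'a \<Rightarrow>\<^sub>C\<^sub>L 'b" is "\<lambda>r f x. r *\<^sub>R f x"
  by (auto simp: scaleC_scaleC mult.commute scaleC_of_real[symmetric]
      intro: bounded_linear_compose[OF bounded_linear_scaleC])

definition norm_cblinfun :: "'a \<Rightarrow>\<^sub>C\<^sub>L 'b \<Rightarrow> real" where
  "norm_cblinfun f = onorm (capply f)"

definition dist_cblinfun :: "'a \<Rightarrow>\<^sub>C\<^sub>L 'b \<Rightarrow> 'a \<Rightarrow>\<^sub>C\<^sub>L 'b \<Rightarrow> real" where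
  "dist_cblinfun f g = norm (f - g)"

definition sgn_cblinfun :: "'a \<Rightarrow>\<^sub>C\<^sub>L 'b \<Rightarrow> 'a \<Rightarrow>\<^sub>C\<^sub>L 'b" where
  "sgn_cblinfun f = inverse (norm f) *\<^sub>R f"

definition uniformity_cblinfun :: "(('a \<Rightarrow>\<^sub>C\<^sub>L 'b) \<times> ('a \<Rightarrow>\<^sub>C\<^sub>L 'b)) filter" where
  "uniformity_cblinfun = (INF e\<in>{0<..}. principal {(f, g). dist f g < e})"

definition open_cblinfun :: "('a \<Rightarrow>\<^sub>C\<^sub>L 'b) set \<Rightarrow> bool" where
  "open_cblinfun S = (\<forall>f\<in>S. \<forall>\<^sub>F (f', g) in uniformity. f' = f \<longrightarrow> g \<in> S)"

instance
proof
  fix f g h :: "'a \<Rightarrow>\<^sub>C\<^sub>L 'b" and r s :: real and a b :: complex and S :: "('a \<Rightarrow>\<^sub>C\<^sub>L 'b) set"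
  show "dist f g = norm (f - g)" by (fact dist_cblinfun_def)
  show "sgn f = inverse (norm f) *\<^sub>R f" by (fact sgn_cblinfun_def)
  show "uniformity = (INF e\<in>{0<..}. principal {(x, y :: 'a \<Rightarrow>\<^sub>C\<^sub>L 'b). dist x y < e})"
    by (fact uniformity_cblinfun_def)
  show "open S = (\<forall>x\<in>S. \<forall>\<^sub>F (x', y) in uniformity. x' = x \<longrightarrow> y \<in> S)"
    by (fact open_cblinfun_def)
  show "f + g + h = f + (g + h)" by transfer (simp add: add.assoc)
  show "0 + f = f" by transfer simp
  show "f + g = g + f" by transfer (simp add: add.commute)
  show "- f + f = 0" by transfer simp
  show "f - g = f + - g" by transfer simp
  show "r *\<^sub>R (f + g) = r *\<^sub>R f + r *\<^sub>R g" by transfer (simp add: scaleR_add_right)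
  show "(r + s) *\<^sub>R f = r *\<^sub>R f + s *\<^sub>R f" by transfer (simp add: scaleR_add_left)
  show "r *\<^sub>R s *\<^sub>R f = (r * s) *\<^sub>R f" by transfer simp
  show "1 *\<^sub>R f = f" by transfer simp
  show "a *\<^sub>C (f + g) = a *\<^sub>C f + a *\<^sub>C g" by transfer (simp add: scaleC_add_right)
  show "(a + b) *\<^sub>C f = a *\<^sub>C f + b *\<^sub>C f" by transfer (simp add: scaleC_add_left)
  show "a *\<^sub>C b *\<^sub>C f = (a * b) *\<^sub>C f" by transfer (simp add: scaleC_scaleC)
  show "complex_of_real r *\<^sub>C f = r *\<^sub>R f" by transfer (simp add: scaleC_of_real)
  show "(norm f = 0) = (f = 0)"
    unfolding norm_cblinfun_def onorm_eq_0[OF bounded_linear_capply]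
    by transfer (auto simp: fun_eq_iff)
  show "norm (f + g) \<le> norm f + norm g"
    unfolding norm_cblinfun_def plus_cblinfun.rep_eq
    by (intro onorm_triangle bounded_linear_capply)
  show "norm (r *\<^sub>R f) = \<bar>r\<bar> * norm f"
    unfolding norm_cblinfun_def scaleR_cblinfun.rep_eq
    by (intro onorm_scaleR bounded_linear_capply)
  show "norm (a *\<^sub>C f) = cmod a * norm f"
  proof -
    have le: "norm (c *\<^sub>C k) \<le> cmod c * norm k" for c and k :: "'a \<Rightarrow>\<^sub>C\<^sub>L 'b"
      unfolding norm_cblinfun_def
    proof (rule onorm_bound)
      show "0 \<le> cmod c * onorm (capply k)"
        by (simp add: onorm_pos_le bounded_linear_capply)
      show "norm (capply (c *\<^sub>C k) x) \<le> cmod c * onorm (capply k) * norm x" for x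
        using onorm[OF bounded_linear_capply, of k x]
        by (simp add: scaleC_cblinfun.rep_eq norm_scaleC mult.assoc mult_left_mono)
    qed
    show ?thesis
    proof (cases "a = 0")
      case True
      then show ?thesis using le[of a f] by (simp add: norm_cblinfun_def onorm_pos_le bounded_linear_capply antisym)
    next
      case False
      have "inverse a *\<^sub>C a *\<^sub>C f = f"
        using False by transfer (simp add: scaleC_scaleC)
      then have "norm f \<le> inverse (cmod a) * norm (a *\<^sub>C f)"
        using le[of "inverse a" "a *\<^sub>C f"] by (simp add: norm_inverse)
      then show ?thesis
        using False le[of a f] by (simp add: field_simps)
    qed
  qed
qed

end

lemma norm_capply: "norm (capply f x) \<le> norm f * norm x"
  unfolding norm_cblinfun_def by (intro onorm bounded_linear_capply)

lemma norm_cblinfun_bound: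
  assumes "0 \<le> b" and "\<And>x. norm (capply f x) \<le> b * norm x"
  shows "norm f \<le> b"
  using assms unfolding norm_cblinfun_def by (rule onorm_bound)

instance cblinfun :: (complex_normed_vector, complex_banach) complex_banach
proof
  fix X :: "nat \<Rightarrow> 'a \<Rightarrow>\<^sub>C\<^sub>L 'b"
  assume X: "Cauchy X"
  define Y where "Y n = Blinfun (capply (X n))" for n
  have Y: "blinfun_apply (Y n) = capply (X n)" for n
    by (simp add: Y_def bounded_linear_Blinfun_apply bounded_linear_capply)
  have dist_eq: "norm (Y m - Y n) = norm (X m - X n)" for m n
    by (simp add: norm_cblinfun_def norm_blinfun.rep_eq minus_blinfun.rep_eq
        minus_cblinfun.rep_eq Y)
  have "Cauchy Y"
    using X by (simp add: Cauchy_def dist_norm dist_eq)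
  then obtain L where L: "Y \<longlonglongrightarrow> L"
    using Cauchy_convergent convergent_def by blast
  have pt: "(\<lambda>n. capply (X n) x) \<longlonglongrightarrow> blinfun_apply L x" for x
    using tendsto_intros(1) blinfun.tendsto[OF L tendsto_const[of x]] by (simp add: Y)
  have "blinfun_apply L (c *\<^sub>C x) = c *\<^sub>C blinfun_apply L x" for c x
  proof (rule LIMSEQ_unique[OF pt])
    show "(\<lambda>n. capply (X n) (c *\<^sub>C x)) \<longlonglongrightarrow> c *\<^sub>C blinfun_apply L x"
      using bounded_linear.tendsto[OF bounded_linear_scaleC pt, of c x]
      by (simp add: capply_scaleC)
  qed
  then have M: "capply (CBlinfun (blinfun_apply L)) = blinfun_apply L"
    by (intro CBlinfun_inverse) (simp add: blinfun.bounded_linear_right)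
  have eq: "norm (X n - CBlinfun (blinfun_apply L)) = norm (Y n - L)" for n
    by (simp add: norm_cblinfun_def norm_blinfun.rep_eq minus_blinfun.rep_eq
        minus_cblinfun.rep_eq Y M)
  have "X \<longlonglongrightarrow> CBlinfun (blinfun_apply L)"
    using L unfolding LIMSEQ_iff eq .
  then show "convergent X" by (auto simp: convergent_def)
qed

lift_definition cid :: "'a::complex_normed_vector \<Rightarrow>\<^sub>C\<^sub>L 'a" is "\<lambda>x. x"
  by simp

lift_definition ccompose :: "'b::complex_normed_vector \<Rightarrow>\<^sub>C\<^sub>L 'c::complex_normed_vector \<Rightarrow>
    'a::complex_normed_vector \<Rightarrow>\<^sub>C\<^sub>L 'b \<Rightarrow> 'a \<Rightarrow>\<^sub>C\<^sub>L 'c"  (infixl "\<circ>\<^sub>C" 70)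
  is "\<lambda>f g x. f (g x)"
  by (auto intro: bounded_linear_compose)

primrec cpow :: "'a::complex_normed_vector \<Rightarrow>\<^sub>C\<^sub>L 'a \<Rightarrow> nat \<Rightarrow> 'a \<Rightarrow>\<^sub>C\<^sub>L 'a" where
  "cpow T 0 = cid"
| "cpow T (Suc n) = T \<circ>\<^sub>C cpow T n"


section \<open>Spectral notions\<close>

definition acc_points :: "complex set \<Rightarrow> complex set" where
  "acc_points K = {z. z islimpt K}"

definition iso_points :: "complex set \<Rightarrow> complex set" where
  "iso_points K = K - acc_points K"

definition minkowski_minus :: "complex set \<Rightarrow> complex set \<Rightarrow> complex set"  (infixl "\<ominus>" 65) where
  "S \<ominus> T = {s - t | s t. s \<in> S \<and> t \<in> T}"

definition nullspace :: "'a::complex_normed_vector \<Rightarrow>\<^sub>C\<^sub>L 'b::complex_normed_vector \<Rightarrow> 'a set" where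
  "nullspace T = {x. capply T x = 0}"

definition range_space :: "'a::complex_normed_vector \<Rightarrow>\<^sub>C\<^sub>L 'b::complex_normed_vector \<Rightarrow> 'b set" where
  "range_space T = range (capply T)"

(* The infimum of the empty set in enat is infinity, so ascent and descent are infinite
   when the chains do not stabilise. *)

definition ascent :: "'a::complex_normed_vector \<Rightarrow>\<^sub>C\<^sub>L 'a \<Rightarrow> enat" where
  "ascent T = Inf {enat a | a. nullspace (cpow T a) = nullspace (cpow T (a + 1))}"

definition descent :: "'a::complex_normed_vector \<Rightarrow>\<^sub>C\<^sub>L 'a \<Rightarrow> enat" where
  "descent T = Inf {enat d | d. range_space (cpow T d) = range_space (cpow T (d + 1))}"

definition cinvertible :: "'a::complex_normed_vector \<Rightarrow>\<^sub>C\<^sub>L 'a \<Rightarrow> bool" where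
  "cinvertible T \<longleftrightarrow> (\<exists>S. S \<circ>\<^sub>C T = cid \<and> T \<circ>\<^sub>C S = cid)"

definition spectrum :: "'a::complex_normed_vector \<Rightarrow>\<^sub>C\<^sub>L 'a \<Rightarrow> complex set" where
  "spectrum T = {\<mu>. \<not> cinvertible (T - \<mu> *\<^sub>C cid)}"

definition poles :: "'a::complex_normed_vector \<Rightarrow>\<^sub>C\<^sub>L 'a \<Rightarrow> complex set" where
  "poles T = {\<mu> \<in> spectrum T. ascent (T - \<mu> *\<^sub>C cid) = descent (T - \<mu> *\<^sub>C cid) \<and>
     ascent (T - \<mu> *\<^sub>C cid) < \<infinity>}"

(* I(T) in the literature. *)

definition iso_nonpoles :: "'a::complex_normed_vector \<Rightarrow>\<^sub>C\<^sub>L 'a \<Rightarrow> complex set" where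
  "iso_nonpoles T = iso_points (spectrum T) - poles T"

definition drazin_invertible :: "'a::complex_normed_vector \<Rightarrow>\<^sub>C\<^sub>L 'a \<Rightarrow> bool" where
  "drazin_invertible T \<longleftrightarrow> (\<exists>S m. cpow T m = cpow T m \<circ>\<^sub>C S \<circ>\<^sub>C T \<and>
     S \<circ>\<^sub>C T \<circ>\<^sub>C S = S \<and> T \<circ>\<^sub>C S = S \<circ>\<^sub>C T)"

definition drazin_spectrum :: "'a::complex_normed_vector \<Rightarrow>\<^sub>C\<^sub>L 'a \<Rightarrow> complex set" where
  "drazin_spectrum T = {\<mu>. \<not> drazin_invertible (T - \<mu> *\<^sub>C cid)}"


section \<open>Generalized derivations\<close>

lift_definition gen_derivation :: "'x::complex_normed_vector \<Rightarrow>\<^sub>C\<^sub>L 'x \<Rightarrow>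
    'y::complex_normed_vector \<Rightarrow>\<^sub>C\<^sub>L 'y \<Rightarrow> ('y \<Rightarrow>\<^sub>C\<^sub>L 'x) \<Rightarrow>\<^sub>C\<^sub>L ('y \<Rightarrow>\<^sub>C\<^sub>L 'x)"
  is "\<lambda>A B U. A \<circ>\<^sub>C U - U \<circ>\<^sub>C B"
proof (intro conjI allI)
  fix A :: "'x \<Rightarrow>\<^sub>C\<^sub>L 'x" and B :: "'y \<Rightarrow>\<^sub>C\<^sub>L 'y"
  let ?f = "\<lambda>U :: 'y \<Rightarrow>\<^sub>C\<^sub>L 'x. A \<circ>\<^sub>C U - U \<circ>\<^sub>C B"
  show scale: "?f (c *\<^sub>C U) = c *\<^sub>C ?f U" for c U
    by (rule cblinfun_eqI) (simp add: minus_cblinfun.rep_eq ccompose.rep_eq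
        scaleC_cblinfun.rep_eq capply_scaleC complex_vector.scale_right_diff_distrib)
  show "bounded_linear ?f"
  proof (rule bounded_linear_intro[where K = "norm A + norm B"])
    show "?f (U + V) = ?f U + ?f V" for U V
      by (rule cblinfun_eqI) (simp add: minus_cblinfun.rep_eq ccompose.rep_eq
          plus_cblinfun.rep_eq linear_simps(1)[OF bounded_linear_capply])
    show "?f (r *\<^sub>R U) = r *\<^sub>R ?f U" for r U
      by (metis scale scaleC_of_real)
    show "norm (?f U) \<le> norm U * (norm A + norm B)" for U
    proof (rule norm_cblinfun_bound)
      fix x
      have "norm (capply (?f U) x) \<le> norm (capply A (capply U x)) + norm (capply U (capply B x))"
        by (simp add: minus_cblinfun.rep_eq ccompose.rep_eq norm_triangle_ineq4)
      also have "\<dots> \<le> norm A * (norm U * norm x) + norm U * (norm B * norm x)"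
        by (intro add_mono order_trans[OF norm_capply] mult_left_mono norm_capply norm_ge_zero)
      finally show "norm (capply (?f U) x) \<le> norm U * (norm A + norm B) * norm x"
        by (simp add: algebra_simps)
    qed simp
  qed
qed

end

theory Submission
  imports Defs "HOL-Complex_Analysis.Cauchy_Integral_Formula"
begin

text \<open>Write \<open>\<rho>\<close> as the difference of the commuting operators \<open>U \<mapsto> A U\<close> and \<open>U \<mapsto> U B\<close>. If \<open>\<rho> - \<mu>\<close> is
  not invertible (not Drazin invertible), a proper ideal of the bicommutant of these two operators
  contains \<open>\<rho> - \<mu>\<close>, and a Gelfand--Mazur argument enlarges it to one that contains \<open>A - \<alpha>\<close> and \<open>B - \<beta>\<close>
  for some \<open>\<alpha> - \<beta> = \<mu>\<close>. So \<open>\<alpha>\<close> and \<open>\<beta>\<close> are spectral values, and in the Drazin case not both poles: if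
  \<open>e\<close> and \<open>f\<close> are the spectral idempotents of two poles, then \<open>1 - e\<close> and \<open>1 - f\<close> lie in the enlarged
  ideal, and so does \<open>e f\<close>, because it is annihilated by a power of \<open>\<rho> - \<mu>\<close>; hence it contains \<open>1\<close>.

  Conversely, testing \<open>\<rho> - \<mu>\<close> on rank one operators shows that it is singular whenever \<open>A - \<alpha>\<close> and
  \<open>B - \<beta>\<close> are. If it is Drazin invertible and \<open>\<alpha>, \<beta>\<close> are isolated, rank one operators built from
  approximate eigenvectors of one factor give \<open>\<parallel>T ^ n w\<parallel> \<le> K \<parallel>T ^ (n + 1) w\<parallel>\<close> for the other factor \<open>T\<close>
  and all \<open>w\<close> commuting with it; this bounds the resolvent of \<open>T\<close> near \<open>0\<close> well enough to produce a
  Drazin inverse of \<open>T\<close> as a limit.\<close>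

section \<open>The Hahn--Banach theorem\<close>

text \<open>The bicommutant is chosen because inverses and Drazin inverses commute with everything
  the element commutes with: for its members, both kinds of invertibility mean the same in this
  commutative algebra and in the whole one. Enlarging a proper ideal twice, once per operator, plays
  the role of a character. In the converse direction no homomorphism leads from operators on the
  maps \<open>U\<close> back to the factors. Only norm inequalities survive the passage to rank one
  operators, so Drazin invertibility has to be derived from an inequality. At an isolated spectral
  value the norm of the resolvent is at least the inverse distance; normalising vectors that it
  stretches gives approximate eigenvectors, and a dual construction gives approximate
  eigenfunctionals. Each makes one of the two multiplications negligible. Poles are translated into
  Drazin invertibility. The obstacle there is boundedness of the inverse, which comes from Baire
  category. Functionals serve to separate a vector from a subspace and to recover norms; the
  Hahn-Banach theorem supplies both kinds.\<close>

definition sublinear :: "('a::real_vector \<Rightarrow> real) \<Rightarrow> bool" where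
  "sublinear p \<longleftrightarrow> (\<forall>x y. p (x + y) \<le> p x + p y) \<and> (\<forall>r x. 0 \<le> r \<longrightarrow> p (r *\<^sub>R x) = r * p x)"

lemma sublinear_add: "sublinear p \<Longrightarrow> p (x + y) \<le> p x + p y"
  and sublinear_scaleR: "sublinear p \<Longrightarrow> 0 \<le> r \<Longrightarrow> p (r *\<^sub>R x) = r * p x"
  by (simp_all add: sublinear_def)

lemma sublinear_zero: "sublinear p \<Longrightarrow> p 0 = 0"
  using sublinear_scaleR[of p 0 0] by simp

lemma sublinear_minus: "sublinear p \<Longrightarrow> - p (- x) \<le> p x"
  using sublinear_add[of p x "- x"] sublinear_zero[of p] by simp

text \<open>Comparability of the members gives subadditivity: if \<open>q\<close> is nearly optimal
  at \<open>x\<close> and \<open>q'\<close> at \<open>y\<close>, the smaller of the two is at least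
  as good at both points.\<close>

lemma sublinear_INF:
  assumes "Q \<noteq> {}"
    and subl: "\<And>q. q \<in> Q \<Longrightarrow> sublinear q"
    and bdd: "\<And>x. bdd_below ((\<lambda>q. q x) ` Q)"
    and dir: "\<And>q q'. q \<in> Q \<Longrightarrow> q' \<in> Q \<Longrightarrow> q \<le> q' \<or> q' \<le> q"
  shows "sublinear (\<lambda>x. INF q\<in>Q. q x)" (is "sublinear ?u")
proof -
  have lower: "?u x \<le> q x" if "q \<in> Q" for q x
    by (rule cINF_lower[OF bdd that])
  have add: "?u (x + y) \<le> ?u x + ?u y" for x y
  proof -
    have "?u (x + y) \<le> q x + q' y" if "q \<in> Q" "q' \<in> Q" for q q'
    proof -
      obtain q'' where q'': "q'' \<in> Q" "q'' \<le> q" "q'' \<le> q'"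
        using dir[OF \<open>q \<in> Q\<close> \<open>q' \<in> Q\<close>] \<open>q \<in> Q\<close> \<open>q' \<in> Q\<close> by blast
      then show ?thesis
        using lower[OF q''(1), of "x + y"] sublinear_add[OF subl[OF q''(1)], of x y]
          le_funD[OF q''(2), of x] le_funD[OF q''(3), of y] by linarith
    qed
    then have "?u (x + y) - q x \<le> q' y" if "q \<in> Q" "q' \<in> Q" for q q'
      using that by (simp add: diff_le_eq add.commute[of "q' y"])
    then have "?u (x + y) - q x \<le> ?u y" if "q \<in> Q" for q
      using that by (intro cINF_greatest[OF assms(1)])
    then have "?u (x + y) - ?u y \<le> ?u x"
      by (intro cINF_greatest[OF assms(1)]) (simp add: algebra_simps)
    then show ?thesis by simp
  qed
  \<comment> \<open>An inequality for all positive factors is enough: applied to the factor 1/r it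
    yields the converse.\<close>
  have le: "?u (r *\<^sub>R x) \<le> r * ?u x" if "0 < r" for r x
  proof -
    have "?u (r *\<^sub>R x) / r \<le> ?u x"
    proof (rule cINF_greatest[OF assms(1)])
      fix q assume "q \<in> Q"
      then show "?u (r *\<^sub>R x) / r \<le> q x"
        using lower[of q "r *\<^sub>R x"] subl[of q] that sublinear_scaleR[of q r x]
        by (simp add: field_simps)
    qed
    then show ?thesis using that by (simp add: field_simps)
  qed
  have "?u (r *\<^sub>R x) = r * ?u x" if "0 \<le> r" for r x
  proof (cases "r = 0")
    case True
    have "(\<lambda>q. q 0) ` Q = {0}"
      using assms(1) sublinear_zero[OF subl] by (force simp: image_iff)
    then show ?thesis using True by simp
  next
    case False
    then have "?u x \<le> ?u (r *\<^sub>R x) / r"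
      using le[of "inverse r" "r *\<^sub>R x"] that by (simp add: field_simps)
    then show ?thesis
      using False that le[of r x] by (simp add: field_simps)
  qed
  with add show ?thesis by (auto simp: sublinear_def)
qed

text \<open>For sublinear \<open>p\<close> this is the one-sided directional derivative at
  \<open>x\<close> in the direction \<open>y\<close>: by homogeneity p(y + t x) - t p(x) is the
  difference quotient (p(x + y/t) - p(x)) / (1/t). Allowing t = 0 builds in the bound by
  \<open>p y\<close>.\<close>

definition tangent_sublinear :: "('a::real_vector \<Rightarrow> real) \<Rightarrow> 'a \<Rightarrow> 'a \<Rightarrow> real" where
  "tangent_sublinear p x y = (INF t\<in>{0..}. p (y + t *\<^sub>R x) - t * p x)"

lemma tangent_sublinear_lower:
  assumes "sublinear p" "0 \<le> t"
  shows "tangent_sublinear p x y \<le> p (y + t *\<^sub>R x) - t * p x"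
proof -
  have "- p (- y) \<le> p (y + s *\<^sub>R x) - s * p x" if "0 \<le> s" for s
    using sublinear_add[OF assms(1), of "y + s *\<^sub>R x" "- y"]
      sublinear_scaleR[OF assms(1) that, of x] by simp
  then have "bdd_below ((\<lambda>t. p (y + t *\<^sub>R x) - t * p x) ` {0..})"
    by (intro bdd_belowI2) auto
  then show ?thesis
    unfolding tangent_sublinear_def using assms(2) by (intro cINF_lower) auto
qed

lemma tangent_sublinear_greatest:
  assumes "\<And>t. 0 \<le> t \<Longrightarrow> c \<le> p (y + t *\<^sub>R x) - t * p x"
  shows "c \<le> tangent_sublinear p x y"
  unfolding tangent_sublinear_def by (intro cINF_greatest) (auto intro: assms)

lemma sublinear_tangent:
  assumes p: "sublinear p"
  shows "sublinear (tangent_sublinear p x)" (is "sublinear ?u")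
proof -
  have add: "?u (y + z) \<le> ?u y + ?u z" for y z
  proof -
    have *: "?u (y + z) \<le> (p (y + s *\<^sub>R x) - s * p x) + (p (z + t *\<^sub>R x) - t * p x)"
      if "0 \<le> s" "0 \<le> t" for s t
      using tangent_sublinear_lower[OF p, of "s + t" x "y + z"] that
        sublinear_add[OF p, of "y + s *\<^sub>R x" "z + t *\<^sub>R x"]
      by (simp add: algebra_simps)
    have "?u (y + z) - ?u z \<le> ?u y"
    proof (rule tangent_sublinear_greatest)
      fix s :: real assume "0 \<le> s"
      then have "?u (y + z) - (p (y + s *\<^sub>R x) - s * p x) \<le> ?u z"
        using * by (intro tangent_sublinear_greatest) (simp add: diff_le_eq add.commute)
      then show "?u (y + z) - ?u z \<le> p (y + s *\<^sub>R x) - s * p x" by simp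
    qed
    then show ?thesis by simp
  qed
  have le: "?u (r *\<^sub>R y) \<le> r * ?u y" if "0 < r" for r y
  proof -
    have "?u (r *\<^sub>R y) / r \<le> ?u y"
    proof (rule tangent_sublinear_greatest)
      fix t :: real assume "0 \<le> t"
      then have "?u (r *\<^sub>R y) \<le> p (r *\<^sub>R (y + t *\<^sub>R x)) - (r * t) * p x"
        using tangent_sublinear_lower[OF p, of "r * t" x "r *\<^sub>R y"] that
        by (simp add: scaleR_add_right)
      then show "?u (r *\<^sub>R y) / r \<le> p (y + t *\<^sub>R x) - t * p x"
        using that sublinear_scaleR[OF p, of r "y + t *\<^sub>R x"] by (simp add: field_simps)
    qed
    then show ?thesis using that by (simp add: field_simps)
  qed
  have "?u (r *\<^sub>R y) = r * ?u y" if "0 \<le> r" for r y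
  proof (cases "r = 0")
    case True
    have "?u 0 = 0"
      using tangent_sublinear_lower[OF p, of 0 x 0] sublinear_zero[OF p]
        tangent_sublinear_greatest[of 0 p 0 x] sublinear_scaleR[OF p, of _ x] by simp
    then show ?thesis using True by simp
  next
    case False
    then have "?u y \<le> ?u (r *\<^sub>R y) / r"
      using le[of "inverse r" "r *\<^sub>R y"] that by (simp add: field_simps)
    then show ?thesis
      using False that le[of r y] by (simp add: field_simps)
  qed
  with add show ?thesis by (auto simp: sublinear_def)
qed

text \<open>Zorn's lemma for the reversed pointwise order. The infimum of a nonempty chain is finite
  because a sublinear \<open>q\<close> below \<open>p\<close> satisfies q(x) \<ge> - q(- x) \<ge> -
  p(- x).\<close>

lemma minimal_sublinear_below:
  fixes p :: "'a::real_vector \<Rightarrow> real"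
  assumes p: "sublinear p"
  obtains q where "sublinear q" "q \<le> p" "\<And>q'. sublinear q' \<Longrightarrow> q' \<le> q \<Longrightarrow> q' = q"
proof -
  let ?A = "{q. sublinear q \<and> q \<le> p}"
  have "\<exists>m\<in>?A. \<forall>a\<in>?A. a \<le> m \<longrightarrow> a = m"
  proof (rule predicate_Zorn)
    show "partial_order_on ?A (relation_of (\<lambda>a b. b \<le> a) ?A)"
      by (rule partial_order_on_relation_ofI) auto
    fix C assume C: "C \<in> Chains (relation_of (\<lambda>a b. b \<le> a) ?A)"
    then have CA: "C \<subseteq> ?A" and total: "\<And>q q'. q \<in> C \<Longrightarrow> q' \<in> C \<Longrightarrow> q \<le> q' \<or> q' \<le> q"
      by (auto simp: Chains_def relation_of_def)
    show "\<exists>u\<in>?A. \<forall>a\<in>C. u \<le> a"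
    proof (cases "C = {}")
      case True
      then show ?thesis using p by auto
    next
      case False
      have low: "- p (- x) \<le> q x" if "q \<in> C" for q x
        using that CA sublinear_minus[of q x] le_funD[of q p "- x"] by force
      have bdd: "bdd_below ((\<lambda>q. q x) ` C)" for x
        using low by (intro bdd_belowI2)
      let ?u = "\<lambda>x. INF q\<in>C. q x"
      have u: "?u x \<le> q x" if "q \<in> C" for q x
        by (rule cINF_lower[OF bdd that])
      have "sublinear ?u"
        using False CA bdd total by (intro sublinear_INF) auto
      moreover have "?u \<le> p"
      proof (rule le_funI)
        fix x
        obtain q where "q \<in> C" using False by blast
        then show "?u x \<le> p x" using u[of q x] CA le_funD[of q p x] by force
      qed
      ultimately show ?thesis using u by (intro bexI[of _ ?u]) (auto intro: le_funI)
    qed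
  qed
  then obtain q where q: "sublinear q" "q \<le> p" and
    min: "\<And>a. sublinear a \<Longrightarrow> a \<le> p \<Longrightarrow> a \<le> q \<Longrightarrow> a = q" by blast
  have "q' = q" if "sublinear q'" "q' \<le> q" for q'
    using min[OF that(1) order_trans[OF that(2) q(2)] that(2)] .
  with q show ?thesis using that by blast
qed

text \<open>Every tangent functional of \<open>q\<close> lies below \<open>q\<close>, so it equals
  \<open>q\<close> by minimality. Its bound at - x with t = 1 then reads q(- x) \<le> - q(x); hence
  \<open>q\<close> is odd, and an odd sublinear functional is linear.\<close>

lemma minimal_sublinear_linear:
  assumes q: "sublinear q" and min: "\<And>q'. sublinear q' \<Longrightarrow> q' \<le> q \<Longrightarrow> q' = q"
  shows "linear q"
proof -
  have "tangent_sublinear q x = q" for x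
    using tangent_sublinear_lower[OF q, of 0 x]
    by (intro min sublinear_tangent q le_funI) simp
  then have "q (- x) \<le> - q x" for x
    using tangent_sublinear_lower[OF q, of 1 x "- x"] sublinear_zero[OF q] by simp
  then have neg: "q (- x) = - q x" for x
    using sublinear_minus[OF q, of x] by (smt (verit))
  show ?thesis
  proof
    show "q (x + y) = q x + q y" for x y
      using sublinear_add[OF q, of x y] sublinear_add[OF q, of "- x" "- y"] neg[of x] neg[of y]
        neg[of "x + y"] by simp
    show "q (r *\<^sub>R x) = r *\<^sub>R q x" for r x
    proof (cases "0 \<le> r")
      case True
      then show ?thesis using sublinear_scaleR[OF q True] by simp
    next
      case False
      then show ?thesis
        using sublinear_scaleR[OF q, of "- r" x] neg[of "r *\<^sub>R x"] by simp
    qed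
  qed
qed

text \<open>The minimal functional is taken below the tangent functional of \<open>p\<close> at
  \<open>x0\<close> instead of \<open>p\<close> itself. This forces q(- x0) \<le> - p(x0), and so
  equality at \<open>x0\<close>.\<close>

theorem Hahn_Banach_sublinear:
  fixes p :: "'a::real_vector \<Rightarrow> real"
  assumes p: "sublinear p"
  obtains f where "linear f" "\<And>x. f x \<le> p x" "f x0 = p x0"
proof -
  obtain q where q: "sublinear q" "q \<le> tangent_sublinear p x0"
    "\<And>q'. sublinear q' \<Longrightarrow> q' \<le> q \<Longrightarrow> q' = q"
    using minimal_sublinear_below[OF sublinear_tangent[OF p]] by metis
  have lin: "linear q" by (rule minimal_sublinear_linear[OF q(1,3)])
  have le: "q x \<le> p x" for x
    using le_funD[OF q(2), of x] tangent_sublinear_lower[OF p, of 0 x0 x] by simp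
  have "q (- x0) \<le> - p x0"
    using le_funD[OF q(2), of "- x0"] tangent_sublinear_lower[OF p, of 1 x0 "- x0"]
      sublinear_zero[OF p] by simp
  then have "q x0 = p x0"
    using le[of x0] linear_neg[OF lin, of x0] by simp
  then show ?thesis using that lin le by blast
qed

text \<open>Domination by the distance to \<open>M\<close> makes a linear functional vanish on
  \<open>M\<close>, while equality at one point keeps the distance there; both properties thus come
  from a single dominating functional.\<close>

lemma sublinear_infdist:
  fixes M :: "'a::real_normed_vector set"
  assumes M: "subspace M"
  shows "sublinear (\<lambda>x. infdist x M)"
proof -
  have ne: "M \<noteq> {}" using subspace_0[OF M] by blast
  have greatest: "c \<le> infdist x M" if "\<And>m. m \<in> M \<Longrightarrow> c \<le> norm (x - m)" for c x
    using that ne by (auto simp: infdist_def dist_norm intro: cINF_greatest)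
  have lower: "infdist x M \<le> norm (x - m)" if "m \<in> M" for x m
    using infdist_le[OF that, of x] by (simp add: dist_norm)
  have add: "infdist (x + y) M \<le> infdist x M + infdist y M" for x y
  proof -
    have *: "infdist (x + y) M \<le> norm (x - m) + norm (y - n)" if "m \<in> M" "n \<in> M" for m n
      using lower[OF subspace_add[OF M that], of "x + y"] norm_triangle_ineq[of "x - m" "y - n"]
      by (simp add: algebra_simps)
    have "infdist (x + y) M - infdist y M \<le> infdist x M"
    proof (rule greatest)
      fix m assume m: "m \<in> M"
      have "infdist (x + y) M - norm (x - m) \<le> infdist y M"
        using *[OF m] by (intro greatest) (simp add: diff_le_eq add.commute)
      then show "infdist (x + y) M - infdist y M \<le> norm (x - m)" by simp
    qed
    then show ?thesis by simp
  qed
  have le: "infdist (r *\<^sub>R x) M \<le> r * infdist x M" if "0 < r" for r x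
  proof -
    have "infdist (r *\<^sub>R x) M / r \<le> infdist x M"
    proof (rule greatest)
      fix m assume "m \<in> M"
      then have "infdist (r *\<^sub>R x) M \<le> norm (r *\<^sub>R x - r *\<^sub>R m)"
        by (intro lower subspace_scale[OF M])
      also have "\<dots> = r * norm (x - m)"
        using that by (metis norm_scaleR abs_of_pos scaleR_diff_right)
      finally show "infdist (r *\<^sub>R x) M / r \<le> norm (x - m)"
        using that by (simp add: field_simps)
    qed
    then show ?thesis using that by (simp add: field_simps)
  qed
  have "infdist (r *\<^sub>R x) M = r * infdist x M" if "0 \<le> r" for r x
  proof (cases "r = 0")
    case True
    then show ?thesis using subspace_0[OF M] by simp
  next
    case False
    then have "infdist x M \<le> infdist (r *\<^sub>R x) M / r"
      using le[of "inverse r" "r *\<^sub>R x"] that by (simp add: field_simps)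
    then show ?thesis
      using False that le[of r x] by (simp add: field_simps)
  qed
  with add show ?thesis by (auto simp: sublinear_def)
qed

section \<open>Complex functionals from real ones\<close>

instantiation complex :: complex_banach
begin

definition scaleC_complex :: "complex \<Rightarrow> complex \<Rightarrow> complex" where
  [simp]: "scaleC_complex c z = c * z"

instance
  by standard (simp_all add: algebra_simps norm_mult scaleR_conv_of_real)

end

lemma cblinfun_of_linear:
  assumes "\<And>x y. f (x + y) = f x + f y" and "\<And>c x. f (c *\<^sub>C x) = c *\<^sub>C f x"
    and "\<And>x. norm (f x) \<le> K * norm x"
  shows "capply (CBlinfun f) = f"
proof (rule CBlinfun_inverse)
  have "bounded_linear f"
  proof (rule bounded_linear_intro[where K = K])
    show "f (r *\<^sub>R x) = r *\<^sub>R f x" for r x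
      using assms(2)[of "of_real r" x] by (simp add: scaleC_of_real)
  qed (use assms in \<open>simp_all add: mult.commute\<close>)
  then show "f \<in> {f. bounded_linear f \<and> (\<forall>c x. f (c *\<^sub>C x) = c *\<^sub>C f x)}"
    using assms(2) by simp
qed

theorem Hahn_Banach_infdist:
  fixes M :: "'a::complex_normed_vector set"
  assumes M: "subspace M" "\<And>c x. x \<in> M \<Longrightarrow> c *\<^sub>C x \<in> M"
  obtains f :: "'a \<Rightarrow>\<^sub>C\<^sub>L complex"
  where "norm f \<le> 1" "\<And>x. x \<in> M \<Longrightarrow> capply f x = 0" "infdist x0 M \<le> norm (capply f x0)"
proof -
  obtain u where u: "linear u" "\<And>x. u x \<le> infdist x M" "u x0 = infdist x0 M"
    using Hahn_Banach_sublinear[OF sublinear_infdist[OF M(1)]] by metis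
  have le: "u x \<le> norm x" for x
    using u(2)[of x] infdist_le[OF subspace_0[OF M(1)], of x] by simp
  have u0: "u x = 0" if "x \<in> M" for x
    using u(2)[of x] u(2)[of "- x"] that subspace_neg[OF M(1) that] linear_neg[OF u(1), of x] by simp
  \<comment> \<open>The unique complex linear functional with real part \<open>u\<close>.\<close>
  define g where "g x = Complex (u x) (- u (\<i> *\<^sub>C x))" for x
  have sc: "u (c *\<^sub>C x) = Re c * u x + Im c * u (\<i> *\<^sub>C x)" for c x
  proof -
    have "c *\<^sub>C x = Re c *\<^sub>R x + Im c *\<^sub>R (\<i> *\<^sub>C x)"
      by (metis complex_eq mult.commute scaleC_add_left scaleC_of_real scaleC_scaleC)
    then show ?thesis by (simp add: linear_add[OF u(1)] linear_scale[OF u(1)])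
  qed
  have gadd: "g (x + y) = g x + g y" for x y
    by (simp add: g_def complex_eq_iff scaleC_add_right linear_add[OF u(1)])
  have gsc: "g (c *\<^sub>C x) = c *\<^sub>C g x" for c x
    using sc[of c x] sc[of "\<i> * c" x]
    by (simp add: g_def complex_eq_iff scaleC_scaleC algebra_simps)
  have gn: "norm (g x) \<le> 1 * norm x" for x
  proof (cases "g x = 0")
    case False
    \<comment> \<open>The unimodular factor that rotates \<open>g x\<close> onto the positive axis,
      where \<open>g\<close> agrees with its real part \<open>u\<close>.\<close>
    define c where "c = cnj (g x) / norm (g x)"
    have "c * g x = norm (g x)"
      using False by (simp add: c_def complex_norm_square[symmetric] mult.commute power2_eq_square divide_simps)
    then have "norm (g x) = u (c *\<^sub>C x)"
      using gsc[of c x] by (simp add: g_def complex_eq_iff)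
    also have "\<dots> \<le> norm (c *\<^sub>C x)" by (rule le)
    also have "\<dots> = norm x"
      using False by (simp add: norm_scaleC c_def norm_divide)
    finally show ?thesis by simp
  qed simp
  have cap: "capply (CBlinfun g) = g"
    using gadd gsc gn by (rule cblinfun_of_linear)
  show ?thesis
  proof
    show "norm (CBlinfun g) \<le> 1"
      using gn by (intro norm_cblinfun_bound) (simp_all add: cap)
    show "capply (CBlinfun g) x = 0" if "x \<in> M" for x
      using u0 M(2) that by (simp add: cap g_def complex_eq_iff)
    show "infdist x0 M \<le> norm (capply (CBlinfun g) x0)"
      using abs_Re_le_cmod[of "g x0"] u(3) by (simp add: cap g_def)
  qed
qed

corollary norming_functional:
  fixes x :: "'a::complex_normed_vector"
  obtains f :: "'a \<Rightarrow>\<^sub>C\<^sub>L complex" where "norm f \<le> 1" "norm (capply f x) = norm x"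
proof -
  obtain f :: "'a \<Rightarrow>\<^sub>C\<^sub>L complex" where f: "norm f \<le> 1" "infdist x {0} \<le> norm (capply f x)"
    using Hahn_Banach_infdist[of "{0 :: 'a}" x] by (auto simp: subspace_def)
  have "norm (capply f x) \<le> norm x"
    using norm_capply[of f x] mult_right_mono[OF f(1) norm_ge_zero, of x] by simp
  with f show ?thesis using that by simp
qed

corollary separating_functional:
  fixes M :: "'a::complex_normed_vector set"
  assumes "subspace M" "\<And>c x. x \<in> M \<Longrightarrow> c *\<^sub>C x \<in> M" "x0 \<notin> closure M"
  obtains f :: "'a \<Rightarrow>\<^sub>C\<^sub>L complex" where "\<And>x. x \<in> M \<Longrightarrow> capply f x = 0" "capply f x0 = 1"
proof -
  obtain f :: "'a \<Rightarrow>\<^sub>C\<^sub>L complex"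
    where f: "\<And>x. x \<in> M \<Longrightarrow> capply f x = 0" "infdist x0 M \<le> norm (capply f x0)"
    using Hahn_Banach_infdist[OF assms(1,2)] by metis
  have "0 < infdist x0 M"
    using assms(3) in_closure_iff_infdist_zero[of M x0] subspace_0[OF assms(1)]
      infdist_nonneg[of x0 M] by force
  then have "capply f x0 \<noteq> 0" using f(2) by auto
  then show ?thesis
    using f(1) by (intro that[of "inverse (capply f x0) *\<^sub>C f"]) (simp_all add: scaleC_cblinfun.rep_eq)
qed

section \<open>Range inclusion for bounded operators\<close>

lemma Baire_closed_cover:
  fixes A :: "nat \<Rightarrow> 'a::banach set"
  assumes "\<And>n. closed (A n)" and "(\<Union>n. A n) = UNIV"
  obtains n x r where "0 < r" "ball x r \<subseteq> A n"
proof -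
  have "\<exists>n. interior (A n) \<noteq> {}"
  proof (rule ccontr)
    assume "\<not> ?thesis"
    then have *: "\<And>n. interior (A n) = {}" by simp
    have "Met_TC.mtopology interior_of \<Union>(range A) = ({} :: 'a set)"
      using * assms(1)
      by (intro Met_TC.metric_Baire_category_alt) (auto simp: complete_UNIV interior_of_def interior_def)
    then show False
      using assms(2) by (auto simp: interior_of_def)
  qed
  then obtain n x where "x \<in> interior (A n)" by blast
  then show ?thesis
    using that by (auto simp: mem_interior)
qed

text \<open>The open mapping argument for a pair of operators: Baire's theorem gives approximate
  solutions \<open>w\<close> of controlled norm, and halving the error repeatedly makes them exact.
  It later bounds the Drazin inverse built from ascent and descent.\<close>

proposition range_inclusion_bound:
  fixes f :: "'a::banach \<Rightarrow> 'c::real_normed_vector" and g :: "'b::banach \<Rightarrow> 'c"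
  assumes f: "bounded_linear f" and g: "bounded_linear g" and incl: "\<And>x. \<exists>w. f x = g w"
  obtains C where "0 \<le> C" "\<And>x. \<exists>w. f x = g w \<and> norm w \<le> C * norm x"
proof -
  interpret f: bounded_linear f by (fact f)
  interpret g: bounded_linear g by (fact g)
  define A where "A n = {x. \<exists>w. norm w \<le> real n \<and> f x = g w}" for n
  have "x \<in> (\<Union>n. closure (A n))" for x
  proof -
    obtain w where w: "f x = g w" using incl by blast
    obtain n where "norm w \<le> real n" using real_arch_simple by blast
    then have "x \<in> A n" using w by (auto simp: A_def)
    then show ?thesis using closure_subset by blast
  qed
  then have cover: "(\<Union>n. closure (A n)) = UNIV" by blast
  obtain n x0 r where r: "0 < r" "ball x0 r \<subseteq> closure (A n)"
    by (rule Baire_closed_cover[OF _ cover]) simp_all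
  \<comment> \<open>A vector \<open>u\<close> is scaled to norm r/2, where a solution of norm at
    most 2n exists; scaling back multiplies by 2 |u| / r.\<close>
  define c where "c = 4 * real n / r"
  have c: "0 \<le> c" using r by (simp add: c_def)
  have near: "\<exists>a w. norm (u - a) \<le> \<epsilon> \<and> f a = g w \<and> norm w \<le> 2 * real n"
    if "norm u < r" "0 < \<epsilon>" for u \<epsilon>
  proof -
    \<comment> \<open>Subtracting an approximant of \<open>x0\<close> moves the centre of the ball
      to 0, at the price of doubling the bound n.\<close>
    have "x0 + u \<in> closure (A n)" "x0 \<in> closure (A n)"
      using r that by (auto simp: subset_iff dist_norm)
    then obtain a a' where a: "a \<in> A n" "dist a (x0 + u) < \<epsilon> / 2" "a' \<in> A n" "dist a' x0 < \<epsilon> / 2"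
      using \<open>0 < \<epsilon>\<close> by (meson closure_approachable half_gt_zero)
    then obtain w w' where w: "norm w \<le> n" "f a = g w" "norm w' \<le> n" "f a' = g w'"
      by (auto simp: A_def)
    have "u - (a - a') = (a' - x0) - (a - (x0 + u))" by simp
    then have "norm (u - (a - a')) \<le> norm (a' - x0) + norm (a - (x0 + u))"
      by (metis norm_triangle_ineq4)
    then have "norm (u - (a - a')) \<le> \<epsilon>"
      using a(2,4) unfolding dist_norm by linarith
    moreover have "norm (w - w') \<le> 2 * real n"
      using w norm_triangle_ineq4[of w w'] by simp
    moreover have "f (a - a') = g (w - w')"
      using w by (simp add: f.diff g.diff)
    ultimately show ?thesis by blast
  qed
  have "\<exists>a w. norm (u - a) \<le> norm u / 2 \<and> f a = g w \<and> norm w \<le> c * norm u" for u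
  proof (cases "u = 0")
    case True
    then show ?thesis
      by (intro exI[of _ 0]) (simp add: f.zero g.zero)
  next
    case False
    define s where "s = r / (2 * norm u)"
    have s: "0 < s" using False r by (simp add: s_def)
    have "norm (s *\<^sub>R u) < r" "0 < s * norm u / 2"
      using False r s by (simp_all add: s_def)
    then obtain a w where a: "norm (s *\<^sub>R u - a) \<le> s * norm u / 2" "f a = g w" "norm w \<le> 2 * real n"
      using near by blast
    have "u - inverse s *\<^sub>R a = inverse s *\<^sub>R (s *\<^sub>R u - a)"
      using s by (simp add: scaleR_diff_right)
    then have "norm (u - inverse s *\<^sub>R a) = inverse s * norm (s *\<^sub>R u - a)"
      using s by simp
    also have "\<dots> \<le> norm u / 2"
      using a(1) s by (simp add: field_simps)
    finally have 1: "norm (u - inverse s *\<^sub>R a) \<le> norm u / 2" .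
    have "norm (inverse s *\<^sub>R w) \<le> inverse s * (2 * real n)"
      using a(3) s by simp
    also have "\<dots> = c * norm u"
      using False r by (simp add: s_def c_def)
    finally have "norm (inverse s *\<^sub>R w) \<le> c * norm u" .
    then show ?thesis
      using 1 a(2) by (intro exI[of _ "inverse s *\<^sub>R a"] exI[of _ "inverse s *\<^sub>R w"])
        (simp add: f.scaleR g.scaleR)
  qed
  then obtain \<alpha> \<omega> where step: "\<And>u. norm (u - \<alpha> u) \<le> norm u / 2" "\<And>u. f (\<alpha> u) = g (\<omega> u)"
    "\<And>u. norm (\<omega> u) \<le> c * norm u"
    by metis
  have "\<exists>w. f x = g w \<and> norm w \<le> (2 * c) * norm x" for x
  proof -
    \<comment> \<open>\<open>X k\<close> is what remains of \<open>x\<close> after k corrections.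
      The errors are halved each time, so the corrections sum to at most \<open>c * norm x\<close>
      times the geometric sum 2.\<close>
    define X where "X k = ((\<lambda>u. u - \<alpha> u) ^^ k) x" for k
    have X: "X 0 = x" "X (Suc k) = X k - \<alpha> (X k)" for k
      by (simp_all add: X_def)
    have normX: "norm (X k) \<le> (1/2) ^ k * norm x" for k
    proof (induction k)
      case (Suc k)
      then show ?case using step(1)[of "X k"] by (simp add: X)
    qed (simp add: X)
    have geo: "(\<lambda>k. c * norm x * (1/2) ^ k) sums (c * norm x * 2)"
      using geometric_sums[of "1/2 :: real"] by (intro sums_mult) simp
    have le: "norm (\<omega> (X k)) \<le> c * norm x * (1/2) ^ k" for k
      using step(3)[of "X k"] mult_left_mono[OF normX[of k] c] by (simp add: mult_ac)
    have sumnorm: "summable (\<lambda>k. norm (\<omega> (X k)))"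
      using le by (intro summable_comparison_test'[OF sums_summable[OF geo]]) simp
    then have summ: "summable (\<lambda>k. \<omega> (X k))" by (rule summable_norm_cancel)
    define w where "w = (\<Sum>k. \<omega> (X k))"
    have "norm w \<le> (\<Sum>k. norm (\<omega> (X k)))"
      unfolding w_def by (rule summable_norm[OF sumnorm])
    also have "\<dots> \<le> c * norm x * 2"
      using suminf_le[OF le sumnorm sums_summable[OF geo]] sums_unique[OF geo] by simp
    finally have wn: "norm w \<le> (2 * c) * norm x" by (simp add: mult_ac)
    have part: "(\<Sum>k<m. g (\<omega> (X k))) = f x - f (X m)" for m
      by (induction m) (simp_all add: X f.diff step(2))
    have "X \<longlonglongrightarrow> 0"
    proof (rule Lim_null_comparison)
      show "\<forall>\<^sub>F k in sequentially. norm (X k) \<le> (1/2) ^ k * norm x"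
        using normX by simp
      show "(\<lambda>k. (1/2) ^ k * norm x) \<longlonglongrightarrow> 0"
        by (intro tendsto_mult_left_zero LIMSEQ_power_zero) simp
    qed
    then have "(\<lambda>m. f x - f (X m)) \<longlonglongrightarrow> f x - f 0"
      by (intro tendsto_intros f.tendsto)
    then have "(\<lambda>k. g (\<omega> (X k))) sums f x"
      by (simp add: sums_def part f.zero)
    moreover have "(\<lambda>k. g (\<omega> (X k))) sums g w"
      unfolding w_def by (rule g.sums[OF summable_sums[OF summ]])
    ultimately have "f x = g w" by (rule sums_unique2)
    then show ?thesis using wn by blast
  qed
  then show ?thesis using that[of "2 * c"] c by simp
qed

section \<open>Drazin invertibility in a complex Banach algebra\<close>

text \<open>The algebra may be trivial, since \<open>0 \<noteq> 1\<close> fails for the operators on the zero space.\<close>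

class complex_banach_algebra = complex_banach + real_normed_algebra + monoid_mult +
  assumes mult_scaleC_left [simp]: "(c *\<^sub>C x) * y = c *\<^sub>C (x * y)"
    and mult_scaleC_right [simp]: "x * (c *\<^sub>C y) = c *\<^sub>C (x * y)"
    and norm_one_le: "norm 1 \<le> 1"

definition inverse_pair :: "'a::monoid_mult \<Rightarrow> 'a \<Rightarrow> bool" where
  "inverse_pair x y \<longleftrightarrow> x * y = 1 \<and> y * x = 1"

definition drazin :: "'a::monoid_mult \<Rightarrow> bool" where
  "drazin x \<longleftrightarrow> (\<exists>s m. x ^ m = x ^ m * s * x \<and> s * x * s = s \<and> x * s = s * x)"

lemma inverse_pairD: "inverse_pair x y \<Longrightarrow> x * y = 1" "inverse_pair x y \<Longrightarrow> y * x = 1"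
  by (simp_all add: inverse_pair_def)

lemma inverse_pair_commute:
  assumes "inverse_pair x y" "z * x = x * z"
  shows "z * y = y * z"
proof -
  have "z * y = y * x * z * y" using assms(1) by (simp add: inverse_pair_def)
  also have "\<dots> = y * (z * x) * y" using assms(2) by (simp add: mult.assoc)
  also have "\<dots> = y * z" using assms(1) by (simp add: inverse_pair_def mult.assoc)
  finally show ?thesis .
qed

text \<open>The last conclusion is recorded because substituting it for the inverse gives expansions
  with an explicit remainder; the derivative of a resolvent is read off from them.\<close>

lemma neumann_series:
  fixes x :: "'a::complex_banach_algebra"
  assumes x: "norm x < 1"
  obtains y where "inverse_pair (1 - x) y" "norm y \<le> 1 / (1 - norm x)" "y = 1 + x * y"
proof -
  have npow: "norm (x ^ n) \<le> norm x ^ n" for n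
  proof (induction n)
    case (Suc n)
    then show ?case
      using norm_mult_ineq[of x "x ^ n"] mult_left_mono[OF Suc norm_ge_zero[of x]] by simp
  qed (simp add: norm_one_le)
  have summ: "summable (\<lambda>n. x ^ n)"
    by (rule summable_comparison_test'[of "\<lambda>n. norm x ^ n" 0]) (use x npow in auto)
  define y where "y = (\<Sum>n. x ^ n)"
  have sums: "(\<lambda>n. x ^ n) sums y" unfolding y_def by (rule summable_sums[OF summ])
  have "(\<lambda>n. x ^ Suc n - x ^ n) sums (0 - x ^ 0)"
    by (intro telescope_sums summable_LIMSEQ_zero[OF summ])
  from sums_minus[OF this] have tele: "(\<lambda>n. x ^ n - x ^ Suc n) sums 1" by simp
  have "(\<lambda>n. (1 - x) * x ^ n) sums ((1 - x) * y)"
    by (rule bounded_linear.sums[OF bounded_linear_mult_right sums])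
  then have 1: "(1 - x) * y = 1"
    using sums_unique2[OF _ tele] by (simp add: left_diff_distrib)
  have "(\<lambda>n. x ^ n * (1 - x)) sums (y * (1 - x))"
    by (rule bounded_linear.sums[OF bounded_linear_mult_left sums])
  then have 2: "y * (1 - x) = 1"
    using sums_unique2[OF _ tele] by (simp add: right_diff_distrib power_commutes)
  have yx: "y = 1 + x * y" using 1 by (simp add: algebra_simps)
  then have "norm y \<le> norm (1 :: 'a) + norm (x * y)" by (metis norm_triangle_ineq)
  also have "\<dots> \<le> 1 + norm x * norm y" by (intro add_mono norm_one_le norm_mult_ineq)
  finally have "norm y \<le> 1 / (1 - norm x)"
    using x by (simp add: field_simps)
  then show ?thesis using that 1 2 yx by (simp add: inverse_pair_def)
qed

lemma neumann_perturbation: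
  fixes x :: "'a::complex_banach_algebra"
  assumes xy: "inverse_pair x y" and d: "norm d * norm y < 1"
  shows "\<exists>z. inverse_pair (x - d) z"
proof -
  have "norm (y * d) < 1"
    using d norm_mult_ineq[of y d] by (simp add: mult.commute)
  then obtain z where z: "inverse_pair (1 - y * d) z"
    by (rule neumann_series)
  have eq: "x - d = x * (1 - y * d)"
    using xy by (simp add: inverse_pair_def right_diff_distrib mult.assoc[symmetric])
  have "x * (1 - y * d) * (z * y) = x * ((1 - y * d) * z) * y" by (simp only: mult.assoc)
  moreover have "(z * y) * (x * (1 - y * d)) = z * (y * x) * (1 - y * d)" by (simp only: mult.assoc)
  ultimately have "inverse_pair (x - d) (z * y)"
    using xy z unfolding eq by (simp add: inverse_pair_def)
  then show ?thesis ..
qed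

lemma commuting_powers:
  assumes "x * s = s * (x :: 'a::monoid_mult)"
  shows "x ^ i * s ^ j = s ^ j * x ^ i"
  by (intro power_commuting_commutes power_commuting_commutes[symmetric] assms[symmetric])

section \<open>Drazin inverses\<close>

text \<open>Iterating the equation gives x^m = x^(m+k) s^k, so x^m s^(m+1) inherits the divisibility
  and in addition satisfies the reflexivity law that \<open>s\<close> may violate.\<close>

lemma drazinI:
  fixes x :: "'a::monoid_mult"
  assumes comm: "x * s = s * x" and eq: "x ^ m = x ^ Suc m * s"
  shows "drazin x"
proof -
  have pow: "x ^ m = x ^ (m + k) * s ^ k" for k
  proof (induction k)
    case (Suc k)
    have "x ^ (m + Suc k) = x ^ k * x ^ Suc m"
      by (simp only: power_add[symmetric] add_Suc_right add.commute)
    then have "x ^ (m + Suc k) * s ^ Suc k = x ^ k * (x ^ Suc m * s) * s ^ k"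
      by (simp only: mult.assoc power_Suc[of s])
    also have "\<dots> = x ^ k * x ^ m * s ^ k"
      by (simp only: eq[symmetric])
    also have "\<dots> = x ^ m"
      by (simp only: power_add[symmetric] add.commute[of k] Suc[symmetric])
    finally show ?case ..
  qed simp
  define D where "D = x ^ m * s ^ Suc m"
  have xD: "x * D = D * x"
  proof -
    have "x * s ^ Suc m = s ^ Suc m * x"
      using commuting_powers[OF comm, of 1 "Suc m"] by simp
    then show ?thesis unfolding D_def
      by (metis mult.assoc power_commutes)
  qed
  have "x ^ m * D * x = x ^ m * x * D"
    using xD by (simp add: mult.assoc)
  also have "\<dots> = x ^ (m + Suc m) * s ^ Suc m"
    by (simp add: D_def power_add mult.assoc power_commutes)
  also have "\<dots> = x ^ m" by (rule pow[symmetric])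
  finally have 1: "x ^ m = x ^ m * D * x" ..
  have "D * x * D = s ^ Suc m * (x ^ m * D * x)"
    using xD commuting_powers[OF comm, of m "Suc m"] by (metis D_def mult.assoc)
  also have "\<dots> = D"
    unfolding 1[symmetric] by (simp only: D_def commuting_powers[OF comm, of m "Suc m"])
  finally show ?thesis
    unfolding drazin_def using 1 xD by blast
qed

lemma drazinE:
  assumes "drazin x"
  obtains s m where "x ^ m = x ^ m * s * x" "s * x * s = s" "x * s = s * x"
  using assms unfolding drazin_def by blast

lemma drazin_idempotent_power:
  fixes x :: "'a::monoid_mult"
  assumes "s * x * s = s" "x * s = s * x"
  shows "x * s = x ^ Suc n * s ^ Suc n"
proof (induction n)
  case (Suc n)
  have "x ^ Suc (Suc n) * s ^ Suc (Suc n) = x * (x ^ Suc n * s ^ Suc n) * s"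
    by (simp add: mult.assoc power_commutes)
  also have "\<dots> = x * (s * x * s)"
    using assms Suc by (simp add: mult.assoc)
  also have "\<dots> = x * s" using assms by simp
  finally show ?case ..
qed simp

text \<open>The idempotent p = x s is divisible by x^m on both sides, whereas 1 - p is annihilated
  by x^m on both sides. As \<open>r\<close> commutes with x^m, its off-diagonal corners with respect
  to \<open>p\<close> vanish; so \<open>r\<close> commutes with \<open>p\<close>, and then with
  \<open>s\<close>.\<close>

lemma drazin_inverse_commute:
  fixes x :: "'a::{ring, monoid_mult}"
  assumes x: "x ^ m = x ^ m * s * x" "s * x * s = s" "x * s = s * x"
    and r: "r * x = x * r"
  shows "r * s = s * r"
proof -
  define p where "p = x * s"
  have p: "p = x ^ m * (x * s ^ Suc m)" "p = (s ^ Suc m * x) * x ^ m"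
  proof -
    show 1: "p = x ^ m * (x * s ^ Suc m)"
      unfolding p_def drazin_idempotent_power[OF x(2,3), of m]
      by (simp add: mult.assoc[symmetric] power_commutes)
    show "p = (s ^ Suc m * x) * x ^ m"
      using commuting_powers[OF x(3), of "Suc m" "Suc m"]
      unfolding p_def drazin_idempotent_power[OF x(2,3), of m]
      by (simp add: mult.assoc)
  qed
  have rx: "r * x ^ m = x ^ m * r"
    using commuting_powers[of r x 1 m] r by simp
  have e: "x ^ m * (1 - p) = 0"
    using x by (simp add: p_def right_diff_distrib mult.assoc)
  have e': "(1 - p) * x ^ m = 0"
  proof -
    have "p * x ^ m = x ^ m * p"
      using x(3) commuting_powers[of x s m 1] unfolding p_def
      by (metis mult.assoc power_commutes power_one_right)
    then show ?thesis using e by (simp add: algebra_simps)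
  qed
  have "(1 - p) * r * p = (1 - p) * (r * x ^ m) * (x * s ^ Suc m)"
    by (subst p(1)) (simp only: mult.assoc)
  also have "\<dots> = ((1 - p) * x ^ m) * r * (x * s ^ Suc m)" by (simp only: rx mult.assoc)
  finally have 1: "r * p = p * r * p" using e' by (simp add: left_diff_distrib)
  have "p * r * (1 - p) = (s ^ Suc m * x) * (x ^ m * r) * (1 - p)"
    by (subst p(2)) (simp only: mult.assoc)
  also have "\<dots> = (s ^ Suc m * x) * r * (x ^ m * (1 - p))" by (simp only: rx[symmetric] mult.assoc)
  finally have "p * r = p * r * p" using e by (simp add: right_diff_distrib)
  with 1 have pr: "r * p = p * r" by simp
  have ps: "p * s = s" "s * p = s" using x by (simp_all add: p_def mult.assoc)
  have "r * s = r * p * s" using ps by (simp add: mult.assoc)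
  also have "\<dots> = p * r * s" by (simp only: pr)
  also have "\<dots> = s * (x * r) * s" using x(3) by (simp add: p_def mult.assoc)
  also have "\<dots> = s * (r * p)" by (simp only: r[symmetric] p_def mult.assoc)
  also have "\<dots> = s * r" using ps by (simp add: pr mult.assoc[symmetric])
  finally show ?thesis .
qed

text \<open>Since \<open>x\<close> acts nilpotently on \<open>v\<close>, the shift x - \<mu> can be
  inverted there: solve first for x v, then use v = (x v - (x - \<mu>) v) / \<mu>.\<close>

lemma shifted_nilpotent_solve:
  fixes x :: "'a::complex_banach_algebra"
  assumes "\<mu> \<noteq> 0" and "x ^ n * v = 0" and "x * v = v * x"
  shows "\<exists>q. (x - \<mu> *\<^sub>C 1) * q = v \<and> x * q = q * x"
  using assms(2,3)
proof (induction n arbitrary: v)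
  case 0
  then show ?case by (intro exI[of _ 0]) simp
next
  case (Suc n)
  have "x ^ n * (x * v) = 0"
    using Suc.prems(1) by (simp add: mult.assoc[symmetric] power_commutes)
  moreover have "x * (x * v) = x * v * x"
    using Suc.prems(2) by (metis mult.assoc)
  ultimately obtain q where q: "(x - \<mu> *\<^sub>C 1) * q = x * v" "x * q = q * x"
    using Suc.IH by blast
  have "(x - \<mu> *\<^sub>C 1) * (inverse \<mu> *\<^sub>C (q - v)) = inverse \<mu> *\<^sub>C (x * v - (x - \<mu> *\<^sub>C 1) * v)"
    using q(1) by (simp only: mult_scaleC_right right_diff_distrib)
  also have "\<dots> = v"
    using assms(1) by (simp add: left_diff_distrib scaleC_scaleC)
  finally show ?case
    using q(2) Suc.prems(2)
    by (intro exI[of _ "inverse \<mu> *\<^sub>C (q - v)"]) (simp add: algebra_simps)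
qed

text \<open>The resolvent is assembled from two pieces: s (1 - \<mu> s)^(-1) on the range of the
  idempotent x s, and the solution for the nilpotent part on that of e = 1 - x s. The radius 1 /
  (|s| + 1) makes the Neumann series converge even when s = 0 is possible.\<close>

proposition drazin_punctured_resolvent:
  fixes x :: "'a::complex_banach_algebra"
  assumes "drazin x"
  obtains \<epsilon> where "0 < \<epsilon>" "\<And>\<mu>. \<mu> \<noteq> 0 \<Longrightarrow> norm \<mu> < \<epsilon> \<Longrightarrow> \<exists>y. inverse_pair (x - \<mu> *\<^sub>C 1) y"
proof -
  obtain s m where s: "x ^ m = x ^ m * s * x" "s * x * s = s" "x * s = s * x"
    using assms by (rule drazinE)
  define e where "e = 1 - x * s"
  have e: "x ^ m * e = 0" "x * e = e * x" "s * e = 0"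
    using s by (simp_all add: e_def algebra_simps) (metis mult.assoc)+
  have "\<exists>y. inverse_pair (x - \<mu> *\<^sub>C 1) y" if \<mu>: "\<mu> \<noteq> 0" "norm \<mu> < 1 / (norm s + 1)" for \<mu>
  proof -
    have "norm \<mu> * (norm s + 1) < 1"
      using \<mu>(2) norm_ge_zero[of s] by (simp add: pos_less_divide_eq)
    then have "norm \<mu> * norm s < 1"
      using norm_ge_zero[of \<mu>] unfolding distrib_left by linarith
    then obtain N where N: "inverse_pair (1 - \<mu> *\<^sub>C s) N"
      using neumann_series[of "\<mu> *\<^sub>C s"] by (auto simp: norm_scaleC)
    have eN: "e * N = e"
    proof -
      have "e * s = 0" using s by (simp add: e_def left_diff_distrib)
      then have "e * (1 - \<mu> *\<^sub>C s) = e" by (simp add: right_diff_distrib)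
      then show ?thesis using N by (metis inverse_pair_def mult.assoc mult_1_right)
    qed
    have xN: "x * N = N * x"
      using s(3) by (intro inverse_pair_commute[OF N]) (simp add: algebra_simps)
    obtain q where q: "(x - \<mu> *\<^sub>C 1) * q = e" "x * q = q * x"
      using shifted_nilpotent_solve[OF \<mu>(1) e(1,2)] by blast
    have "(x - \<mu> *\<^sub>C 1) * (s * N) = ((1 - \<mu> *\<^sub>C s) - e) * N"
      by (simp add: e_def algebra_simps)
    also have "\<dots> = 1 - e" using N eN by (simp add: left_diff_distrib[of _ e] inverse_pair_def)
    finally have r: "(x - \<mu> *\<^sub>C 1) * (s * N + q) = 1"
      using q by (simp add: distrib_left)
    have "x * (s * N + q) = (s * N + q) * x"
      using xN s(3) q(2) by (simp add: algebra_simps) (metis mult.assoc)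
    then have "(s * N + q) * (x - \<mu> *\<^sub>C 1) = (x - \<mu> *\<^sub>C 1) * (s * N + q)"
      by (simp add: algebra_simps)
    then show ?thesis using r by (auto simp: inverse_pair_def)
  qed
  moreover have "0 < 1 / (norm s + 1)"
    by (simp add: add_nonneg_pos)
  ultimately show ?thesis using that by blast
qed

section \<open>Drazin inverses as limits of resolvents\<close>

lemma inverse_pair_resolvent_comm:
  fixes x :: "'a::complex_banach_algebra"
  assumes "inverse_pair (x - \<mu> *\<^sub>C 1) R" "w * x = x * w"
  shows "w * R = R * w"
  by (rule inverse_pair_commute[OF assms(1)]) (simp add: algebra_simps assms(2))

text \<open>Because x R = 1 + \<mu> R, the right side of \<open>K\<close> is at most K times |x^n w|
  + |\<mu>| |x^n R w|; the smallness of K |\<mu>| lets the left side absorb the second term.\<close>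

lemma power_mult_resolvent_bound:
  fixes x :: "'a::complex_banach_algebra"
  assumes R: "inverse_pair (x - \<mu> *\<^sub>C 1) R"
    and K: "norm (x ^ n * (R * w)) \<le> K * norm (x ^ Suc n * (R * w))"
    and K0: "0 \<le> K" and \<mu>: "K * norm \<mu> \<le> 1 / 2"
  shows "norm (x ^ n * (R * w)) \<le> 2 * K * norm (x ^ n * w)"
proof -
  have "x * R = 1 + \<mu> *\<^sub>C R"
    using inverse_pairD(1)[OF R] by (simp add: algebra_simps)
  then have "x ^ Suc n * (R * w) = x ^ n * w + \<mu> *\<^sub>C (x ^ n * (R * w))"
    by (simp only: power_Suc2 mult.assoc mult.assoc[of x R w, symmetric])
      (simp add: distrib_left distrib_right)
  then have "norm (x ^ Suc n * (R * w)) \<le> norm (x ^ n * w) + norm \<mu> * norm (x ^ n * (R * w))"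
    by (metis norm_scaleC norm_triangle_ineq)
  from mult_left_mono[OF this K0]
  have "norm (x ^ n * (R * w)) \<le> K * norm (x ^ n * w) + (K * norm \<mu>) * norm (x ^ n * (R * w))"
    using K by (simp add: algebra_simps)
  also have "\<dots> \<le> K * norm (x ^ n * w) + 1 / 2 * norm (x ^ n * (R * w))"
    by (intro add_left_mono mult_right_mono \<mu> norm_ge_zero)
  finally show ?thesis by simp
qed

text \<open>The bound on \<open>x ^ n * w\<close> makes \<open>x ^ n * R k ^ j\<close> bounded in \<open>k\<close> for every \<open>j\<close>, hence
  \<open>x ^ n * R k ^ Suc n\<close> a Cauchy sequence; its limit replaces the Drazin inverse that one would
  otherwise obtain from a Riesz projection.\<close>

proposition drazin_of_resolvent_sequence:
  fixes x :: "'a::complex_banach_algebra" and R :: "nat \<Rightarrow> 'a"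
  assumes R: "\<And>k. inverse_pair (x - \<mu> k *\<^sub>C 1) (R k)" and \<mu>: "\<mu> \<longlonglongrightarrow> 0"
    and K: "0 \<le> K" "\<And>w. w * x = x * w \<Longrightarrow> norm (x ^ n * w) \<le> K * norm (x ^ Suc n * w)"
  shows "drazin x"
proof -
  have Rx: "R k * x = x * R k" for k
    using inverse_pair_resolvent_comm[OF R, of x k] by simp
  have RR: "R k * R l = R l * R k" for k l
    using inverse_pair_resolvent_comm[OF R Rx] by simp
  have xR: "x * R k = 1 + \<mu> k *\<^sub>C R k" for k
    using inverse_pairD(1)[OF R[of k]] by (simp add: algebra_simps)
  have res: "R k - R l = (\<mu> k - \<mu> l) *\<^sub>C (R k * R l)" for k l
  proof -
    have "R k - R l = R k * (x * R l - \<mu> l *\<^sub>C R l) - R k * x * R l + \<mu> k *\<^sub>C (R k * R l)"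
      by (simp only: Rx xR) (simp add: distrib_right)
    then show ?thesis
      by (simp add: right_diff_distrib mult.assoc complex_vector.scale_left_diff_distrib)
  qed
  have "(\<lambda>k. K * norm (\<mu> k)) \<longlonglongrightarrow> K * norm (0 :: complex)"
    by (intro tendsto_intros \<mu>)
  then have "\<forall>\<^sub>F k in sequentially. K * norm (\<mu> k) < 1 / 2"
    by (intro order_tendstoD(2)) auto
  then obtain k0 where k0: "\<And>k. k \<ge> k0 \<Longrightarrow> K * norm (\<mu> k) \<le> 1 / 2"
    by (auto simp: eventually_sequentially intro: less_imp_le)
  have bound: "norm (x ^ n * (R k * w)) \<le> 2 * K * norm (x ^ n * w)"
    if "k \<ge> k0" "w * x = x * w" for k w
  proof (rule power_mult_resolvent_bound[OF R _ K(1) k0[OF that(1)]])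
    have "R k * w * x = x * (R k * w)"
      by (metis Rx mult.assoc that(2))
    then show "norm (x ^ n * (R k * w)) \<le> K * norm (x ^ Suc n * (R k * w))"
      by (rule K(2))
  qed
  have Rpx: "R k ^ i * x = x * R k ^ i" for k i
    by (rule power_commuting_commutes[OF Rx])
  define N where "N = norm (x ^ n)"
  have pow_bound: "norm (x ^ n * R k ^ i) \<le> (2 * K) ^ i * N" if "k \<ge> k0" for k i
  proof (induction i)
    case (Suc i)
    then show ?case
      using bound[OF that Rpx, of k i] mult_left_mono[OF Suc, of "2 * K"] K(1)
      by (simp add: mult.assoc)
  qed (simp add: N_def)
  \<comment> \<open>Induction along R_k^(i+1) - R_l^(i+1) = R_k (R_k^i - R_l^i) + (R_k - R_l) R_l^i:
    \<open>bound\<close> controls the first summand, and the resolvent identity \<open>res\<close>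
    extracts \<mu>_k - \<mu>_l from the second.\<close>
  have diff_bound: "\<exists>C. \<forall>k\<ge>k0. \<forall>l\<ge>k0. norm (x ^ n * (R k ^ i - R l ^ i)) \<le> C * norm (\<mu> k - \<mu> l)" for i
  proof (induction i)
    case 0
    then show ?case by (intro exI[of _ 0]) simp
  next
    case (Suc i)
    then obtain C where C: "\<And>k l. k \<ge> k0 \<Longrightarrow> l \<ge> k0 \<Longrightarrow> norm (x ^ n * (R k ^ i - R l ^ i)) \<le> C * norm (\<mu> k - \<mu> l)"
      by blast
    have "norm (x ^ n * (R k ^ Suc i - R l ^ Suc i)) \<le> (2 * K * C + (2 * K) ^ Suc (Suc i) * N) * norm (\<mu> k - \<mu> l)"
      if kl: "k \<ge> k0" "l \<ge> k0" for k l
    proof -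
      have "R k ^ Suc i - R l ^ Suc i = R k * (R k ^ i - R l ^ i) + (R k - R l) * R l ^ i"
        by (simp add: algebra_simps)
      also have "\<dots> = R k * (R k ^ i - R l ^ i) + (\<mu> k - \<mu> l) *\<^sub>C (R k * R l ^ Suc i)"
        by (simp add: res mult.assoc)
      finally have "x ^ n * (R k ^ Suc i - R l ^ Suc i)
          = x ^ n * (R k * (R k ^ i - R l ^ i)) + (\<mu> k - \<mu> l) *\<^sub>C (x ^ n * (R k * R l ^ Suc i))"
        by (simp only: distrib_left mult_scaleC_right)
      then have "norm (x ^ n * (R k ^ Suc i - R l ^ Suc i))
          \<le> norm (x ^ n * (R k * (R k ^ i - R l ^ i))) + norm (\<mu> k - \<mu> l) * norm (x ^ n * (R k * R l ^ Suc i))"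
        by (simp only: norm_scaleC[symmetric] norm_triangle_ineq)
      also have "\<dots> \<le> 2 * K * (C * norm (\<mu> k - \<mu> l)) + norm (\<mu> k - \<mu> l) * (2 * K * ((2 * K) ^ Suc i * N))"
      proof (intro add_mono mult_left_mono norm_ge_zero)
        have "(R k ^ i - R l ^ i) * x = x * (R k ^ i - R l ^ i)"
          by (simp add: algebra_simps Rpx)
        from bound[OF kl(1) this]
        show "norm (x ^ n * (R k * (R k ^ i - R l ^ i))) \<le> 2 * K * (C * norm (\<mu> k - \<mu> l))"
          using mult_left_mono[OF C[OF kl], of "2 * K"] K(1) by simp
        show "norm (x ^ n * (R k * R l ^ Suc i)) \<le> 2 * K * ((2 * K) ^ Suc i * N)"
          by (rule order_trans[OF bound[OF kl(1) Rpx] mult_left_mono[OF pow_bound[OF kl(2)]]])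
            (use K(1) in simp)
      qed
      finally show ?thesis by (simp add: algebra_simps)
    qed
    then show ?case by blast
  qed
  \<comment> \<open>The factor x R_k differs from 1 by \<mu>_k R_k. The resolvents themselves may
    blow up, so the comparison is made after multiplication by x^n.\<close>
  have near_one: "\<exists>C. \<forall>k\<ge>k0. norm (x ^ n * ((x * R k) ^ j - 1)) \<le> C * norm (\<mu> k)" for j
  proof (induction j)
    case 0
    then show ?case by (intro exI[of _ 0]) simp
  next
    case (Suc j)
    then obtain C where C: "\<And>k. k \<ge> k0 \<Longrightarrow> norm (x ^ n * ((x * R k) ^ j - 1)) \<le> C * norm (\<mu> k)"
      by blast
    have "norm (x ^ n * ((x * R k) ^ Suc j - 1)) \<le> (C + C + 2 * K * N) * norm (\<mu> k)"
      if k: "k \<ge> k0" for k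
    proof -
      let ?w = "(x * R k) ^ j - 1"
      have wx: "?w * x = x * ?w"
      proof -
        have "(x * R k) * x = x * (x * R k)" by (simp add: mult.assoc Rx)
        then have "(x * R k) ^ j * x = x * (x * R k) ^ j" by (rule power_commuting_commutes)
        then show ?thesis by (simp add: algebra_simps)
      qed
      have "(x * R k) ^ Suc j - 1 = (x * R k) * ?w + (x * R k - 1)"
        by (simp add: algebra_simps)
      also have "\<dots> = ?w + \<mu> k *\<^sub>C (R k * ?w) + \<mu> k *\<^sub>C (R k * 1)"
        by (subst (1 3) xR) (simp add: algebra_simps)
      finally have "x ^ n * ((x * R k) ^ Suc j - 1)
          = x ^ n * ?w + \<mu> k *\<^sub>C (x ^ n * (R k * ?w)) + \<mu> k *\<^sub>C (x ^ n * (R k * 1))"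
        by (simp only: distrib_left mult_scaleC_right)
      then have "norm (x ^ n * ((x * R k) ^ Suc j - 1))
          \<le> norm (x ^ n * ?w) + norm (\<mu> k) * norm (x ^ n * (R k * ?w)) + norm (\<mu> k) * norm (x ^ n * (R k * 1))"
        by (metis (no_types, lifting) norm_triangle_le norm_triangle_ineq add_right_mono norm_scaleC)
      also have "\<dots> \<le> C * norm (\<mu> k) + norm (\<mu> k) * (2 * K * (C * norm (\<mu> k))) + norm (\<mu> k) * (2 * K * N)"
      proof (intro add_mono mult_left_mono norm_ge_zero)
        show "norm (x ^ n * ?w) \<le> C * norm (\<mu> k)" by (rule C[OF k])
        show "norm (x ^ n * (R k * ?w)) \<le> 2 * K * (C * norm (\<mu> k))"
          using bound[OF k wx] mult_left_mono[OF C[OF k], of "2 * K"] K(1) by simp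
        show "norm (x ^ n * (R k * 1)) \<le> 2 * K * N"
          using bound[OF k, of 1] by (simp add: N_def)
      qed
      also have "norm (\<mu> k) * (2 * K * (C * norm (\<mu> k))) = (2 * (K * norm (\<mu> k))) * (C * norm (\<mu> k))"
        by simp
      \<comment> \<open>For k \<ge> k0 the factor 2 K |\<mu>_k| is at most 1, so the quadratic term
        is absorbed into the linear one.\<close>
      also have "\<dots> \<le> 1 * (C * norm (\<mu> k))"
        using k0[OF k] norm_ge_zero[of "x ^ n * ?w"] C[OF k] by (intro mult_right_mono) linarith+
      finally show ?thesis by (simp add: algebra_simps)
    qed
    then show ?case by blast
  qed
  \<comment> \<open>The exponent n + 1 is chosen so that x^(n+1) d_k = x^n (x R_k)^(n+1), which
    tends to x^n.\<close>
  define d where "d k = x ^ n * R k ^ Suc n" for k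
  have "Cauchy d"
  proof -
    obtain C where C: "\<And>k l. k \<ge> k0 \<Longrightarrow> l \<ge> k0 \<Longrightarrow> norm (d k - d l) \<le> C * norm (\<mu> k - \<mu> l)"
      using diff_bound[of "Suc n"] by (auto simp: d_def right_diff_distrib)
    \<comment> \<open>The constant \<open>C\<close> may be zero or negative; a positive one is
      required for the division below.\<close>
    have C': "norm (d k - d l) \<le> (\<bar>C\<bar> + 1) * norm (\<mu> k - \<mu> l)" if "k \<ge> k0" "l \<ge> k0" for k l
      using C[OF that] by (rule order_trans) (intro mult_right_mono, auto)
    show ?thesis
    proof (rule CauchyI)
      fix e :: real assume "0 < e"
      then have "0 < e / (\<bar>C\<bar> + 1)" by simp
      then obtain M where M: "\<And>k l. k \<ge> M \<Longrightarrow> l \<ge> M \<Longrightarrow> norm (\<mu> k - \<mu> l) < e / (\<bar>C\<bar> + 1)"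
        using CauchyD[OF LIMSEQ_imp_Cauchy[OF \<mu>]] by blast
      have "norm (d k - d l) < e" if "k \<ge> max M k0" "l \<ge> max M k0" for k l
        using C'[of k l] M[of k l] that by (simp add: field_simps)
      then show "\<exists>M. \<forall>k\<ge>M. \<forall>l\<ge>M. norm (d k - d l) < e" by blast
    qed
  qed
  then obtain D where D: "d \<longlonglongrightarrow> D"
    using Cauchy_convergent_iff convergent_def by blast
  have dx: "x * d k = d k * x" for k
    unfolding d_def by (simp only: mult.assoc Rpx) (simp only: mult.assoc[symmetric] power_commutes)
  have "(\<lambda>k. x * d k) \<longlonglongrightarrow> D * x"
    unfolding dx by (intro tendsto_intros D)
  then have comm: "x * D = D * x"
    using LIMSEQ_unique[OF tendsto_mult[OF tendsto_const D]] by blast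
  have "(\<lambda>k. x ^ Suc n * d k - x ^ n) \<longlonglongrightarrow> 0"
  proof -
    have "x ^ Suc n * d k - x ^ n = x ^ n * ((x * R k) ^ Suc n - 1)" for k
    proof -
      have "(x * R k) ^ m = x ^ m * R k ^ m" for m
      proof (induction m)
        case (Suc m)
        have "(x * R k) ^ Suc m = x * (R k * x ^ m) * R k ^ m" by (simp add: Suc mult.assoc)
        also have "R k * x ^ m = x ^ m * R k"
          using power_commuting_commutes[OF Rx[symmetric]] by simp
        finally show ?case by (simp add: mult.assoc)
      qed simp
      moreover have "x ^ Suc n * x ^ n = x ^ n * x ^ Suc n"
        by (simp only: power_add[symmetric] add.commute)
      ultimately show ?thesis
        unfolding d_def by (simp only: right_diff_distrib mult.assoc[symmetric] mult_1_right)
    qed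
    moreover obtain C where "\<And>k. k \<ge> k0 \<Longrightarrow> norm (x ^ n * ((x * R k) ^ Suc n - 1)) \<le> C * norm (\<mu> k)"
      using near_one by blast
    ultimately have "\<forall>\<^sub>F k in sequentially. norm (x ^ Suc n * d k - x ^ n) \<le> C * norm (\<mu> k)"
      by (auto simp: eventually_sequentially intro!: exI[of _ k0])
    moreover have "(\<lambda>k. C * norm (\<mu> k)) \<longlonglongrightarrow> 0"
      using tendsto_mult_right_zero[OF tendsto_norm_zero[OF \<mu>]] .
    ultimately show ?thesis by (rule Lim_null_comparison)
  qed
  then have "(\<lambda>k. x ^ Suc n * d k) \<longlonglongrightarrow> x ^ n"
    by (simp add: LIM_zero_iff)
  then have "x ^ n = x ^ Suc n * D"
    using LIMSEQ_unique[OF _ tendsto_mult[OF tendsto_const D]] by blast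
  then show ?thesis by (rule drazinI[OF comm])
qed

section \<open>Ideals of a commutative bicommutant\<close>

definition commutant :: "'a::semigroup_mult set \<Rightarrow> 'a set" where
  "commutant S = {x. \<forall>s\<in>S. x * s = s * x}"

text \<open>Being a commutant is what keeps inverses and Drazin inverses of members inside
  \<open>C\<close>; commutativity is a separate requirement, met by the bicommutant of two commuting
  elements.\<close>

locale commutative_commutant =
  fixes S C :: "'a::complex_banach_algebra set"
  assumes C_def: "C = commutant S"
    and comm: "\<And>x y. x \<in> C \<Longrightarrow> y \<in> C \<Longrightarrow> x * y = y * x"
begin

lemma one_in [simp]: "1 \<in> C"
  and zero_in [simp]: "0 \<in> C"
  and add_in [simp]: "x \<in> C \<Longrightarrow> y \<in> C \<Longrightarrow> x + y \<in> C"
  and uminus_in [simp]: "x \<in> C \<Longrightarrow> - x \<in> C"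
  and diff_in [simp]: "x \<in> C \<Longrightarrow> y \<in> C \<Longrightarrow> x - y \<in> C"
  and scaleC_in [simp]: "x \<in> C \<Longrightarrow> c *\<^sub>C x \<in> C"
  by (simp_all add: C_def commutant_def algebra_simps)

lemma mult_in [simp]: "x \<in> C \<Longrightarrow> y \<in> C \<Longrightarrow> x * y \<in> C"
  by (simp add: C_def commutant_def) (metis mult.assoc)

lemma power_in [simp]: "x \<in> C \<Longrightarrow> x ^ n \<in> C"
  by (induction n) simp_all

lemma inverse_in: "inverse_pair x y \<Longrightarrow> x \<in> C \<Longrightarrow> y \<in> C"
  by (simp add: C_def commutant_def) (metis inverse_pair_commute)

lemma drazin_inverse_in:
  assumes "x ^ m = x ^ m * s * x" "s * x * s = s" "x * s = s * x" "x \<in> C"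
  shows "s \<in> C"
  using assms(4) drazin_inverse_commute[OF assms(1-3)]
  by (simp add: C_def commutant_def)

definition ideal :: "'a set \<Rightarrow> bool" where
  "ideal J \<longleftrightarrow> J \<subseteq> C \<and> 0 \<in> J \<and> (\<forall>x\<in>J. \<forall>y\<in>J. x + y \<in> J) \<and> (\<forall>a\<in>C. \<forall>x\<in>J. a * x \<in> J)"

lemma idealD:
  assumes "ideal J"
  shows "x \<in> J \<Longrightarrow> x \<in> C" "0 \<in> J" "x \<in> J \<Longrightarrow> y \<in> J \<Longrightarrow> x + y \<in> J"
    "a \<in> C \<Longrightarrow> x \<in> J \<Longrightarrow> a * x \<in> J"
  using assms by (auto simp: ideal_def)

lemma ideal_scaleC: "ideal J \<Longrightarrow> x \<in> J \<Longrightarrow> c *\<^sub>C x \<in> J"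
  using idealD(4)[of J "c *\<^sub>C 1" x] by simp

lemma ideal_diff: "ideal J \<Longrightarrow> x \<in> J \<Longrightarrow> y \<in> J \<Longrightarrow> x - y \<in> J"
  using idealD(3)[of J x "(- 1) *\<^sub>C y"] ideal_scaleC[of J y "- 1"] by simp

lemma ideal_subspace: "ideal J \<Longrightarrow> subspace J"
  by (auto simp: subspace_def idealD scaleC_of_real[symmetric] ideal_scaleC)

definition adjoin :: "'a set \<Rightarrow> 'a \<Rightarrow> 'a set" where
  "adjoin J x = {j + a * x | j a. j \<in> J \<and> a \<in> C}"

lemma ideal_adjoin:
  assumes J: "ideal J" and x: "x \<in> C"
  shows "ideal (adjoin J x)"
  unfolding ideal_def
proof (intro conjI ballI subsetI)
  show "y \<in> C" if "y \<in> adjoin J x" for y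
    using that idealD(1)[OF J] x by (auto simp: adjoin_def)
  have "0 = 0 + 0 * x" by simp
  then show "0 \<in> adjoin J x"
    unfolding adjoin_def using idealD(2)[OF J] zero_in by blast
  show "y + z \<in> adjoin J x" if yz: "y \<in> adjoin J x" "z \<in> adjoin J x" for y z
  proof -
    obtain j a j' a' where "j \<in> J" "a \<in> C" "y = j + a * x" "j' \<in> J" "a' \<in> C" "z = j' + a' * x"
      using yz by (auto simp: adjoin_def)
    then have "y + z = (j + j') + (a + a') * x" "j + j' \<in> J" "a + a' \<in> C"
      using idealD(3)[OF J] by (auto simp: algebra_simps)
    then show ?thesis unfolding adjoin_def by blast
  qed
  show "b * y \<in> adjoin J x" if b: "b \<in> C" "y \<in> adjoin J x" for b y
  proof -
    obtain j a where "j \<in> J" "a \<in> C" "y = j + a * x"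
      using b by (auto simp: adjoin_def)
    then have "b * y = b * j + (b * a) * x" "b * j \<in> J" "b * a \<in> C"
      using idealD(4)[OF J] b by (auto simp: algebra_simps)
    then show ?thesis unfolding adjoin_def by blast
  qed
qed

lemma adjoin_superset: "J \<subseteq> adjoin J x"
proof
  fix j assume "j \<in> J"
  moreover have "j = j + 0 * x" by simp
  ultimately show "j \<in> adjoin J x" unfolding adjoin_def using zero_in by blast
qed

lemma adjoin_self: "ideal J \<Longrightarrow> x \<in> adjoin J x"
proof -
  assume "ideal J"
  moreover have "x = 0 + 1 * x" by simp
  ultimately show ?thesis unfolding adjoin_def using idealD(2) one_in by blast
qed

lemma proper_ideal_no_inverse:
  assumes "ideal J" "1 \<notin> J" "x \<in> J"
  shows "\<not> inverse_pair x y"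
proof
  assume y: "inverse_pair x y"
  have "y * x \<in> J"
    by (intro idealD(4)[OF assms(1)] inverse_in[OF y] idealD(1)[OF assms(1)] assms(3))
  then show False using y assms(2) by (simp add: inverse_pair_def)
qed

text \<open>All elements at distance less than 1 from the unit are invertible, so a proper ideal
  misses that ball. This provides the functional that vanishes on the ideal and not at 1.\<close>

lemma proper_ideal_closure:
  assumes J: "ideal J" "1 \<notin> J"
  shows "1 \<notin> closure J"
proof
  assume "1 \<in> closure J"
  then obtain j where j: "j \<in> J" "dist j 1 < 1"
    using closure_approachable[of 1 J] zero_less_one by blast
  then have "norm (1 - j) < 1" by (simp add: dist_norm norm_minus_commute)
  then obtain y where "inverse_pair (1 - (1 - j)) y" by (rule neumann_series)
  then show False using proper_ideal_no_inverse[OF J j(1)] by simp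
qed

text \<open>Otherwise the classes of \<open>p - \<mu>\<close> modulo \<open>J\<close> would all be invertible, and a functional vanishing
  on \<open>J\<close> would turn their inverses into an entire function that decays like \<open>- 1 / \<mu>\<close> at infinity.\<close>

proposition proper_ideal_extend:
  assumes J: "ideal J" "1 \<notin> J" and p: "p \<in> C"
  obtains \<mu> where "1 \<notin> adjoin J (p - \<mu> *\<^sub>C 1)"
proof -
  have False if all: "\<And>\<mu>. 1 \<in> adjoin J (p - \<mu> *\<^sub>C 1)"
  proof -
    have "\<exists>a. a \<in> C \<and> 1 - a * (p - \<mu> *\<^sub>C 1) \<in> J" for \<mu>
    proof -
      obtain j a where "j \<in> J" "a \<in> C" "1 = j + a * (p - \<mu> *\<^sub>C 1)"
        using all[of \<mu>] unfolding adjoin_def by blast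
      then show ?thesis by (metis add_diff_cancel_right')
    qed
    then obtain R where R: "\<And>\<mu>. R \<mu> \<in> C" "\<And>\<mu>. 1 - R \<mu> * (p - \<mu> *\<^sub>C 1) \<in> J"
      by metis
    obtain f :: "'a \<Rightarrow>\<^sub>C\<^sub>L complex" where f: "\<And>x. x \<in> J \<Longrightarrow> capply f x = 0" "capply f 1 = 1"
      using separating_functional[OF ideal_subspace[OF J(1)] ideal_scaleC[OF J(1)] proper_ideal_closure[OF J]]
      by metis
    interpret f: bounded_linear "capply f" by (rule bounded_linear_capply)
    define g where "g \<mu> = capply f (R \<mu>)" for \<mu>
    \<comment> \<open>Two inverses of p - \<mu> modulo \<open>J\<close> differ by an element of
      \<open>J\<close>. Hence \<open>g\<close> does not depend on the pointwise choice of
      \<open>R\<close>, and nearby values may be computed from a Neumann series.\<close>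
    have g: "g \<mu> = capply f a" if a: "a \<in> C" "1 - a * (p - \<mu> *\<^sub>C 1) \<in> J" for \<mu> a
    proof -
      let ?x = "p - \<mu> *\<^sub>C 1"
      have "R \<mu> * (1 - a * ?x) - a * (1 - R \<mu> * ?x) \<in> J"
        by (rule ideal_diff[OF J(1) idealD(4)[OF J(1) R(1) a(2)] idealD(4)[OF J(1) a(1) R(2)]])
      moreover have "R \<mu> * (1 - a * ?x) - a * (1 - R \<mu> * ?x) = R \<mu> - a"
        using comm[OF R(1) a(1)] by (simp add: right_diff_distrib mult.assoc[symmetric])
      ultimately have "capply f (R \<mu> - a) = 0" using f(1) by simp
      then show ?thesis by (simp add: g_def f.diff)
    qed
    have "(g has_field_derivative capply f (R \<mu> * R \<mu>)) (at \<mu>)" for \<mu>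
    proof -
      let ?r = "R \<mu>"
      \<comment> \<open>With N = (1 - h r)^(-1), the product N r inverts p - (\<mu> + h) modulo
        \<open>J\<close>. Expanding N twice leaves the remainder h r r N r, where |N| \<le> 2; this
        is the origin of the constant.\<close>
      have est: "norm ((g (\<mu> + h) - g \<mu>) / h - capply f (?r * ?r)) \<le> norm f * (2 * norm ?r ^ 3) * norm h"
        if h: "h \<noteq> 0" "norm h * norm ?r < 1 / 2" for h
      proof -
        have small: "norm (h *\<^sub>C ?r) < 1" using h by (simp add: norm_scaleC)
        obtain N where N: "inverse_pair (1 - h *\<^sub>C ?r) N" "norm N \<le> 1 / (1 - norm (h *\<^sub>C ?r))"
          "N = 1 + (h *\<^sub>C ?r) * N"
          using neumann_series[OF small] .
        have NC: "N \<in> C" using R(1) by (intro inverse_in[OF N(1)]) simp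
        have "1 - (N * ?r) * (p - (\<mu> + h) *\<^sub>C 1) = N * (1 - h *\<^sub>C ?r) - N * ?r * (p - (\<mu> + h) *\<^sub>C 1)"
          using N(1) by (simp add: inverse_pair_def)
        also have "\<dots> = N * (1 - ?r * (p - \<mu> *\<^sub>C 1))"
          by (simp add: algebra_simps scaleC_add_left)
        finally have "1 - (N * ?r) * (p - (\<mu> + h) *\<^sub>C 1) \<in> J"
          using idealD(4)[OF J(1) NC R(2)] by simp
        then have "g (\<mu> + h) = capply f (N * ?r)"
          using g NC R(1) by simp
        also have "N * ?r = ?r + h *\<^sub>C (?r * N * ?r)"
          by (subst N(3)) (simp add: distrib_right mult.assoc)
        finally have "(g (\<mu> + h) - g \<mu>) / h = capply f (?r * N * ?r)"
          using h(1) by (simp add: g_def f.add capply_scaleC)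
        moreover have "?r * N * ?r - ?r * ?r = h *\<^sub>C (?r * ?r * N * ?r)"
          by (subst N(3)) (simp add: algebra_simps)
        ultimately have "(g (\<mu> + h) - g \<mu>) / h - capply f (?r * ?r) = capply f (h *\<^sub>C (?r * ?r * N * ?r))"
          by (metis f.diff)
        then have "norm ((g (\<mu> + h) - g \<mu>) / h - capply f (?r * ?r)) \<le> norm f * (norm h * norm (?r * ?r * N * ?r))"
          using norm_capply[of f "h *\<^sub>C (?r * ?r * N * ?r)"] by (simp add: norm_scaleC)
        also have "\<dots> \<le> norm f * (norm h * (norm ?r * norm ?r * 2 * norm ?r))"
        proof (intro mult_left_mono norm_ge_zero)
          have "norm N \<le> 2"
            using N(2) h by (elim order_trans) (simp add: norm_scaleC field_simps)
          then have "norm ?r * norm ?r * norm N * norm ?r \<le> norm ?r * norm ?r * 2 * norm ?r"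
            by (intro mult_right_mono mult_left_mono) auto
          moreover have "norm (?r * ?r * N * ?r) \<le> norm ?r * norm ?r * norm N * norm ?r"
            by (meson norm_mult_ineq mult_right_mono norm_ge_zero order_trans)
          ultimately show "norm (?r * ?r * N * ?r) \<le> norm ?r * norm ?r * 2 * norm ?r" by linarith
        qed
        finally show ?thesis by (simp add: power3_eq_cube mult_ac)
      qed
      have "((\<lambda>h. (g (\<mu> + h) - g \<mu>) / h - capply f (?r * ?r)) \<longlongrightarrow> 0) (at 0)"
      proof (rule Lim_null_comparison)
        have "((\<lambda>h::complex. norm h * norm ?r) \<longlongrightarrow> norm (0 :: complex) * norm ?r) (at 0)"
          by (intro tendsto_intros)
        then have "\<forall>\<^sub>F h::complex in at 0. norm h * norm ?r < 1 / 2"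
          by (intro order_tendstoD(2)) auto
        moreover have "\<forall>\<^sub>F h::complex in at 0. h \<noteq> 0"
          by (rule eventually_neq_at_within)
        ultimately show "\<forall>\<^sub>F h in at 0. norm ((g (\<mu> + h) - g \<mu>) / h - capply f (?r * ?r))
            \<le> norm f * (2 * norm ?r ^ 3) * norm h"
          by eventually_elim (rule est)
        show "((\<lambda>h::complex. norm f * (2 * norm ?r ^ 3) * norm h) \<longlongrightarrow> 0) (at 0)"
          by (intro tendsto_mult_right_zero tendsto_norm_zero) simp
      qed
      then show ?thesis by (simp add: DERIV_def LIM_zero_iff)
    qed
    then have "g holomorphic_on UNIV"
      by (auto simp: holomorphic_on_def field_differentiable_def)
    moreover have big: "\<exists>N. norm (N - 1) \<le> 2 * norm p / norm \<mu> \<and> norm N \<le> 2 \<and> g \<mu> = - (capply f N / \<mu>)"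
      if \<mu>: "2 * norm p < norm \<mu>" for \<mu>
    proof -
      have \<mu>0: "\<mu> \<noteq> 0" using \<mu> norm_ge_zero[of p] by auto
      let ?q = "inverse \<mu> *\<^sub>C p"
      have nq: "norm ?q = norm p / norm \<mu>"
        by (simp add: norm_scaleC norm_inverse divide_inverse)
      have q: "norm ?q < 1 / 2" using \<mu> \<mu>0 unfolding nq by (simp add: field_simps)
      then have small: "norm ?q < 1" by simp
      obtain N where N: "inverse_pair (1 - ?q) N" "norm N \<le> 1 / (1 - norm ?q)" "N = 1 + ?q * N"
        using neumann_series[OF small] .
      have N2: "norm N \<le> 2"
        using N(2) q by (elim order_trans) (simp add: field_simps)
      have "N - 1 = ?q * N" using N(3) by (simp add: algebra_simps)
      then have "norm (N - 1) \<le> norm ?q * norm N" by (metis norm_mult_ineq)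
      also have "\<dots> \<le> norm ?q * 2" by (intro mult_left_mono N2 norm_ge_zero)
      finally have N1: "norm (N - 1) \<le> 2 * norm p / norm \<mu>" by (simp add: nq mult.commute)
      have NC: "N \<in> C" using p by (intro inverse_in[OF N(1)]) simp
      have "(- inverse \<mu>) *\<^sub>C N * (p - \<mu> *\<^sub>C 1) = N * (1 - ?q)"
        using \<mu>0 by (simp add: algebra_simps scaleC_scaleC)
      also have "\<dots> = 1" using N(1) by (simp add: inverse_pair_def)
      finally have "g \<mu> = capply f ((- inverse \<mu>) *\<^sub>C N)"
        using NC idealD(2)[OF J(1)] by (intro g) auto
      also have "\<dots> = - (capply f N / \<mu>)" by (simp add: capply_scaleC f.neg divide_inverse mult.commute)
      finally show ?thesis using N1 N2 by blast
    qed
    moreover have "(g \<longlongrightarrow> 0) at_infinity"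
    proof (rule Lim_null_comparison)
      show "\<forall>\<^sub>F \<mu> in at_infinity. norm (g \<mu>) \<le> norm f * 2 * inverse (norm \<mu>)"
        unfolding eventually_at_infinity
      proof (intro exI allI impI)
        fix \<mu> :: complex assume "2 * norm p + 1 \<le> norm \<mu>"
        then obtain N where N: "norm N \<le> 2" "g \<mu> = - (capply f N / \<mu>)" using big[of \<mu>] by auto
        have "norm (capply f N) \<le> norm f * 2"
          using norm_capply[of f N] mult_left_mono[OF N(1), of "norm f"] by simp
        from mult_right_mono[OF this, of "inverse (norm \<mu>)"]
        show "norm (g \<mu>) \<le> norm f * 2 * inverse (norm \<mu>)"
          unfolding N(2) by (simp add: norm_mult norm_inverse divide_inverse)
      qed
      show "((\<lambda>\<mu>::complex. norm f * 2 * inverse (norm \<mu>)) \<longlongrightarrow> 0) at_infinity"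
        by (intro tendsto_mult_right_zero tendsto_inverse_0_at_top filterlim_norm_at_top)
    qed
    ultimately have g0: "g \<mu> = 0" for \<mu> by (intro Liouville_weak_0)
    \<comment> \<open>So large that |N - 1| times the norm of \<open>f\<close> is below 1, which
      contradicts f(N) = 0 and f(1) = 1.\<close>
    define \<mu> where "\<mu> = complex_of_real (2 * norm p + 2 * norm f * norm p + 1)"
    have n\<mu>: "norm \<mu> = 2 * norm p + 2 * norm f * norm p + 1"
      unfolding \<mu>_def norm_of_real by simp
    have "2 * norm p < norm \<mu>" unfolding n\<mu> by (simp add: add_nonneg_pos)
    then obtain N where N: "norm (N - 1) \<le> 2 * norm p / norm \<mu>" "g \<mu> = - (capply f N / \<mu>)"
      using big by blast
    have \<mu>0: "\<mu> \<noteq> 0" using \<open>2 * norm p < norm \<mu>\<close> norm_ge_zero[of p] by auto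
    then have "capply f N = 0" using N(2) g0 by simp
    then have "1 = norm (capply f (N - 1))" using f(2) by (simp add: f.diff)
    also have "\<dots> \<le> norm f * (2 * norm p / norm \<mu>)"
      using norm_capply[of f "N - 1"] mult_left_mono[OF N(1), of "norm f"] by simp
    also have "\<dots> < 1"
    proof -
      have "2 * norm f * norm p < norm \<mu>" unfolding n\<mu> using norm_ge_zero[of p] by linarith
      then show ?thesis using \<mu>0 by (simp add: field_simps)
    qed
    finally show False by simp
  qed
  then show ?thesis using that by blast
qed

section \<open>Joint spectral values of two commuting elements\<close>

text \<open>The second extension starts from the ideal produced by the first. Modulo the final ideal
  p - q is both \<kappa> and \<mu> - \<nu>; a proper ideal contains no nonzero scalar, so these
  agree.\<close>

corollary proper_ideal_joint_spectrum:
  assumes J: "ideal J" "1 \<notin> J" and pq: "p \<in> C" "q \<in> C" and mem: "p - q - \<kappa> *\<^sub>C 1 \<in> J"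
  obtains \<mu> \<nu> J' where "ideal J'" "1 \<notin> J'" "J \<subseteq> J'" "p - \<mu> *\<^sub>C 1 \<in> J'" "q - \<nu> *\<^sub>C 1 \<in> J'" "\<mu> - \<nu> = \<kappa>"
proof -
  obtain \<mu> where \<mu>: "1 \<notin> adjoin J (p - \<mu> *\<^sub>C 1)" (is "1 \<notin> ?J1")
    using proper_ideal_extend[OF J pq(1)] .
  have J1: "ideal ?J1" using pq by (intro ideal_adjoin J) simp
  obtain \<nu> where \<nu>: "1 \<notin> adjoin ?J1 (q - \<nu> *\<^sub>C 1)" (is "1 \<notin> ?J2")
    using proper_ideal_extend[OF J1 \<mu> pq(2)] .
  have J2: "ideal ?J2" using pq by (intro ideal_adjoin J1) simp
  have sub: "J \<subseteq> ?J2" "?J1 \<subseteq> ?J2" using adjoin_superset by blast+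
  have p: "p - \<mu> *\<^sub>C 1 \<in> ?J2" using adjoin_self[OF J(1)] sub by blast
  have q: "q - \<nu> *\<^sub>C 1 \<in> ?J2" using adjoin_self[OF J1] by blast
  have "\<mu> - \<nu> = \<kappa>"
  proof (rule ccontr)
    assume "\<mu> - \<nu> \<noteq> \<kappa>"
    then have ne: "\<mu> - \<nu> - \<kappa> \<noteq> 0" by simp
    have "(p - q - \<kappa> *\<^sub>C 1) - ((p - \<mu> *\<^sub>C 1) - (q - \<nu> *\<^sub>C 1)) \<in> ?J2"
      by (rule ideal_diff[OF J2 _ ideal_diff[OF J2 p q]]) (use mem sub in blast)
    then have "(\<mu> - \<nu> - \<kappa>) *\<^sub>C 1 \<in> ?J2"
      by (simp add: algebra_simps)
    from ideal_scaleC[OF J2 this, of "inverse (\<mu> - \<nu> - \<kappa>)"] show False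
      using ne \<nu> by (simp add: scaleC_scaleC)
  qed
  then show ?thesis using that J2 \<nu> sub(1) p q by blast
qed

text \<open>In the commutative \<open>C\<close> a one-sided inverse is two-sided, so a
  non-invertible p - q - \<kappa> generates a proper ideal.\<close>

proposition invertible_of_joint_spectrum:
  assumes pq: "p \<in> C" "q \<in> C"
    and inv: "\<And>\<mu> \<nu>. \<mu> - \<nu> = \<kappa> \<Longrightarrow> (\<exists>y. inverse_pair (p - \<mu> *\<^sub>C 1) y) \<or> (\<exists>y. inverse_pair (q - \<nu> *\<^sub>C 1) y)"
  shows "\<exists>y. inverse_pair (p - q - \<kappa> *\<^sub>C 1) y"
proof (rule ccontr)
  assume no: "\<not> ?thesis"
  let ?t = "p - q - \<kappa> *\<^sub>C 1"
  have t: "?t \<in> C" using pq by simp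
  have z: "ideal {0}" by (auto simp: ideal_def)
  have J: "ideal (adjoin {0} ?t)" by (rule ideal_adjoin[OF z t])
  have "1 \<notin> adjoin {0} ?t"
  proof
    assume "1 \<in> adjoin {0} ?t"
    then obtain a where "a \<in> C" "a * ?t = 1" by (auto simp: adjoin_def)
    then have "inverse_pair ?t a" using comm[of a ?t] t by (simp add: inverse_pair_def)
    then show False using no by blast
  qed
  from proper_ideal_joint_spectrum[OF J this pq adjoin_self[OF z]]
  show False using inv proper_ideal_no_inverse by metis
qed

text \<open>The binomial expansion in disguise: each factor x - y raises exactly one of the two
  exponents by one.\<close>

lemma power_diff_annihilates:
  assumes "x \<in> C" "y \<in> C" "\<And>a b. a + b = n \<Longrightarrow> x ^ a * y ^ b * v = 0"
  shows "(x - y) ^ n * v = 0"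
  using assms(3)
proof (induction n arbitrary: v)
  case 0
  then show ?case using 0[of 0 0] by simp
next
  case (Suc n)
  have "x ^ a * y ^ b * ((x - y) * v) = 0" if "a + b = n" for a b
  proof -
    have "y ^ b * x = x * y ^ b" using assms by (intro comm) simp_all
    then have "x ^ a * y ^ b * ((x - y) * v) = x ^ Suc a * y ^ b * v - x ^ a * y ^ Suc b * v"
      by (simp only: left_diff_distrib right_diff_distrib mult.assoc[symmetric] power_Suc2)
        (simp add: mult.assoc)
    also have "\<dots> = 0" using Suc.prems[of "Suc a" b] Suc.prems[of a "Suc b"] that by simp
    finally show ?thesis .
  qed
  from Suc.IH[OF this] show ?case by (simp only: power_Suc2 mult.assoc)
qed

proposition drazin_of_joint_spectrum:
  assumes pq: "p \<in> C" "q \<in> C"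
    and dr: "\<And>\<mu> \<nu>. \<mu> - \<nu> = \<kappa> \<Longrightarrow> \<not> (\<exists>y. inverse_pair (p - \<mu> *\<^sub>C 1) y) \<Longrightarrow>
      \<not> (\<exists>y. inverse_pair (q - \<nu> *\<^sub>C 1) y) \<Longrightarrow> drazin (p - \<mu> *\<^sub>C 1) \<and> drazin (q - \<nu> *\<^sub>C 1)"
  shows "drazin (p - q - \<kappa> *\<^sub>C 1)"
proof (rule ccontr)
  assume no: "\<not> ?thesis"
  define t where "t = p - q - \<kappa> *\<^sub>C 1"
  have t: "t \<in> C" using pq by (simp add: t_def)
  \<comment> \<open>The elements that become divisible by one further factor \<open>t\<close> after
    multiplication by a power of \<open>t\<close>. \<open>J\<close> contains \<open>t\<close> and
    everything annihilated by a power of \<open>t\<close>, and 1 in \<open>J\<close> would make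
    \<open>t\<close> Drazin invertible.\<close>
  define J where "J = {s \<in> C. \<exists>m. \<exists>a\<in>C. t ^ m * s = t ^ Suc m * a}"
  have tpow: "\<exists>a\<in>C. t ^ (m + k) * s = t ^ Suc (m + k) * a" if "t ^ m * s = t ^ Suc m * a" "a \<in> C" for m k s a
  proof -
    have "t ^ (m + k) * s = t ^ k * (t ^ m * s)"
      by (simp add: power_add[symmetric] add.commute mult.assoc[symmetric])
    also have "\<dots> = t ^ Suc (m + k) * a"
      unfolding that(1) mult.assoc[symmetric] power_add[symmetric] by (simp add: add.commute)
    finally show ?thesis using that(2) by blast
  qed
  have J: "ideal J"
    unfolding ideal_def
  proof (intro conjI ballI)
    show "J \<subseteq> C" by (auto simp: J_def)
    show "0 \<in> J" by (auto simp: J_def intro!: exI[of _ 0] bexI[of _ 0])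
    show "x + y \<in> J" if xy: "x \<in> J" "y \<in> J" for x y
    proof -
      obtain m a m' a' where "x \<in> C" "y \<in> C" "a \<in> C" "a' \<in> C" "t ^ m * x = t ^ Suc m * a" "t ^ m' * y = t ^ Suc m' * a'"
        using xy unfolding J_def by blast
      then obtain b b' where b: "x \<in> C" "y \<in> C" "b \<in> C" "b' \<in> C"
        "t ^ (m + m') * x = t ^ Suc (m + m') * b" "t ^ (m + m') * y = t ^ Suc (m + m') * b'"
        using tpow[of m x a m'] tpow[of m' y a' m] by (metis add.commute)
      then have "t ^ (m + m') * (x + y) = t ^ Suc (m + m') * (b + b')"
        by (simp only: distrib_left)
      then show ?thesis using b(1-4) unfolding J_def by (auto intro!: add_in)
    qed
    show "c * x \<in> J" if cx: "c \<in> C" "x \<in> J" for c x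
    proof -
      obtain m a where x: "x \<in> C" "a \<in> C" "t ^ m * x = t ^ Suc m * a"
        using cx unfolding J_def by blast
      have "t ^ m * (c * x) = c * (t ^ m * x)"
        using comm[of c "t ^ m"] cx(1) t by (simp add: mult.assoc[symmetric])
      also have "\<dots> = t ^ Suc m * (c * a)"
        using comm[of c "t ^ Suc m"] cx(1) t x(3) by (simp only: mult.assoc[symmetric] power_in)
      finally show ?thesis using x cx(1) unfolding J_def by (auto intro!: mult_in)
    qed
  qed
  have J1: "1 \<notin> J"
  proof
    assume "1 \<in> J"
    then obtain m a where "a \<in> C" "t ^ m = t ^ Suc m * a" by (auto simp: J_def)
    then have "drazin t" using comm[OF t] by (intro drazinI)
    then show False using no by (simp add: t_def)
  qed
  have "t \<in> J" using t by (auto simp: J_def intro!: exI[of _ 0] bexI[of _ 1])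
  then obtain \<mu> \<nu> J' where J': "ideal J'" "1 \<notin> J'" "J \<subseteq> J'" and
    xy: "p - \<mu> *\<^sub>C 1 \<in> J'" "q - \<nu> *\<^sub>C 1 \<in> J'" and eq: "\<mu> - \<nu> = \<kappa>"
    using proper_ideal_joint_spectrum[OF J J1 pq] unfolding t_def by metis
  define x where "x = p - \<mu> *\<^sub>C 1"
  define y where "y = q - \<nu> *\<^sub>C 1"
  have xyC: "x \<in> C" "y \<in> C" using pq by (simp_all add: x_def y_def)
  have "drazin x" "drazin y"
    using dr[OF eq] proper_ideal_no_inverse[OF J'(1,2)] xy by (auto simp: x_def y_def)
  then obtain r i s j where r: "x ^ i = x ^ i * r * x" "r * x * r = r" "x * r = r * x"
    and s: "y ^ j = y ^ j * s * y" "s * y * s = s" "y * s = s * y"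
    by (metis drazinE)
  have rs: "r \<in> C" "s \<in> C" using drazin_inverse_in r s xyC by blast+
  define e where "e = 1 - x * r"
  define f where "f = 1 - y * s"
  have ef: "e \<in> C" "f \<in> C" using rs xyC by (simp_all add: e_def f_def)
  have e0: "x ^ i * e = 0" and f0: "y ^ j * f = 0"
    using r s by (simp_all add: e_def f_def right_diff_distrib mult.assoc)
  \<comment> \<open>If a + b = i + j then a \<ge> i or b \<ge> j, so at least one of the idempotents
    \<open>e\<close>, \<open>f\<close> is annihilated.\<close>
  have "x ^ a * y ^ b * (e * f) = 0" if ab: "a + b = i + j" for a b
  proof (cases "i \<le> a")
    case True
    then have "x ^ a * e = 0"
      using e0 by (metis le_add_diff_inverse2 mult.assoc mult_zero_right power_add)
    moreover have "x ^ a * y ^ b * (e * f) = (x ^ a * e) * (y ^ b * f)"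
      using comm[of e "y ^ b"] ef xyC by (simp add: mult.assoc) (simp add: mult.assoc[symmetric])
    ultimately show ?thesis by simp
  next
    case False
    then have "j \<le> b" using ab by simp
    then have "y ^ b * f = 0"
      using f0 by (metis le_add_diff_inverse2 mult.assoc mult_zero_right power_add)
    moreover have "x ^ a * y ^ b * (e * f) = (x ^ a * e) * (y ^ b * f)"
      using comm[of e "y ^ b"] ef xyC by (simp add: mult.assoc) (simp add: mult.assoc[symmetric])
    ultimately show ?thesis by simp
  qed
  then have "(x - y) ^ (i + j) * (e * f) = 0"
    by (rule power_diff_annihilates[OF xyC])
  moreover have "x - y = t"
    by (simp add: x_def y_def t_def eq[symmetric] algebra_simps)
  ultimately have "e * f \<in> J"
    using ef by (auto simp: J_def intro!: exI[of _ "i + j"] bexI[of _ 0])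
  then have 1: "e * f \<in> J'" using J'(3) by blast
  \<comment> \<open>The unit splits as e f + e (1 - f) + (1 - e), where 1 - e = r x and 1 - f = s y
    are multiples of elements of \<open>J'\<close>.\<close>
  have "r * x \<in> J'" "e * s * y \<in> J'"
    using xy rs ef unfolding x_def y_def by (intro idealD(4)[OF J'(1)]; simp)+
  then have "e * f + (e * s * y + r * x) \<in> J'"
    using 1 by (intro idealD(3)[OF J'(1)])
  moreover have "e * f + (e * s * y + r * x) = 1"
    using r(3) s(3) by (simp add: f_def right_diff_distrib mult.assoc) (simp add: e_def)
  ultimately show False using J'(2) by simp
qed

end

lemma commutant_antimono: "S \<subseteq> T \<Longrightarrow> commutant T \<subseteq> commutant S"
  unfolding commutant_def by blast

lemma commutantD: "x \<in> commutant S \<Longrightarrow> s \<in> S \<Longrightarrow> x * s = s * x"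
  unfolding commutant_def by blast

text \<open>Since \<open>p\<close> and \<open>q\<close> commute, they lie in their own commutant;
  taking commutants reverses this, so the bicommutant lies in the commutant, with which it
  commutes.\<close>

lemma commutative_bicommutant:
  assumes "p * q = q * (p :: 'a::complex_banach_algebra)"
  shows "commutative_commutant (commutant {p, q}) (commutant (commutant {p, q}))"
    and "p \<in> commutant (commutant {p, q})" "q \<in> commutant (commutant {p, q})"
proof -
  have "{p, q} \<subseteq> commutant {p, q}" using assms by (auto simp: commutant_def)
  then have sub: "commutant (commutant {p, q}) \<subseteq> commutant {p, q}"
    by (rule commutant_antimono)
  show "commutative_commutant (commutant {p, q}) (commutant (commutant {p, q}))"
    by unfold_locales (simp, rule commutantD, assumption, erule subsetD[OF sub])
  show "p \<in> commutant (commutant {p, q})" "q \<in> commutant (commutant {p, q})"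
    by (simp_all add: commutant_def)
qed

section \<open>The algebra of bounded operators\<close>

text \<open>A class instance attaches to a type constructor applied to distinct variables, so the
  maps of a space to itself are copied to a type of their own before becoming an algebra.\<close>

typedef (overloaded) 'a endo = "UNIV :: ('a::complex_normed_vector \<Rightarrow>\<^sub>C\<^sub>L 'a) set"
  morphisms op_of Endo ..

setup_lifting type_definition_endo

lemma norm_ccompose: "norm (f \<circ>\<^sub>C g) \<le> norm f * norm g"
proof (rule norm_cblinfun_bound)
  show "norm (capply (f \<circ>\<^sub>C g) x) \<le> norm f * norm g * norm x" for x
    using norm_capply[of f "capply g x"] mult_left_mono[OF norm_capply[of g x], of "norm f"]
    by (simp add: ccompose.rep_eq mult.assoc)
qed simp

lemmas capply_simps = plus_cblinfun.rep_eq minus_cblinfun.rep_eq zero_cblinfun.rep_eq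
  uminus_cblinfun.rep_eq scaleC_cblinfun.rep_eq scaleR_cblinfun.rep_eq ccompose.rep_eq cid.rep_eq
  linear_simps(1-4)[OF bounded_linear_capply] capply_scaleC

instantiation endo :: (complex_normed_vector) complex_normed_vector
begin

lift_definition zero_endo :: "'a endo" is 0 .
lift_definition plus_endo :: "'a endo \<Rightarrow> 'a endo \<Rightarrow> 'a endo" is "(+)" .
lift_definition minus_endo :: "'a endo \<Rightarrow> 'a endo \<Rightarrow> 'a endo" is "(-)" .
lift_definition uminus_endo :: "'a endo \<Rightarrow> 'a endo" is uminus .
lift_definition scaleR_endo :: "real \<Rightarrow> 'a endo \<Rightarrow> 'a endo" is "(*\<^sub>R)" .
lift_definition scaleC_endo :: "complex \<Rightarrow> 'a endo \<Rightarrow> 'a endo" is "(*\<^sub>C)" .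
lift_definition norm_endo :: "'a endo \<Rightarrow> real" is norm .

definition dist_endo :: "'a endo \<Rightarrow> 'a endo \<Rightarrow> real" where
  "dist_endo f g = norm (f - g)"

definition sgn_endo :: "'a endo \<Rightarrow> 'a endo" where
  "sgn_endo f = inverse (norm f) *\<^sub>R f"

definition uniformity_endo :: "('a endo \<times> 'a endo) filter" where
  "uniformity_endo = (INF e\<in>{0<..}. principal {(f, g). dist f g < e})"

definition open_endo :: "'a endo set \<Rightarrow> bool" where
  "open_endo S = (\<forall>f\<in>S. \<forall>\<^sub>F (f', g) in uniformity. f' = f \<longrightarrow> g \<in> S)"

instance
proof
  fix f g h :: "'a endo" and r s :: real and a b :: complex and S :: "'a endo set"
  show "dist f g = norm (f - g)" by (fact dist_endo_def)
  show "sgn f = inverse (norm f) *\<^sub>R f" by (fact sgn_endo_def)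
  show "uniformity = (INF e\<in>{0<..}. principal {(x, y :: 'a endo). dist x y < e})"
    by (fact uniformity_endo_def)
  show "open S = (\<forall>x\<in>S. \<forall>\<^sub>F (x', y) in uniformity. x' = x \<longrightarrow> y \<in> S)"
    by (fact open_endo_def)
qed (transfer, simp add: algebra_simps norm_triangle_ineq scaleC_add_right scaleC_add_left
      scaleC_scaleC scaleC_of_real norm_scaleC)+

end

instance endo :: (complex_banach) complex_banach
proof
  fix X :: "nat \<Rightarrow> 'a endo"
  assume "Cauchy X"
  then have "Cauchy (\<lambda>n. op_of (X n))"
    by (simp add: Cauchy_def dist_norm minus_endo.rep_eq[symmetric] norm_endo.rep_eq[symmetric])
  then obtain L where "(\<lambda>n. op_of (X n)) \<longlonglongrightarrow> L"
    using Cauchy_convergent convergent_def by blast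
  then have "X \<longlonglongrightarrow> Endo L"
    by (simp add: LIMSEQ_iff norm_endo.rep_eq minus_endo.rep_eq Endo_inverse)
  then show "convergent X" by (auto simp: convergent_def)
qed

instantiation endo :: (complex_banach) complex_banach_algebra
begin

lift_definition times_endo :: "'a endo \<Rightarrow> 'a endo \<Rightarrow> 'a endo" is "(\<circ>\<^sub>C)" .
lift_definition one_endo :: "'a endo" is cid .

instance
proof
  fix f g h :: "'a endo" and r :: real and c :: complex
  show "f * g * h = f * (g * h)"
    by transfer (rule cblinfun_eqI, simp add: capply_simps)
  show "(f + g) * h = f * h + g * h"
    by transfer (rule cblinfun_eqI, simp add: capply_simps)
  show "f * (g + h) = f * g + f * h"
    by transfer (rule cblinfun_eqI, simp add: capply_simps)
  show "r *\<^sub>R f * g = r *\<^sub>R (f * g)"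
    by transfer (rule cblinfun_eqI, simp add: capply_simps)
  show "f * r *\<^sub>R g = r *\<^sub>R (f * g)"
    by transfer (rule cblinfun_eqI, simp add: capply_simps linear_simps(5)[OF bounded_linear_capply])
  show "(c *\<^sub>C f) * g = c *\<^sub>C (f * g)"
    by transfer (rule cblinfun_eqI, simp add: capply_simps)
  show "f * (c *\<^sub>C g) = c *\<^sub>C (f * g)"
    by transfer (rule cblinfun_eqI, simp add: capply_simps)
  show "1 * f = f" by transfer (rule cblinfun_eqI, simp add: capply_simps)
  show "f * 1 = f" by transfer (rule cblinfun_eqI, simp add: capply_simps)
  show "norm (f * g) \<le> norm f * norm g" by transfer (rule norm_ccompose)
  show "norm (1 :: 'a endo) \<le> 1"
    by transfer (rule norm_cblinfun_bound, simp_all add: cid.rep_eq)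
qed

end

lemma op_of_power: "op_of (x ^ n) = cpow (op_of x) n"
  by (induction n) (simp_all add: one_endo.rep_eq times_endo.rep_eq)

lemma Endo_shift: "Endo (T - \<mu> *\<^sub>C cid) = Endo T - \<mu> *\<^sub>C 1"
  by (metis Endo_inverse UNIV_I minus_endo.rep_eq one_endo.rep_eq op_of_inverse scaleC_endo.rep_eq)

lemma inverse_pair_Endo:
  "inverse_pair (Endo S) (Endo T) \<longleftrightarrow> S \<circ>\<^sub>C T = cid \<and> T \<circ>\<^sub>C S = cid"
  by (simp add: inverse_pair_def op_of_inject[symmetric] times_endo.rep_eq one_endo.rep_eq Endo_inverse)

lemma cinvertible_iff: "cinvertible T \<longleftrightarrow> (\<exists>y. inverse_pair (Endo T) y)"
proof
  assume "cinvertible T"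
  then show "\<exists>y. inverse_pair (Endo T) y"
    unfolding cinvertible_def using inverse_pair_Endo by blast
next
  assume "\<exists>y. inverse_pair (Endo T) y"
  then obtain y where "inverse_pair (Endo T) (Endo (op_of y))" by (auto simp: op_of_inverse)
  then show "cinvertible T"
    unfolding cinvertible_def inverse_pair_Endo by blast
qed

lemma spectrum_iff: "\<mu> \<in> spectrum T \<longleftrightarrow> \<not> (\<exists>y. inverse_pair (Endo T - \<mu> *\<^sub>C 1) y)"
  by (simp add: spectrum_def cinvertible_iff Endo_shift)

lemma drazin_invertible_iff: "drazin_invertible T \<longleftrightarrow> drazin (Endo T)"
proof -
  have "drazin_invertible T \<longleftrightarrow> (\<exists>S m. Endo T ^ m = Endo T ^ m * Endo S * Endo T \<and>
      Endo S * Endo T * Endo S = Endo S \<and> Endo T * Endo S = Endo S * Endo T)"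
    by (simp add: drazin_invertible_def op_of_inject[symmetric] times_endo.rep_eq op_of_power Endo_inverse)
  also have "\<dots> \<longleftrightarrow> drazin (Endo T)"
    unfolding drazin_def by (metis op_of_inverse)
  finally show ?thesis .
qed

lemma capply_cpow: "capply (cpow T n) = capply T ^^ n"
  by (induction n) (simp_all add: cid.rep_eq ccompose.rep_eq fun_eq_iff)

section \<open>Ascent, descent and Drazin invertibility\<close>

lemma nullspace_cpow: "nullspace (cpow T k) = {x. (capply T ^^ k) x = 0}"
  unfolding nullspace_def capply_cpow ..

lemma range_space_cpow: "range_space (cpow T k) = range (capply T ^^ k)"
  unfolding range_space_def capply_cpow ..

lemma nullspace_cpow_stable:
  assumes "nullspace (cpow T k) = nullspace (cpow T (k + 1))"
  shows "(capply T ^^ (k + j)) x = 0 \<longleftrightarrow> (capply T ^^ k) x = 0"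
proof (induction j arbitrary: x)
  case (Suc j)
  have "(capply T ^^ k) y = 0 \<longleftrightarrow> (capply T ^^ k) (capply T y) = 0" for y
    using assms unfolding nullspace_cpow by (simp add: set_eq_iff funpow_swap1)
  with Suc[of "capply T x"] show ?case by (simp add: funpow_swap1)
qed simp

lemma range_space_cpow_stable:
  assumes "range_space (cpow T k) = range_space (cpow T (k + 1))"
  shows "\<exists>y. (capply T ^^ k) x = (capply T ^^ (k + j)) y"
proof (induction j)
  case (Suc j)
  then obtain y where y: "(capply T ^^ k) x = (capply T ^^ (k + j)) y" by blast
  obtain z where z: "(capply T ^^ k) y = (capply T ^^ (k + 1)) z"
    using assms unfolding range_space_cpow by (metis rangeE rangeI)
  have "(capply T ^^ (j + k)) y = (capply T ^^ j) ((capply T ^^ k) y)"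
    by (simp add: funpow_add)
  also have "\<dots> = (capply T ^^ (j + (k + 1))) z"
    unfolding z by (simp only: funpow_add comp_apply)
  finally show ?case using y by (auto simp: add.commute simp del: funpow.simps)
qed auto

lemma range_space_cpow_subset: "range_space (cpow T (k + 1)) \<subseteq> range_space (cpow T k)"
proof -
  have "(capply T ^^ (k + 1)) x = (capply T ^^ k) (capply T x)" for x
    by (simp add: funpow_swap1)
  then show ?thesis unfolding range_space_cpow by (metis image_subsetI rangeI)
qed

lemma nullspace_cpow_subset: "nullspace (cpow T k) \<subseteq> nullspace (cpow T (k + 1))"
proof
  fix x assume "x \<in> nullspace (cpow T k)"
  then show "x \<in> nullspace (cpow T (k + 1))"
    unfolding nullspace_cpow by (simp add: linear_simps(3)[OF bounded_linear_capply])
qed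

text \<open>For each single k, stability of kernels and of ranges are equivalent, so the two infima
  run over the same set. If kernels are stable, x - S T x is killed by T^m, hence by T^k; if ranges
  are stable, T^k x lies in the range of T^(k+m), where S T acts as the identity.\<close>

lemma drazin_imp_finite_ascent:
  assumes "drazin_invertible T"
  shows "ascent T = descent T" "ascent T < \<infinity>"
proof -
  obtain S m where m: "cpow T m = cpow T m \<circ>\<^sub>C S \<circ>\<^sub>C T" and comm: "T \<circ>\<^sub>C S = S \<circ>\<^sub>C T"
    using assms unfolding drazin_invertible_def by blast
  let ?t = "capply T" and ?s = "capply S"
  have s0: "?s 0 = 0" by (rule linear_simps(3)[OF bounded_linear_capply])
  have ts: "?t (?s x) = ?s (?t x)" for x
    using arg_cong[OF comm, of "\<lambda>U. capply U x"] by (simp add: ccompose.rep_eq)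
  have tm: "(?t ^^ m) x = (?t ^^ m) (?s (?t x))" for x
    using arg_cong[OF m, of "\<lambda>U. capply U x"] by (simp add: ccompose.rep_eq capply_cpow)
  have sn: "(?t ^^ n) (?s x) = ?s ((?t ^^ n) x)" for n x
    by (induction n) (simp_all add: ts)
  have tn: "(?t ^^ n) (?t x) = ?t ((?t ^^ n) x)" for n x
    by (rule funpow_swap1[symmetric])
  have lin: "(?t ^^ n) (x - y) = (?t ^^ n) x - (?t ^^ n) y" for n x y
    unfolding capply_cpow[symmetric] by (rule linear_simps(2)[OF bounded_linear_capply])
  have sub: "nullspace (cpow T (k + 1)) \<subseteq> nullspace (cpow T k)"
    if "\<And>x. (?t ^^ k) x = ?s (?t ((?t ^^ k) x))" for k
  proof
    fix x assume "x \<in> nullspace (cpow T (k + 1))"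
    then have "?t ((?t ^^ k) x) = 0" unfolding nullspace_cpow by simp
    then show "x \<in> nullspace (cpow T k)"
      using that[of x] s0 unfolding nullspace_cpow by simp
  qed
  have iff: "nullspace (cpow T k) = nullspace (cpow T (k + 1)) \<longleftrightarrow>
      range_space (cpow T k) = range_space (cpow T (k + 1))" for k
  proof
    assume N: "nullspace (cpow T k) = nullspace (cpow T (k + 1))"
    have "(?t ^^ k) x = (?t ^^ (k + 1)) (?s x)" for x
    proof -
      have "(?t ^^ m) (x - ?s (?t x)) = 0"
        using tm[of x] by (simp add: lin)
      then have "(?t ^^ (k + m)) (x - ?s (?t x)) = 0"
        using lin[of k 0 0] by (simp add: funpow_add)
      then have "(?t ^^ k) (x - ?s (?t x)) = 0"
        using nullspace_cpow_stable[OF N] by blast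
      then show ?thesis by (simp add: lin sn tn ts)
    qed
    then have "range_space (cpow T k) \<subseteq> range_space (cpow T (k + 1))"
      unfolding range_space_cpow by (metis image_subsetI rangeI)
    then show "range_space (cpow T k) = range_space (cpow T (k + 1))"
      using range_space_cpow_subset by blast
  next
    assume R: "range_space (cpow T k) = range_space (cpow T (k + 1))"
    have "(?t ^^ k) x = ?s (?t ((?t ^^ k) x))" for x
    proof -
      obtain y where y: "(?t ^^ k) x = (?t ^^ (k + m)) y"
        using range_space_cpow_stable[OF R] by blast
      have "(?t ^^ (k + m)) y = ?s (?t ((?t ^^ (k + m)) y))"
        using arg_cong[OF tm[of y], of "?t ^^ k"] by (simp add: funpow_add sn tn)
      then show ?thesis unfolding y .
    qed
    from sub[OF this] show "nullspace (cpow T k) = nullspace (cpow T (k + 1))"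
      using nullspace_cpow_subset by blast
  qed
  then show "ascent T = descent T" by (simp add: ascent_def descent_def)
  have "(?t ^^ m) x = ?s (?t ((?t ^^ m) x))" for x
    using tm[of x] by (simp add: sn tn)
  from sub[OF this] have "nullspace (cpow T m) = nullspace (cpow T (m + 1))"
    using nullspace_cpow_subset by blast
  then have "ascent T \<le> enat m"
    unfolding ascent_def by (intro Inf_lower) blast
  then show "ascent T < \<infinity>" by (meson enat_ord_code(4) order_le_less_trans)
qed

lemma enat_Inf_attained:
  assumes "Inf {enat a | a. P a} = enat n"
  shows "P n"
proof -
  have "{enat a | a. P a} \<noteq> {}"
    using assms by (auto simp: Inf_enat_def split: if_splits)
  then obtain k where "k \<in> {enat a | a. P a}" by blast
  then have "Inf {enat a | a. P a} \<in> {enat a | a. P a}" by (rule wellorder_InfI)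
  then show ?thesis using assms by auto
qed

text \<open>A high power V of T is injective on its own range and maps it onto itself. Inverting V
  there gives the Drazin inverse, up to a power of T; its continuity comes from
  \<open>range_inclusion_bound\<close>.\<close>

proposition drazin_of_finite_ascent:
  fixes T :: "'a::complex_banach \<Rightarrow>\<^sub>C\<^sub>L 'a"
  assumes "ascent T = descent T" "ascent T < \<infinity>"
  shows "drazin_invertible T"
proof -
  obtain p where p: "ascent T = enat p" using assms(2) by (cases "ascent T") auto
  have N: "nullspace (cpow T p) = nullspace (cpow T (p + 1))"
    using p unfolding ascent_def by (rule enat_Inf_attained)
  have R: "range_space (cpow T p) = range_space (cpow T (p + 1))"
    using p unfolding assms(1) descent_def by (rule enat_Inf_attained)
  \<comment> \<open>The exponent is p + 1 rather than p so that V^2 contains at least one factor T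
    more than V, even when the ascent is 0.\<close>
  define V where "V = cpow T (Suc p)"
  let ?t = "capply T" and ?v = "capply V"
  have v: "?v = ?t ^^ Suc p" by (simp only: V_def capply_cpow)
  have bl: "bounded_linear ?v" by (rule bounded_linear_capply)
  interpret v: bounded_linear ?v by (rule bl)
  have tv: "?t (?v x) = ?v (?t x)" for x by (simp add: v funpow_swap1)
  have null: "?v x = 0" if "?v (?v x) = 0" for x
  proof -
    have "?v (?v x) = (?t ^^ (p + (p + 2))) x"
      unfolding v by (simp add: funpow_add funpow_swap1)
    then have "(?t ^^ p) x = 0" using that nullspace_cpow_stable[OF N] by metis
    then show ?thesis by (simp add: v linear_simps(3)[OF bounded_linear_capply])
  qed
  have incl: "\<exists>w. ?v x = ?v (?v w)" for x
  proof -
    obtain y where y: "(?t ^^ p) (?t x) = (?t ^^ (p + (p + 2))) y"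
      using range_space_cpow_stable[OF R] by blast
    have "?v x = (?t ^^ p) (?t x)" by (simp add: v funpow_swap1)
    also have "\<dots> = ?v (?v y)"
      unfolding y unfolding v by (simp add: funpow_add funpow_swap1)
    finally show ?thesis by blast
  qed
  have "bounded_linear (\<lambda>w. ?v (?v w))" by (rule bounded_linear_compose[OF bl bl])
  from range_inclusion_bound[OF bl this incl]
  obtain C where C: "0 \<le> C" "\<And>x. \<exists>w. ?v x = ?v (?v w) \<and> norm w \<le> C * norm x"
    by metis
  \<comment> \<open>Solving V x = V^2 w and V w = V^2 w' in turn costs the factor \<open>C\<close>
    twice; the second solve puts the later value V w' into the range of V.\<close>
  have ex: "\<exists>w. ?v (?v (?v w)) = ?v x \<and> norm w \<le> C * C * norm x" for x
  proof -
    obtain w where w: "?v x = ?v (?v w)" "norm w \<le> C * norm x" using C(2) by blast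
    obtain w' where w': "?v w = ?v (?v w')" "norm w' \<le> C * norm w" using C(2) by blast
    have "norm w' \<le> C * (C * norm x)"
      using w'(2) mult_left_mono[OF w(2) C(1)] by linarith
    moreover have "?v (?v (?v w')) = ?v x" using w w' by simp
    ultimately show ?thesis by (auto simp: mult.assoc)
  qed
  then obtain W where W: "\<And>x. ?v (?v (?v (W x))) = ?v x" "\<And>x. norm (W x) \<le> C * C * norm x"
    by metis
  \<comment> \<open>F x is the unique z in the range of V with V^2 z = V x. This uniqueness, proved
    as \<open>FI\<close>, makes F linear although W is an arbitrary choice.\<close>
  define F where "F x = ?v (W x)" for x
  have FI: "F x = z" if "z = ?v w" "?v (?v z) = ?v x" for x z w
  proof -
    have "?v (?v (?v (W x - w))) = 0"
      using W(1)[of x] that by (simp add: v.diff)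
    then have "?v (W x - w) = 0" by (intro null[of "W x - w"] null[of "?v (W x - w)"])
    then show ?thesis using that by (simp add: F_def v.diff)
  qed
  have vvF: "?v (?v (F x)) = ?v x" for x by (simp add: F_def W)
  have cap: "capply (CBlinfun F) = F"
  proof (rule cblinfun_of_linear)
    show "F (x + y) = F x + F y" for x y
      by (rule FI[where w = "W x + W y"]) (simp_all add: v.add vvF, simp add: F_def v.add)
    show "F (c *\<^sub>C x) = c *\<^sub>C F x" for c x
      by (rule FI[where w = "c *\<^sub>C W x"]) (simp_all add: capply_scaleC vvF, simp add: F_def capply_scaleC)
    show "norm (F x) \<le> (norm V * (C * C)) * norm x" for x
      using norm_capply[of V "W x"] mult_left_mono[OF W(2)[of x], of "norm V"]
      by (simp add: F_def mult.assoc)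
  qed
  have tF: "F (?t x) = ?t (F x)" for x
    by (rule FI[where w = "?t (W x)"]) (simp add: F_def tv, metis tv vvF)
  define x where "x = Endo T"
  define s where "s = Endo (CBlinfun F)"
  have xs: "x * s = s * x"
    by (simp add: x_def s_def op_of_inject[symmetric] times_endo.rep_eq Endo_inverse)
      (rule cblinfun_eqI, simp add: ccompose.rep_eq cap tF)
  have "x ^ Suc p = x ^ Suc p * x ^ Suc p * s"
    by (simp only: op_of_inject[symmetric] times_endo.rep_eq op_of_power)
      (rule cblinfun_eqI, simp add: x_def s_def ccompose.rep_eq Endo_inverse cap V_def[symmetric] vvF
        del: cpow.simps)
  also have "\<dots> = x ^ Suc (Suc p) * (x ^ p * s)"
    by (simp only: mult.assoc[symmetric] power_add[symmetric]) simp
  finally have "x ^ Suc p = x ^ Suc (Suc p) * (x ^ p * s)" .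
  moreover have "x * (x ^ p * s) = x ^ p * s * x"
    by (simp only: mult.assoc xs[symmetric]) (simp only: mult.assoc[symmetric] power_commutes)
  ultimately have "drazin x" by (intro drazinI)
  then show ?thesis by (simp add: drazin_invertible_iff x_def)
qed

text \<open>Ascent and descent are eliminated here; from now on poles are seen through the algebra
  structure.\<close>

lemma poles_iff:
  fixes T :: "'a::complex_banach \<Rightarrow>\<^sub>C\<^sub>L 'a"
  shows "\<mu> \<in> poles T \<longleftrightarrow> \<mu> \<in> spectrum T \<and> drazin (Endo T - \<mu> *\<^sub>C 1)"
proof -
  let ?S = "T - \<mu> *\<^sub>C cid"
  have "ascent ?S = descent ?S \<and> ascent ?S < \<infinity> \<longleftrightarrow> drazin_invertible ?S"
    using drazin_of_finite_ascent[of ?S] drazin_imp_finite_ascent[of ?S] by argo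
  then show ?thesis
    unfolding poles_def mem_Collect_eq by (simp add: Endo_shift[symmetric] drazin_invertible_iff[symmetric])
qed

section \<open>The spectrum of a generalized derivation\<close>

lemma capply_gen_derivation: "capply (gen_derivation A B) U = A \<circ>\<^sub>C U - U \<circ>\<^sub>C B"
  by (simp add: gen_derivation.rep_eq)

text \<open>It moves any point \<alpha> - \<beta> to 0 by shifting the two operators
  separately.\<close>

lemma gen_derivation_shift:
  "gen_derivation A B - (\<alpha> - \<beta>) *\<^sub>C cid = gen_derivation (A - \<alpha> *\<^sub>C cid) (B - \<beta> *\<^sub>C cid)"
proof (rule cblinfun_eqI, rule cblinfun_eqI)
  fix U x
  show "capply (capply (gen_derivation A B - (\<alpha> - \<beta>) *\<^sub>C cid) U) x
      = capply (capply (gen_derivation (A - \<alpha> *\<^sub>C cid) (B - \<beta> *\<^sub>C cid)) U) x"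
    by (simp add: capply_simps capply_gen_derivation algebra_simps complex_vector.scale_left_diff_distrib)
qed

section \<open>Left and right multiplication operators\<close>

text \<open>Multiplicativity is asked on commuting pairs only, because right multiplication reverses
  products.\<close>

lemma commuting_hom_power:
  fixes h :: "'a::monoid_mult \<Rightarrow> 'b::monoid_mult"
  assumes "h 1 = 1" and "\<And>x y. x * y = y * x \<Longrightarrow> h (x * y) = h x * h y"
  shows "h (x ^ n) = h x ^ n"
proof (induction n)
  case (Suc n)
  have "h (x * x ^ n) = h x * h (x ^ n)" by (intro assms(2)) (simp add: power_commutes)
  then show ?case by (simp add: Suc)
qed (simp add: assms(1))

lemma commuting_hom_inverse_pair:
  assumes "h 1 = 1" and "\<And>x y. x * y = y * x \<Longrightarrow> h (x * y) = h x * h y" and "inverse_pair x y"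
  shows "inverse_pair (h x) (h y)"
  using assms(2)[of x y] assms(2)[of y x] assms(1,3) by (simp add: inverse_pair_def)

lemma commuting_hom_drazin:
  fixes h :: "'a::monoid_mult \<Rightarrow> 'b::monoid_mult"
  assumes one: "h 1 = 1" and mult: "\<And>x y. x * y = y * x \<Longrightarrow> h (x * y) = h x * h y" and "drazin x"
  shows "drazin (h x)"
proof -
  obtain s m where s: "x ^ m = x ^ m * s * x" "x * s = s * x"
    using assms(3) by (rule drazinE)
  have "x ^ Suc m * s = x ^ m * s * x"
    using s(2) by (simp only: power_Suc2 mult.assoc)
  then have eq: "x ^ m = x ^ Suc m * s" using s(1) by simp
  have "x ^ Suc m * s = s * x ^ Suc m"
    by (rule power_commuting_commutes[OF s(2)])
  from mult[OF this] have "h (x ^ m) = h (x ^ Suc m) * h s"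
    using arg_cong[OF eq, of h] by simp
  then have "h x ^ m = h x ^ Suc m * h s"
    by (simp only: commuting_hom_power[of h, OF one mult])
  moreover have "h x * h s = h s * h x"
    using mult[OF s(2)] mult[OF s(2)[symmetric]] s(2) by simp
  ultimately show ?thesis by (intro drazinI)
qed

definition lmul :: "'x::complex_banach endo \<Rightarrow> ('y::complex_banach \<Rightarrow>\<^sub>C\<^sub>L 'x) endo" where
  "lmul a = Endo (gen_derivation (op_of a) 0)"

text \<open>The two minus signs cancel and leave U b; writing it as a generalized derivation
  inherits linearity and boundedness.\<close>

definition rmul :: "'y::complex_banach endo \<Rightarrow> ('y \<Rightarrow>\<^sub>C\<^sub>L 'x::complex_banach) endo" where
  "rmul b = Endo (gen_derivation 0 (- op_of b))"

lemma capply_lmul: "capply (op_of (lmul a)) U = op_of a \<circ>\<^sub>C U"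
  and capply_rmul: "capply (op_of (rmul b)) U = U \<circ>\<^sub>C op_of b"
  by (simp_all add: lmul_def rmul_def Endo_inverse capply_gen_derivation cblinfun_eqI capply_simps)

lemma endo_eqI: "(\<And>x. capply (op_of f) x = capply (op_of g) x) \<Longrightarrow> f = g"
  by (metis cblinfun_eqI op_of_inject)

lemmas endo_simps = times_endo.rep_eq one_endo.rep_eq minus_endo.rep_eq scaleC_endo.rep_eq
  capply_lmul capply_rmul

lemma lmul_one: "lmul 1 = 1"
  and lmul_mult: "lmul (a * b) = lmul a * lmul b"
  and lmul_shift: "lmul (a - \<mu> *\<^sub>C 1) = lmul a - \<mu> *\<^sub>C 1"
  and rmul_one: "rmul 1 = 1"
  and rmul_mult: "rmul (c * d) = rmul d * rmul c"
  and rmul_shift: "rmul (c - \<mu> *\<^sub>C 1) = rmul c - \<mu> *\<^sub>C 1"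
  and lmul_rmul: "lmul a * rmul c = rmul c * lmul a"
  by (rule endo_eqI, rule cblinfun_eqI, simp add: endo_simps capply_simps)+

lemma Endo_gen_derivation: "Endo (gen_derivation A B) = lmul (Endo A) - rmul (Endo B)"
  by (rule endo_eqI) (simp add: minus_endo.rep_eq minus_cblinfun.rep_eq capply_lmul capply_rmul
      Endo_inverse capply_gen_derivation)

lemma rmul_mult_commute: "c * d = d * c \<Longrightarrow> rmul (c * d) = rmul c * rmul d"
  by (simp add: rmul_mult)

lemma
  shows lmul_inverse_pair: "inverse_pair a b \<Longrightarrow> inverse_pair (lmul a) (lmul b)"
    and lmul_drazin: "drazin a \<Longrightarrow> drazin (lmul a)"
    and rmul_inverse_pair: "inverse_pair c d \<Longrightarrow> inverse_pair (rmul c) (rmul d)"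
    and rmul_drazin: "drazin c \<Longrightarrow> drazin (rmul c)"
  by (rule commuting_hom_inverse_pair commuting_hom_drazin, rule lmul_one rmul_one,
      rule lmul_mult rmul_mult_commute, assumption+)+

proposition spectrum_gen_derivation_subset:
  fixes A :: "'x::complex_banach \<Rightarrow>\<^sub>C\<^sub>L 'x" and B :: "'y::complex_banach \<Rightarrow>\<^sub>C\<^sub>L 'y"
  assumes "\<mu> \<in> spectrum (gen_derivation A B)"
  shows "\<mu> \<in> spectrum A \<ominus> spectrum B"
proof -
  let ?p = "lmul (Endo A) :: ('y \<Rightarrow>\<^sub>C\<^sub>L 'x) endo" and ?q = "rmul (Endo B) :: ('y \<Rightarrow>\<^sub>C\<^sub>L 'x) endo"
  interpret commutative_commutant "commutant {?p, ?q}" "commutant (commutant {?p, ?q})"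
    by (rule commutative_bicommutant(1)[OF lmul_rmul])
  have "\<exists>\<alpha> \<beta>. \<alpha> - \<beta> = \<mu> \<and> \<not> (\<exists>y. inverse_pair (?p - \<alpha> *\<^sub>C 1) y) \<and> \<not> (\<exists>y. inverse_pair (?q - \<beta> *\<^sub>C 1) y)"
    using invertible_of_joint_spectrum[OF commutative_bicommutant(2,3)[OF lmul_rmul[of "Endo A" "Endo B"]], of \<mu>]
      assms unfolding spectrum_iff Endo_gen_derivation by blast
  then obtain \<alpha> \<beta> where eq: "\<alpha> - \<beta> = \<mu>" and
    p: "\<not> (\<exists>y. inverse_pair (?p - \<alpha> *\<^sub>C 1) y)" and q: "\<not> (\<exists>y. inverse_pair (?q - \<beta> *\<^sub>C 1) y)" by blast
  have "\<alpha> \<in> spectrum A"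
    using p lmul_inverse_pair unfolding spectrum_iff lmul_shift[symmetric] by blast
  moreover have "\<beta> \<in> spectrum B"
    using q rmul_inverse_pair unfolding spectrum_iff rmul_shift[symmetric] by blast
  ultimately show ?thesis using eq unfolding minkowski_minus_def by blast
qed

proposition drazin_gen_derivation:
  fixes A :: "'x::complex_banach \<Rightarrow>\<^sub>C\<^sub>L 'x" and B :: "'y::complex_banach \<Rightarrow>\<^sub>C\<^sub>L 'y"
  assumes dr: "\<And>\<alpha> \<beta>. \<alpha> \<in> spectrum A \<Longrightarrow> \<beta> \<in> spectrum B \<Longrightarrow> \<alpha> - \<beta> = \<mu> \<Longrightarrow>
    drazin (Endo A - \<alpha> *\<^sub>C 1) \<and> drazin (Endo B - \<beta> *\<^sub>C 1)"
  shows "drazin (Endo (gen_derivation A B) - \<mu> *\<^sub>C 1)"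
proof -
  let ?p = "lmul (Endo A) :: ('y \<Rightarrow>\<^sub>C\<^sub>L 'x) endo" and ?q = "rmul (Endo B) :: ('y \<Rightarrow>\<^sub>C\<^sub>L 'x) endo"
  interpret commutative_commutant "commutant {?p, ?q}" "commutant (commutant {?p, ?q})"
    by (rule commutative_bicommutant(1)[OF lmul_rmul])
  show ?thesis
    unfolding Endo_gen_derivation
  proof (rule drazin_of_joint_spectrum[OF commutative_bicommutant(2,3)[OF lmul_rmul]])
    fix \<alpha> \<beta> assume eq: "\<alpha> - \<beta> = \<mu>" and
      p: "\<not> (\<exists>y. inverse_pair (?p - \<alpha> *\<^sub>C 1) y)" and q: "\<not> (\<exists>y. inverse_pair (?q - \<beta> *\<^sub>C 1) y)"
    have "\<alpha> \<in> spectrum A"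
      using p lmul_inverse_pair unfolding spectrum_iff lmul_shift[symmetric] by blast
    moreover have "\<beta> \<in> spectrum B"
      using q rmul_inverse_pair unfolding spectrum_iff rmul_shift[symmetric] by blast
    ultimately show "drazin (?p - \<alpha> *\<^sub>C 1) \<and> drazin (?q - \<beta> *\<^sub>C 1)"
      using dr[OF _ _ eq] lmul_drazin rmul_drazin
      unfolding lmul_shift[symmetric] rmul_shift[symmetric] by blast
  qed
qed

section \<open>Rank one operators and the inclusion of the difference set in the spectrum\<close>

definition rank_one :: "'x::complex_normed_vector \<Rightarrow> ('y::complex_normed_vector \<Rightarrow>\<^sub>C\<^sub>L complex) \<Rightarrow> 'y \<Rightarrow>\<^sub>C\<^sub>L 'x" where
  "rank_one x f = CBlinfun (\<lambda>y. capply f y *\<^sub>C x)"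

lemma capply_rank_one: "capply (rank_one x f) y = capply f y *\<^sub>C x"
proof -
  have "capply (CBlinfun (\<lambda>y. capply f y *\<^sub>C x)) = (\<lambda>y. capply f y *\<^sub>C x)"
  proof (rule cblinfun_of_linear[where K = "norm f * norm x"])
    show "norm (capply f y *\<^sub>C x) \<le> norm f * norm x * norm y" for y
      using mult_right_mono[OF norm_capply[of f y] norm_ge_zero[of x]] by (simp add: norm_scaleC mult_ac)
  qed (simp_all add: capply_simps scaleC_add_left scaleC_scaleC)
  then show ?thesis by (simp add: rank_one_def)
qed

lemma norm_rank_one: "norm (rank_one x f) = norm x * norm f"
proof (rule antisym)
  show "norm (rank_one x f) \<le> norm x * norm f"
  proof (rule norm_cblinfun_bound)
    show "norm (capply (rank_one x f) y) \<le> norm x * norm f * norm y" for y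
      using mult_left_mono[OF norm_capply[of f y] norm_ge_zero[of x]]
      by (simp add: capply_rank_one norm_scaleC mult_ac)
  qed simp
  show "norm x * norm f \<le> norm (rank_one x f)"
  proof (cases "x = 0")
    case False
    have "norm f \<le> norm (rank_one x f) / norm x"
    proof (rule norm_cblinfun_bound)
      show "norm (capply f y) \<le> norm (rank_one x f) / norm x * norm y" for y
        using norm_capply[of "rank_one x f" y] False
        by (simp add: capply_rank_one norm_scaleC field_simps)
    qed simp
    then show ?thesis using False by (simp add: field_simps)
  qed simp
qed

lemma ccompose_rank_one: "a \<circ>\<^sub>C rank_one x f = rank_one (capply a x) f"
  and rank_one_ccompose: "rank_one x f \<circ>\<^sub>C b = rank_one x (f \<circ>\<^sub>C b)"
  by (rule cblinfun_eqI, simp add: capply_simps capply_rank_one)+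

lemma rank_one_zero: "rank_one x 0 = 0"
  by (rule cblinfun_eqI, simp add: capply_simps capply_rank_one)

lemma cblinfun_nonzeroD:
  fixes f :: "'y::complex_normed_vector \<Rightarrow>\<^sub>C\<^sub>L complex"
  assumes "f \<noteq> 0"
  obtains y where "capply f y = 1"
proof -
  obtain y where "capply f y \<noteq> 0"
    using assms cblinfun_eqI[of f 0] by (auto simp: capply_simps)
  then have "capply f (inverse (capply f y) *\<^sub>C y) = 1" by (simp add: capply_scaleC)
  then show ?thesis using that by blast
qed

text \<open>The lower bound makes \<open>b\<close> injective with closed range, and the absence of
  annihilating functionals makes that range dense.\<close>

proposition cinvertible_of_bounded_below:
  fixes b :: "'y::complex_banach \<Rightarrow>\<^sub>C\<^sub>L 'y"
  assumes K: "0 \<le> K" "\<And>y. norm y \<le> K * norm (capply b y)"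
    and dense: "\<And>f :: 'y \<Rightarrow>\<^sub>C\<^sub>L complex. f \<circ>\<^sub>C b = 0 \<Longrightarrow> f = 0"
  shows "cinvertible b"
proof -
  interpret b: bounded_linear "capply b" by (rule bounded_linear_capply)
  have "complete (range (capply b))"
  proof (rule complete_isometric_image[OF _ subspace_UNIV bounded_linear_capply])
    show "0 < 1 / (K + 1)" using K(1) by simp
    show "\<forall>y\<in>UNIV. norm (capply b y) \<ge> 1 / (K + 1) * norm y"
    proof
      fix y
      have "norm y \<le> (K + 1) * norm (capply b y)"
        using K(2)[of y] norm_ge_zero[of "capply b y"] unfolding distrib_right by linarith
      then show "norm (capply b y) \<ge> 1 / (K + 1) * norm y"
        using K(1) by (simp add: field_simps)
    qed
  qed (simp add: complete_UNIV)
  then have closed: "closure (range (capply b)) = range (capply b)"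
    using complete_imp_closed closure_closed by blast
  have sub: "subspace (range (capply b))"
    using linear_subspace_image[OF b.linear_axioms subspace_UNIV] .
  have "x \<in> range (capply b)" for x
  proof (rule ccontr)
    assume "x \<notin> range (capply b)"
    then have x: "x \<notin> closure (range (capply b))" by (simp add: closed)
    obtain f :: "'y \<Rightarrow>\<^sub>C\<^sub>L complex" where f: "\<And>z. z \<in> range (capply b) \<Longrightarrow> capply f z = 0" "capply f x = 1"
    proof (rule separating_functional[OF sub _ x])
      show "c *\<^sub>C z \<in> range (capply b)" if "z \<in> range (capply b)" for c z
        using that by (auto simp: capply_scaleC[symmetric])
    qed (use that in blast)
    have "f \<circ>\<^sub>C b = 0" using f(1) by (intro cblinfun_eqI) (simp add: capply_simps)
    then have "f = 0" by (rule dense)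
    then show False using f(2) by (simp add: capply_simps)
  qed
  then obtain g where g: "\<And>x. capply b (g x) = x" by (metis surj_def rangeE)
  have inj: "x = y" if "capply b x = capply b y" for x y
    using K(2)[of "x - y"] that by (simp add: b.diff)
  have cap: "capply (CBlinfun g) = g"
  proof (rule cblinfun_of_linear)
    show "g (x + y) = g x + g y" for x y by (rule inj) (simp add: g b.add)
    show "g (c *\<^sub>C x) = c *\<^sub>C g x" for c x by (rule inj) (simp add: g capply_scaleC)
    show "norm (g x) \<le> K * norm x" for x using K(2)[of "g x"] by (simp add: g)
  qed
  have "CBlinfun g \<circ>\<^sub>C b = cid" by (rule cblinfun_eqI, rule inj) (simp add: capply_simps cap g)
  moreover have "b \<circ>\<^sub>C CBlinfun g = cid" by (rule cblinfun_eqI) (simp add: capply_simps cap g)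
  ultimately show ?thesis unfolding cinvertible_def by blast
qed

text \<open>If \<open>a\<close> is not bounded below, a unit vector x with a x almost 0 isolates the
  action of \<open>b\<close>. If \<open>a\<close> is bounded below but singular, a functional
  \<open>h\<close> vanishing on its range does so instead.\<close>

proposition cinvertible_of_gen_derivation:
  fixes a :: "'x::complex_banach \<Rightarrow>\<^sub>C\<^sub>L 'x" and b :: "'y::complex_banach \<Rightarrow>\<^sub>C\<^sub>L 'y"
  assumes "cinvertible (gen_derivation a b)"
  shows "cinvertible a \<or> cinvertible b"
proof -
  let ?T = "capply (gen_derivation a b)"
  interpret a: bounded_linear "capply a" by (rule bounded_linear_capply)
  obtain S where S: "S \<circ>\<^sub>C gen_derivation a b = cid" "gen_derivation a b \<circ>\<^sub>C S = cid"
    using assms unfolding cinvertible_def by blast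
  have ST: "capply S (?T U) = U" and TS: "?T (capply S U) = U" for U
    using arg_cong[OF S(1), of "\<lambda>F. capply F U"] arg_cong[OF S(2), of "\<lambda>F. capply F U"]
    by (simp_all add: capply_simps)
  define M where "M = norm S"
  have M: "0 \<le> M" by (simp add: M_def)
  have nS: "norm (capply S U) \<le> M * norm U" for U unfolding M_def by (rule norm_capply)
  have S0: "capply S 0 = 0" by (rule linear_simps(3)[OF bounded_linear_capply])
  have T: "?T U = a \<circ>\<^sub>C U - U \<circ>\<^sub>C b" for U by (rule capply_gen_derivation)
  show ?thesis
  proof (cases "\<exists>K\<ge>0. \<forall>x. norm x \<le> K * norm (capply a x)")
    case False
    define K where "K = 2 * M + 1"
    have "0 \<le> K" using M by (simp add: K_def)
    then obtain u where u: "K * norm (capply a u) < norm u"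
      using False by (meson not_le)
    define x where "x = inverse (norm u) *\<^sub>R u"
    have "u \<noteq> 0" using u \<open>0 \<le> K\<close> by auto
    then have x: "norm x = 1" "K * norm (capply a x) < 1"
      using u by (simp_all add: x_def a.scaleR field_simps)
    \<comment> \<open>Terms containing a x thus contribute at most half of the quantity being
      estimated and can be absorbed.\<close>
    have ax: "M * norm (capply a x) \<le> 1 / 2"
      using x(2) norm_ge_zero[of "capply a x"] unfolding K_def distrib_right mult.assoc by linarith
    have "cinvertible b"
    proof (rule cinvertible_of_bounded_below)
      fix f :: "'y \<Rightarrow>\<^sub>C\<^sub>L complex" assume f: "f \<circ>\<^sub>C b = 0"
      have "?T (rank_one x f) = rank_one (capply a x) f"
        by (simp add: T ccompose_rank_one rank_one_ccompose f rank_one_zero)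
      then have "norm (rank_one x f) \<le> M * norm (rank_one (capply a x) f)"
        using nS[of "?T (rank_one x f)"] unfolding ST by simp
      then have "norm f \<le> (M * norm (capply a x)) * norm f"
        using x(1) by (simp add: norm_rank_one mult.assoc)
      also have "\<dots> \<le> 1 / 2 * norm f" by (rule mult_right_mono[OF ax norm_ge_zero])
      finally show "f = 0" by simp
    next
      show "0 \<le> 2 * M" using M by simp
      fix y :: 'y
      obtain g :: "'y \<Rightarrow>\<^sub>C\<^sub>L complex" where g: "norm g \<le> 1" "norm (capply g y) = norm y"
        by (rule norming_functional)
      define W where "W = capply S (rank_one x g)"
      have W: "a \<circ>\<^sub>C W - W \<circ>\<^sub>C b = rank_one x g" using TS by (simp add: W_def T)
      \<comment> \<open>The derivation commutes with left multiplication by \<open>a\<close>, hence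
        so does its inverse S. Thus a W is the S-image of a rank one operator built on the small
        vector a x.\<close>
      have "?T (a \<circ>\<^sub>C W) = a \<circ>\<^sub>C ?T W"
        by (rule cblinfun_eqI) (simp add: T capply_simps)
      also have "\<dots> = rank_one (capply a x) g" by (simp add: T W ccompose_rank_one)
      finally have "a \<circ>\<^sub>C W = capply S (rank_one (capply a x) g)" by (metis ST)
      then have "norm (a \<circ>\<^sub>C W) \<le> M * (norm (capply a x) * norm g)"
        using nS[of "rank_one (capply a x) g"] by (simp add: norm_rank_one)
      also have "\<dots> \<le> M * norm (capply a x) * 1"
        unfolding mult.assoc[symmetric] using g(1) M by (intro mult_left_mono) auto
      also have "\<dots> \<le> 1 / 2" using ax by simp
      finally have aW: "norm (a \<circ>\<^sub>C W) \<le> 1 / 2" .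
      have "norm W \<le> M * norm g" using nS[of "rank_one x g"] x(1) by (simp add: W_def norm_rank_one)
      also have "\<dots> \<le> M * 1" using g(1) M by (rule mult_left_mono)
      finally have nW: "norm W \<le> M" by simp
      have "norm y = norm (capply g y *\<^sub>C x)" using g(2) x(1) by (simp add: norm_scaleC)
      also have "capply g y *\<^sub>C x = capply (a \<circ>\<^sub>C W) y - capply W (capply b y)"
        using arg_cong[OF W, of "\<lambda>F. capply F y"] by (simp add: capply_simps capply_rank_one)
      also have "norm \<dots> \<le> norm (a \<circ>\<^sub>C W) * norm y + norm W * norm (capply b y)"
        by (rule order_trans[OF norm_triangle_ineq4 add_mono[OF norm_capply norm_capply]])
      also have "\<dots> \<le> 1 / 2 * norm y + M * norm (capply b y)"
        by (intro add_mono mult_right_mono aW nW norm_ge_zero)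
      finally show "norm y \<le> 2 * M * norm (capply b y)" by simp
    qed
    then show ?thesis ..
  next
    case True
    then obtain K where K: "0 \<le> K" "\<And>x. norm x \<le> K * norm (capply a x)" by blast
    show ?thesis
    proof (rule disjCI)
      assume nb: "\<not> cinvertible b"
      show "cinvertible a"
      proof (rule cinvertible_of_bounded_below[OF K], rule ccontr)
        fix h :: "'x \<Rightarrow>\<^sub>C\<^sub>L complex" assume ha: "h \<circ>\<^sub>C a = 0" and "h \<noteq> 0"
        then obtain x0 where x0: "capply h x0 = 1" using cblinfun_nonzeroD by blast
        have ha': "capply h (capply a x) = 0" for x
          using arg_cong[OF ha, of "\<lambda>F. capply F x"] by (simp add: capply_simps)
        have "cinvertible b"
        proof (rule cinvertible_of_bounded_below)
          fix f :: "'y \<Rightarrow>\<^sub>C\<^sub>L complex" assume f: "f \<circ>\<^sub>C b = 0"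
          show "f = 0"
          proof (rule ccontr)
            assume "f \<noteq> 0"
            then obtain y where y: "capply f y = 1" using cblinfun_nonzeroD by blast
            define U where "U = capply S (rank_one x0 f)"
            have U: "?T U = rank_one x0 f" by (simp add: U_def TS)
            \<comment> \<open>Right multiplication by \<open>b\<close> also commutes with the
              derivation, so U b = 0 by injectivity; then a U has rank one and \<open>h\<close>
              detects a vector outside the range of \<open>a\<close>.\<close>
            have "?T (U \<circ>\<^sub>C b) = ?T U \<circ>\<^sub>C b"
              by (rule cblinfun_eqI) (simp add: T capply_simps)
            also have "\<dots> = 0" by (simp add: U rank_one_ccompose f rank_one_zero)
            finally have "U \<circ>\<^sub>C b = 0" using ST[of "U \<circ>\<^sub>C b"] S0 by simp
            then have "a \<circ>\<^sub>C U = rank_one x0 f" using U by (simp add: T)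
            from arg_cong[OF this, of "\<lambda>F. capply h (capply F y)"]
            show False using x0 y ha' by (simp add: capply_simps capply_rank_one)
          qed
        next
          show "0 \<le> norm h * (M * norm x0)" using M by simp
          fix y :: 'y
          obtain g :: "'y \<Rightarrow>\<^sub>C\<^sub>L complex" where g: "norm g \<le> 1" "norm (capply g y) = norm y"
            by (rule norming_functional)
          define U where "U = capply S (rank_one x0 g)"
          have "a \<circ>\<^sub>C U - U \<circ>\<^sub>C b = rank_one x0 g" using TS by (simp add: U_def T)
          from arg_cong[OF this, of "\<lambda>F. capply h (capply F y)"]
          have "capply g y = - capply h (capply U (capply b y))"
            using x0 ha' by (simp add: capply_simps capply_rank_one)
          then have "norm y = norm (capply h (capply U (capply b y)))"
            using g(2) by (metis norm_minus_cancel)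
          also have "\<dots> \<le> norm h * (norm U * norm (capply b y))"
            by (rule order_trans[OF norm_capply mult_left_mono[OF norm_capply norm_ge_zero]])
          also have "\<dots> \<le> norm h * ((M * norm x0) * norm (capply b y))"
          proof (intro mult_left_mono mult_right_mono norm_ge_zero)
            have "norm U \<le> M * (norm x0 * norm g)"
              using nS[of "rank_one x0 g"] by (simp add: U_def norm_rank_one)
            also have "\<dots> \<le> M * (norm x0 * 1)"
              using g(1) M by (intro mult_left_mono) auto
            finally show "norm U \<le> M * norm x0" by simp
          qed
          finally show "norm y \<le> norm h * (M * norm x0) * norm (capply b y)" by (simp add: mult.assoc)
        qed
        then show False using nb by blast
      qed
    qed
  qed
qed

corollary spectrum_gen_derivation:
  fixes A :: "'x::complex_banach \<Rightarrow>\<^sub>C\<^sub>L 'x" and B :: "'y::complex_banach \<Rightarrow>\<^sub>C\<^sub>L 'y"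
  shows "spectrum (gen_derivation A B) = spectrum A \<ominus> spectrum B"
proof
  show "spectrum A \<ominus> spectrum B \<subseteq> spectrum (gen_derivation A B)"
    by (auto simp: minkowski_minus_def spectrum_def gen_derivation_shift
        dest!: cinvertible_of_gen_derivation)
qed (use spectrum_gen_derivation_subset in blast)

section \<open>Poles of a generalized derivation\<close>

text \<open>Otherwise \<open>x\<close> would be a small enough perturbation of x - \<mu> to be
  invertible itself.\<close>

lemma resolvent_norm_ge:
  fixes x :: "'a::complex_banach_algebra"
  assumes "inverse_pair (x - \<mu> *\<^sub>C 1) R" and "\<not> (\<exists>y. inverse_pair x y)"
  shows "1 \<le> norm \<mu> * norm R"
proof (rule ccontr)
  assume "\<not> ?thesis"
  moreover have "norm (- (\<mu> *\<^sub>C (1 :: 'a))) * norm R \<le> norm \<mu> * norm R"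
    using mult_left_mono[OF norm_one_le[where 'a = 'a] norm_ge_zero[of \<mu>]]
    by (intro mult_right_mono) (simp_all add: norm_scaleC)
  ultimately have "norm (- (\<mu> *\<^sub>C (1 :: 'a))) * norm R < 1" by linarith
  from neumann_perturbation[OF assms(1) this] show False using assms(2) by simp
qed

text \<open>The norm of \<open>R\<close> need not be attained, so \<open>y\<close> is a vector that
  \<open>R\<close> stretches by more than half of its norm; hence the factor 2.\<close>

lemma large_resolvent_vector:
  fixes a :: "'a::complex_banach \<Rightarrow>\<^sub>C\<^sub>L 'a"
  assumes R: "inverse_pair (Endo a - \<mu> *\<^sub>C 1) R" and a: "\<not> cinvertible a"
  obtains y where "norm y \<le> 2 * norm \<mu> * norm (capply (op_of R) y)" "0 < norm (capply (op_of R) y)"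
proof -
  have ge: "1 \<le> norm \<mu> * norm (op_of R)"
    using resolvent_norm_ge[OF R] a by (simp add: cinvertible_iff norm_endo.rep_eq)
  have "\<exists>y. norm (op_of R) / 2 * norm y < norm (capply (op_of R) y)"
  proof (rule ccontr)
    assume "\<not> ?thesis"
    then have "norm (op_of R) \<le> norm (op_of R) / 2"
      by (intro norm_cblinfun_bound) (simp_all add: not_less)
    then show False using ge by auto
  qed
  then obtain y where y: "norm (op_of R) / 2 * norm y < norm (capply (op_of R) y)" by blast
  have "norm y \<le> (norm \<mu> * norm (op_of R)) * norm y"
    using mult_right_mono[OF ge norm_ge_zero[of y]] by simp
  also have "\<dots> = 2 * norm \<mu> * (norm (op_of R) / 2 * norm y)" by simp
  also have "\<dots> \<le> 2 * norm \<mu> * norm (capply (op_of R) y)"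
    using y by (intro mult_left_mono) auto
  finally show ?thesis
    using y by (intro that[of y]) (auto intro: order_le_less_trans[rotated])
qed

lemma resolvent_eq:
  fixes a :: "'a::complex_banach \<Rightarrow>\<^sub>C\<^sub>L 'a"
  assumes "inverse_pair (Endo a - \<mu> *\<^sub>C 1) R"
  shows "a \<circ>\<^sub>C op_of R = cid + \<mu> *\<^sub>C op_of R" "op_of R \<circ>\<^sub>C a = cid + \<mu> *\<^sub>C op_of R"
proof -
  have "Endo a * R = 1 + \<mu> *\<^sub>C R" "R * Endo a = 1 + \<mu> *\<^sub>C R"
    using inverse_pairD[OF assms] by (simp_all add: algebra_simps)
  then show "a \<circ>\<^sub>C op_of R = cid + \<mu> *\<^sub>C op_of R" "op_of R \<circ>\<^sub>C a = cid + \<mu> *\<^sub>C op_of R"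
    by (simp_all add: op_of_inject[symmetric] times_endo.rep_eq plus_endo.rep_eq one_endo.rep_eq
        scaleC_endo.rep_eq Endo_inverse)
qed

text \<open>For z = R y the resolvent equation gives a z = y + \<mu> z, where |y| \<le> 2 |\<mu>|
  |z|; the constant 3 is 2 + 1.\<close>

lemma approximate_eigenvectors:
  fixes a :: "'a::complex_banach \<Rightarrow>\<^sub>C\<^sub>L 'a"
  assumes R: "\<And>k. inverse_pair (Endo a - \<mu> k *\<^sub>C 1) (R k)" and a: "\<not> cinvertible a" and \<mu>: "\<mu> \<longlonglongrightarrow> 0"
  obtains x where "\<And>k. norm (x k) = 1" "(\<lambda>k. capply a (x k)) \<longlonglongrightarrow> 0"
proof -
  have "\<exists>x. norm x = 1 \<and> norm (capply a x) \<le> 3 * norm (\<mu> k)" for k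
  proof -
    interpret a: bounded_linear "capply a" by (rule bounded_linear_capply)
    obtain y where y: "norm y \<le> 2 * norm (\<mu> k) * norm (capply (op_of (R k)) y)" "0 < norm (capply (op_of (R k)) y)"
      using large_resolvent_vector[OF R a] .
    define z where "z = capply (op_of (R k)) y"
    have "capply a z = y + \<mu> k *\<^sub>C z"
      using arg_cong[OF resolvent_eq(1)[OF R], of "\<lambda>F. capply F y"] by (simp add: z_def capply_simps)
    then have "norm (capply a z) \<le> norm y + norm (\<mu> k) * norm z"
      by (metis norm_scaleC norm_triangle_ineq)
    also have "\<dots> \<le> 3 * norm (\<mu> k) * norm z" using y(1) by (simp add: z_def)
    finally have "norm (capply a (inverse (norm z) *\<^sub>R z)) \<le> 3 * norm (\<mu> k)"
      using y(2) by (simp add: z_def[symmetric] a.scaleR field_simps)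
    moreover have "norm (inverse (norm z) *\<^sub>R z) = 1" using y(2) by (simp add: z_def[symmetric])
    ultimately show ?thesis by blast
  qed
  then obtain x where x: "\<And>k. norm (x k) = 1" "\<And>k. norm (capply a (x k)) \<le> 3 * norm (\<mu> k)" by metis
  have lim: "(\<lambda>k. 3 * norm (\<mu> k)) \<longlonglongrightarrow> 0"
    by (rule tendsto_mult_right_zero[OF tendsto_norm_zero[OF \<mu>]])
  have "(\<lambda>k. capply a (x k)) \<longlonglongrightarrow> 0"
    by (rule Lim_null_comparison[OF _ lim]) (use x(2) in simp)
  with x(1) show ?thesis using that by blast
qed

text \<open>The dual version: a functional \<open>g\<close> norming R y is pulled back to f = g R,
  and f a = g + \<mu> f with |g| \<le> 1 \<le> 2 |\<mu>| |f|.\<close>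

lemma approximate_eigenfunctionals:
  fixes a :: "'a::complex_banach \<Rightarrow>\<^sub>C\<^sub>L 'a"
  assumes R: "\<And>k. inverse_pair (Endo a - \<mu> k *\<^sub>C 1) (R k)" and a: "\<not> cinvertible a" and \<mu>: "\<mu> \<longlonglongrightarrow> 0"
  obtains f :: "nat \<Rightarrow> 'a \<Rightarrow>\<^sub>C\<^sub>L complex"
  where "\<And>k. norm (f k) = 1" "(\<lambda>k. f k \<circ>\<^sub>C a) \<longlonglongrightarrow> 0"
proof -
  have "\<exists>f :: 'a \<Rightarrow>\<^sub>C\<^sub>L complex. norm f = 1 \<and> norm (f \<circ>\<^sub>C a) \<le> 3 * norm (\<mu> k)" for k
  proof -
    obtain y where y: "norm y \<le> 2 * norm (\<mu> k) * norm (capply (op_of (R k)) y)" "0 < norm (capply (op_of (R k)) y)"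
      using large_resolvent_vector[OF R a] .
    obtain g :: "'a \<Rightarrow>\<^sub>C\<^sub>L complex"
      where g: "norm g \<le> 1" "norm (capply g (capply (op_of (R k)) y)) = norm (capply (op_of (R k)) y)"
      by (rule norming_functional)
    define f where "f = g \<circ>\<^sub>C op_of (R k)"
    have fy: "norm (capply (op_of (R k)) y) \<le> norm f * norm y"
      using g(2) norm_capply[of f y] by (simp add: f_def capply_simps)
    have ypos: "0 < norm y" using fy y(2) by (cases "y = 0") auto
    have fpos: "0 < norm f" using fy y(2) ypos by (cases "f = 0") auto
    have "norm y \<le> 2 * norm (\<mu> k) * (norm f * norm y)"
      using y(1) mult_left_mono[OF fy, of "2 * norm (\<mu> k)"] by simp
    then have f1: "1 \<le> 2 * norm (\<mu> k) * norm f" using ypos by (simp add: mult.assoc[symmetric])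
    have "f \<circ>\<^sub>C a = g + \<mu> k *\<^sub>C f"
    proof (rule cblinfun_eqI)
      show "capply (f \<circ>\<^sub>C a) x = capply (g + \<mu> k *\<^sub>C f) x" for x
        using arg_cong[OF resolvent_eq(2)[OF R], of "\<lambda>F. capply g (capply F x)" k]
        by (simp add: f_def capply_simps)
    qed
    then have "norm (f \<circ>\<^sub>C a) \<le> norm g + norm (\<mu> k) * norm f"
      by (metis norm_scaleC norm_triangle_ineq)
    also have "\<dots> \<le> 3 * norm (\<mu> k) * norm f" using g(1) f1 unfolding mult.assoc by linarith
    finally have fa: "norm (f \<circ>\<^sub>C a) \<le> 3 * norm (\<mu> k) * norm f" .
    have "(inverse (norm f) *\<^sub>R f) \<circ>\<^sub>C a = inverse (norm f) *\<^sub>R (f \<circ>\<^sub>C a)"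
      by (rule cblinfun_eqI) (simp add: capply_simps)
    then have "norm ((inverse (norm f) *\<^sub>R f) \<circ>\<^sub>C a) \<le> 3 * norm (\<mu> k)"
      using fa fpos by (simp add: field_simps)
    moreover have "norm (inverse (norm f) *\<^sub>R f) = 1" using fpos by simp
    ultimately show ?thesis by blast
  qed
  then obtain f :: "nat \<Rightarrow> 'a \<Rightarrow>\<^sub>C\<^sub>L complex"
    where f: "\<And>k. norm (f k) = 1" "\<And>k. norm (f k \<circ>\<^sub>C a) \<le> 3 * norm (\<mu> k)" by metis
  have lim: "(\<lambda>k. 3 * norm (\<mu> k)) \<longlonglongrightarrow> 0"
    by (rule tendsto_mult_right_zero[OF tendsto_norm_zero[OF \<mu>]])
  have "(\<lambda>k. f k \<circ>\<^sub>C a) \<longlonglongrightarrow> 0"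
    by (rule Lim_null_comparison[OF _ lim]) (use f(2) in simp)
  with f(1) show ?thesis using that by blast
qed

section \<open>Powers of the derivation on rank one operators\<close>

lemma gen_derivation_rank_one:
  "capply (gen_derivation a b) (rank_one x f) = rank_one (capply a x) f - rank_one x (f \<circ>\<^sub>C b)"
  by (simp add: capply_gen_derivation ccompose_rank_one rank_one_ccompose)

lemma bounded_linear_funpow_capply:
  fixes T :: "'a::complex_normed_vector \<Rightarrow>\<^sub>C\<^sub>L 'a"
  shows "bounded_linear (capply T ^^ j)"
  unfolding capply_cpow[symmetric] by (rule bounded_linear_capply)

lemma tendsto_rank_one_zero:
  shows "f \<longlonglongrightarrow> 0 \<Longrightarrow> (\<lambda>k. rank_one x (f k)) \<longlonglongrightarrow> 0"
    and "u \<longlonglongrightarrow> 0 \<Longrightarrow> (\<lambda>k. rank_one (u k) g) \<longlonglongrightarrow> 0"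
  by (rule tendsto_norm_zero_cancel, simp add: norm_rank_one,
      intro tendsto_mult_right_zero tendsto_mult_left_zero tendsto_norm_zero, assumption)+

text \<open>Every term in which \<open>b\<close> acts contains f_k b and vanishes in the limit, so
  asymptotically the derivation acts on the vector alone, as \<open>a\<close> does.\<close>

lemma gen_derivation_power_left:
  assumes "(\<lambda>k. f k \<circ>\<^sub>C b) \<longlonglongrightarrow> 0"
  shows "(\<lambda>k. (capply (gen_derivation a b) ^^ j) (rank_one x (f k)) - rank_one ((capply a ^^ j) x) (f k)) \<longlonglongrightarrow> 0"
proof (induction j arbitrary: x)
  case (Suc j)
  let ?T = "capply (gen_derivation a b)"
  interpret Tj: bounded_linear "?T ^^ j" by (rule bounded_linear_funpow_capply)
  have "(\<lambda>k. (?T ^^ j) (rank_one x (f k \<circ>\<^sub>C b))) \<longlonglongrightarrow> (?T ^^ j) 0"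
    by (intro Tj.tendsto tendsto_rank_one_zero assms)
  from tendsto_diff[OF Suc[of "capply a x"] this] show ?case
    by (simp add: funpow_swap1 gen_derivation_rank_one Tj.diff Tj.zero algebra_simps)
qed simp

text \<open>Here the terms containing \<open>a\<close> vanish and \<open>b\<close> acts on the
  functional from the right. Each application contributes a sign, which disappears once norms are
  taken.\<close>

lemma gen_derivation_power_right:
  assumes "(\<lambda>k. capply a (u k)) \<longlonglongrightarrow> 0"
  shows "(\<lambda>k. (capply (gen_derivation a b) ^^ j) (rank_one (u k) g)
      - (- 1) ^ j *\<^sub>C rank_one (u k) (g \<circ>\<^sub>C cpow b j)) \<longlonglongrightarrow> 0"
proof (induction j arbitrary: g)
  case 0
  have "g \<circ>\<^sub>C cid = g" by (rule cblinfun_eqI) (simp add: capply_simps)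
  then show ?case by simp
next
  case (Suc j)
  let ?T = "capply (gen_derivation a b)"
  interpret Tj: bounded_linear "?T ^^ j" by (rule bounded_linear_funpow_capply)
  have "(\<lambda>k. (?T ^^ j) (rank_one (capply a (u k)) g)) \<longlonglongrightarrow> (?T ^^ j) 0"
    by (intro Tj.tendsto tendsto_rank_one_zero assms)
  from tendsto_diff[OF this Suc[of "g \<circ>\<^sub>C b"]]
  have "(\<lambda>k. (?T ^^ j) (rank_one (capply a (u k)) g) - ((?T ^^ j) (rank_one (u k) (g \<circ>\<^sub>C b))
      - (- 1) ^ j *\<^sub>C rank_one (u k) (g \<circ>\<^sub>C b \<circ>\<^sub>C cpow b j))) \<longlonglongrightarrow> 0"
    by (simp add: Tj.zero)
  moreover have "g \<circ>\<^sub>C b \<circ>\<^sub>C cpow b j = g \<circ>\<^sub>C cpow b (Suc j)"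
    by (rule cblinfun_eqI) (simp add: capply_simps)
  ultimately show ?case
    by (simp add: funpow_swap1 gen_derivation_rank_one Tj.diff algebra_simps del: cpow.simps)
qed

lemma tendsto_norm_of_diff_zero:
  assumes "(\<lambda>k. F k - G k) \<longlonglongrightarrow> (0 :: 'a::real_normed_vector)" and "\<And>k. norm (G k) = c"
  shows "(\<lambda>k. norm (F k)) \<longlonglongrightarrow> c"
proof -
  have "(\<lambda>k. norm (F k) - c) \<longlonglongrightarrow> 0"
  proof (rule Lim_null_comparison[OF _ tendsto_norm_zero[OF assms(1)]])
    show "\<forall>\<^sub>F k in sequentially. norm (norm (F k) - c) \<le> norm (F k - G k)"
      using norm_triangle_ineq3 assms(2) by (metis (mono_tags, lifting) eventuallyI real_norm_def)
  qed
  then show ?thesis by (simp add: LIM_zero_iff)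
qed

text \<open>Cancelling one power with the Drazin inverse \<open>s\<close> bounds the m-th power of
  the derivation by |s| times the next one. Passing to the limit on asymptotically
  rank-one-invariant families gives the same bound, with the same m and constant, for each
  factor.\<close>

proposition drazin_of_gen_derivation:
  fixes a :: "'x::complex_banach \<Rightarrow>\<^sub>C\<^sub>L 'x" and b :: "'y::complex_banach \<Rightarrow>\<^sub>C\<^sub>L 'y"
  assumes dr: "drazin (Endo (gen_derivation a b))"
    and a: "\<not> cinvertible a" "\<mu> \<longlonglongrightarrow> 0" "\<And>k. inverse_pair (Endo a - \<mu> k *\<^sub>C 1) (R k)"
    and b: "\<not> cinvertible b" "\<nu> \<longlonglongrightarrow> 0" "\<And>k. inverse_pair (Endo b - \<nu> k *\<^sub>C 1) (Q k)"
  shows "drazin (Endo a)" "drazin (Endo b)"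
proof -
  let ?T = "capply (gen_derivation a b)"
  define X where "X = Endo (gen_derivation a b)"
  obtain s m where "X ^ m = X ^ m * s * X" and comm: "X * s = s * X"
    using dr unfolding X_def by (rule drazinE)
  moreover have "X ^ Suc m * s = X ^ m * s * X"
    using comm by (simp only: power_Suc2 mult.assoc)
  ultimately have "X ^ m = s * X ^ Suc m"
    using power_commuting_commutes[OF comm, of "Suc m"] by simp
  then have "op_of (X ^ m) = op_of s \<circ>\<^sub>C op_of (X ^ Suc m)"
    by (simp only: times_endo.rep_eq[symmetric])
  then have "cpow (gen_derivation a b) m = op_of s \<circ>\<^sub>C cpow (gen_derivation a b) (Suc m)"
    unfolding op_of_power X_def Endo_inverse[OF UNIV_I] .
  from arg_cong[OF this, of "\<lambda>F. capply F U" for U]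
  have "(?T ^^ m) U = capply (op_of s) ((?T ^^ Suc m) U)" for U
    unfolding ccompose.rep_eq capply_cpow .
  then have T: "norm ((?T ^^ m) U) \<le> norm s * norm ((?T ^^ Suc m) U)" for U
    by (metis norm_capply norm_endo.rep_eq)
  show "drazin (Endo a)"
  proof (rule drazin_of_resolvent_sequence[OF a(3,2) norm_ge_zero[of s]])
    obtain f :: "nat \<Rightarrow> 'y \<Rightarrow>\<^sub>C\<^sub>L complex" where f: "\<And>k. norm (f k) = 1" "(\<lambda>k. f k \<circ>\<^sub>C b) \<longlonglongrightarrow> 0"
      using approximate_eigenfunctionals[OF b(3,1,2)] by blast
    have lim: "(\<lambda>k. norm ((?T ^^ j) (rank_one x (f k)))) \<longlonglongrightarrow> norm ((capply a ^^ j) x)" for j x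
      by (rule tendsto_norm_of_diff_zero[OF gen_derivation_power_left[OF f(2)]])
        (simp add: norm_rank_one f(1))
    have le: "norm ((capply a ^^ m) x) \<le> norm s * norm ((capply a ^^ Suc m) x)" for x
      by (rule LIMSEQ_le[OF lim tendsto_mult_left[OF lim]]) (use T in blast)
    fix w :: "'x endo"
    show "norm (Endo a ^ m * w) \<le> norm s * norm (Endo a ^ Suc m * w)"
      unfolding norm_endo.rep_eq[of "_ * _"]
    proof (rule norm_cblinfun_bound)
      fix x
      have eq: "capply (op_of (Endo a ^ j * w)) x = (capply a ^^ j) (capply (op_of w) x)" for j
        unfolding times_endo.rep_eq op_of_power ccompose.rep_eq capply_cpow Endo_inverse[OF UNIV_I] ..
      show "norm (capply (op_of (Endo a ^ m * w)) x) \<le> norm s * norm (op_of (Endo a ^ Suc m * w)) * norm x"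
        using le[of "capply (op_of w) x"] mult_left_mono[OF norm_capply[of "op_of (Endo a ^ Suc m * w)" x], of "norm s"]
        unfolding eq by (simp add: mult.assoc)
    qed simp
  qed
  show "drazin (Endo b)"
  proof (rule drazin_of_resolvent_sequence[OF b(3,2) norm_ge_zero[of s]])
    obtain u where u: "\<And>k. norm (u k) = 1" "(\<lambda>k. capply a (u k)) \<longlonglongrightarrow> 0"
      using approximate_eigenvectors[OF a(3,1,2)] by blast
    have lim: "(\<lambda>k. norm ((?T ^^ j) (rank_one (u k) g))) \<longlonglongrightarrow> norm (g \<circ>\<^sub>C cpow b j)" for j g
      by (rule tendsto_norm_of_diff_zero[OF gen_derivation_power_right[OF u(2)]])
        (simp add: norm_scaleC norm_power norm_rank_one u(1))
    have le: "norm (g \<circ>\<^sub>C cpow b m) \<le> norm s * norm (g \<circ>\<^sub>C cpow b (Suc m))" for g :: "'y \<Rightarrow>\<^sub>C\<^sub>L complex"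
      by (rule LIMSEQ_le[OF lim tendsto_mult_left[OF lim]]) (use T in blast)
    fix w :: "'y endo" assume w: "w * Endo b = Endo b * w"
    \<comment> \<open>Functionals see powers of \<open>b\<close> only to the right of other factors,
      so \<open>w\<close> has to be moved to the left. This is why the inequality is stated for
      commuting \<open>w\<close>.\<close>
    have comm: "op_of (Endo b ^ j * w) = op_of w \<circ>\<^sub>C cpow b j" for j
    proof -
      have "Endo b ^ j * w = w * Endo b ^ j"
        by (rule power_commuting_commutes[OF w[symmetric]])
      then show ?thesis by (simp add: times_endo.rep_eq op_of_power Endo_inverse)
    qed
    show "norm (Endo b ^ m * w) \<le> norm s * norm (Endo b ^ Suc m * w)"
      unfolding norm_endo.rep_eq[of "_ * _"] comm
    proof (rule norm_cblinfun_bound)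
      fix y
      let ?z = "capply (op_of w \<circ>\<^sub>C cpow b m) y"
      obtain g :: "'y \<Rightarrow>\<^sub>C\<^sub>L complex" where g: "norm g \<le> 1" "norm (capply g ?z) = norm ?z"
        by (rule norming_functional)
      have assoc: "g \<circ>\<^sub>C op_of w \<circ>\<^sub>C cpow b j = g \<circ>\<^sub>C (op_of w \<circ>\<^sub>C cpow b j)" for j
        by (rule cblinfun_eqI) (simp add: capply_simps)
      have "norm ?z = norm (capply (g \<circ>\<^sub>C op_of w \<circ>\<^sub>C cpow b m) y)"
        unfolding g(2)[symmetric] by (simp add: capply_simps)
      also have "\<dots> \<le> norm (g \<circ>\<^sub>C op_of w \<circ>\<^sub>C cpow b m) * norm y" by (rule norm_capply)
      also have "\<dots> \<le> norm s * norm (g \<circ>\<^sub>C op_of w \<circ>\<^sub>C cpow b (Suc m)) * norm y"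
        by (intro mult_right_mono le norm_ge_zero)
      also have "\<dots> \<le> norm s * norm (op_of w \<circ>\<^sub>C cpow b (Suc m)) * norm y"
      proof (intro mult_right_mono mult_left_mono norm_ge_zero)
        show "norm (g \<circ>\<^sub>C op_of w \<circ>\<^sub>C cpow b (Suc m)) \<le> norm (op_of w \<circ>\<^sub>C cpow b (Suc m))"
          using norm_ccompose[of g "op_of w \<circ>\<^sub>C cpow b (Suc m)"]
            mult_right_mono[OF g(1) norm_ge_zero[of "op_of w \<circ>\<^sub>C cpow b (Suc m)"]]
          unfolding assoc by simp
      qed
      finally show "norm ?z \<le> norm s * norm (op_of w \<circ>\<^sub>C cpow b (Suc m)) * norm y" .
    qed simp
  qed
qed

section \<open>Isolated points of the spectra\<close>

lemma iso_point_resolvent_sequence: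
  assumes "\<alpha> \<in> iso_points (spectrum A)"
  obtains \<mu> R where "\<mu> \<longlonglongrightarrow> 0" "\<And>k. inverse_pair (Endo (A - \<alpha> *\<^sub>C cid) - \<mu> k *\<^sub>C 1) (R k)"
proof -
  have "\<not> \<alpha> islimpt spectrum A" using assms by (simp add: iso_points_def acc_points_def)
  then obtain e where e: "0 < e" "\<And>z. z \<in> spectrum A \<Longrightarrow> z \<noteq> \<alpha> \<Longrightarrow> e \<le> dist z \<alpha>"
    unfolding islimpt_approachable by (meson not_le)
  \<comment> \<open>The factor e/2 keeps every term, including the one for k = 0, strictly inside
    the punctured disc that is free of spectrum.\<close>
  define \<mu> where "\<mu> k = complex_of_real (e / 2 * inverse (real (Suc k)))" for k
  have "\<mu> \<longlonglongrightarrow> complex_of_real (e / 2 * 0)"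
    unfolding \<mu>_def by (intro tendsto_intros LIMSEQ_inverse_real_of_nat)
  then have lim: "\<mu> \<longlonglongrightarrow> 0" by simp
  have "\<exists>y. inverse_pair (Endo (A - \<alpha> *\<^sub>C cid) - \<mu> k *\<^sub>C 1) y" for k
  proof -
    have n: "norm (\<mu> k) = e / 2 * inverse (real (Suc k))"
      unfolding \<mu>_def norm_of_real using e(1) by simp
    have pos: "0 < norm (\<mu> k)" unfolding n using e(1) by simp
    have "norm (\<mu> k) \<le> e / 2 * 1"
      unfolding n using e(1) by (intro mult_left_mono) (simp_all add: field_simps)
    then have lt: "norm (\<mu> k) < e" using e(1) by simp
    have "\<alpha> + \<mu> k \<notin> spectrum A"
      using e(2)[of "\<alpha> + \<mu> k"] pos lt by (auto simp: dist_norm)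
    then have "\<exists>y. inverse_pair (Endo A - (\<alpha> + \<mu> k) *\<^sub>C 1) y" by (simp add: spectrum_iff)
    then show ?thesis by (simp add: Endo_shift scaleC_add_left diff_diff_eq)
  qed
  then show ?thesis using that lim by metis
qed

lemma poles_subset_iso_points:
  fixes T :: "'a::complex_banach \<Rightarrow>\<^sub>C\<^sub>L 'a"
  shows "poles T \<subseteq> iso_points (spectrum T)"
proof
  fix \<mu> assume "\<mu> \<in> poles T"
  then have \<mu>: "\<mu> \<in> spectrum T" "drazin (Endo T - \<mu> *\<^sub>C 1)" by (simp_all add: poles_iff)
  obtain \<epsilon> where \<epsilon>: "0 < \<epsilon>" "\<And>\<nu>. \<nu> \<noteq> 0 \<Longrightarrow> norm \<nu> < \<epsilon> \<Longrightarrow> \<exists>y. inverse_pair (Endo T - \<mu> *\<^sub>C 1 - \<nu> *\<^sub>C 1) y"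
    using drazin_punctured_resolvent[OF \<mu>(2)] by blast
  have "\<not> \<mu> islimpt spectrum T"
  proof
    assume "\<mu> islimpt spectrum T"
    then obtain z where z: "z \<in> spectrum T" "z \<noteq> \<mu>" "dist z \<mu> < \<epsilon>"
      using \<epsilon>(1) unfolding islimpt_approachable by blast
    have "Endo T - \<mu> *\<^sub>C 1 - (z - \<mu>) *\<^sub>C 1 = Endo T - z *\<^sub>C 1"
      by (simp add: complex_vector.scale_left_diff_distrib)
    moreover have "\<exists>y. inverse_pair (Endo T - \<mu> *\<^sub>C 1 - (z - \<mu>) *\<^sub>C 1) y"
      using \<epsilon>(2)[of "z - \<mu>"] z(2,3) by (simp add: dist_norm)
    ultimately show False
      using z(1) unfolding spectrum_iff by metis
  qed
  then show "\<mu> \<in> iso_points (spectrum T)" using \<mu>(1) by (simp add: iso_points_def acc_points_def)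
qed

lemma islimpt_translate:
  fixes S T :: "'a::real_normed_vector set"
  assumes "x islimpt S" and "\<And>z. z \<in> S \<Longrightarrow> z + c \<in> T"
  shows "x + c islimpt T"
  unfolding islimpt_approachable
proof (intro allI impI)
  fix e :: real assume "0 < e"
  then obtain z where "z \<in> S" "z \<noteq> x" "dist z x < e"
    using assms(1) unfolding islimpt_approachable by blast
  then show "\<exists>w\<in>T. w \<noteq> x + c \<and> dist w (x + c) < e"
    using assms(2) by (intro bexI[of _ "z + c"]) auto
qed

text \<open>Translating one set by a fixed point of the other stays inside the difference set. Read
  contrapositively, an isolated difference arises only from two isolated points.\<close>

lemma islimpt_minkowski_minus:
  assumes "\<alpha> \<in> S" "\<beta> \<in> T" and "\<alpha> islimpt S \<or> \<beta> islimpt T"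
  shows "\<alpha> - \<beta> islimpt S \<ominus> T"
  using assms(3)
proof
  assume "\<alpha> islimpt S"
  from islimpt_translate[OF this, of "- \<beta>" "S \<ominus> T"] show ?thesis
    using assms(2) by (auto simp: minkowski_minus_def)
next
  assume "\<beta> islimpt T"
  then have "- \<beta> islimpt uminus ` T"
    unfolding islimpt_approachable by (fastforce simp: dist_norm norm_minus_commute)
  from islimpt_translate[OF this, of \<alpha> "S \<ominus> T"] show ?thesis
    using assms(1) by (force simp: minkowski_minus_def)
qed

theorem theorem3p5:
  fixes A :: "'x::complex_banach \<Rightarrow>\<^sub>C\<^sub>L 'x" and B :: "'y::complex_banach \<Rightarrow>\<^sub>C\<^sub>L 'y"
    and \<rho> :: "('y \<Rightarrow>\<^sub>C\<^sub>L 'x) \<Rightarrow>\<^sub>C\<^sub>L ('y \<Rightarrow>\<^sub>C\<^sub>L 'x)"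
  assumes "infinite_dimensional TYPE('x)" and "infinite_dimensional TYPE('y)"
    and "\<rho> = gen_derivation A B"
  shows "iso_nonpoles \<rho> =
           ((iso_nonpoles A \<ominus> iso_points (spectrum B)) \<union> (iso_points (spectrum A) \<ominus> iso_nonpoles B))
             - acc_points (spectrum \<rho>) \<and>
         poles \<rho> = (poles A \<ominus> poles B) - drazin_spectrum \<rho>"
proof -
  have spec: "spectrum \<rho> = spectrum A \<ominus> spectrum B"
    unfolding assms(3) by (rule spectrum_gen_derivation)
  have drsp: "\<mu> \<in> drazin_spectrum \<rho> \<longleftrightarrow> \<not> drazin (Endo \<rho> - \<mu> *\<^sub>C 1)" for \<mu>
    by (simp add: drazin_spectrum_def drazin_invertible_iff Endo_shift)
  have iso_sub: "\<mu> \<in> iso_points K \<Longrightarrow> \<mu> \<in> K" for \<mu> K by (simp add: iso_points_def)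
  have iso: "\<alpha> \<in> iso_points (spectrum A)" "\<beta> \<in> iso_points (spectrum B)"
    if "\<alpha> \<in> spectrum A" "\<beta> \<in> spectrum B" "\<alpha> - \<beta> \<in> iso_points (spectrum \<rho>)" for \<alpha> \<beta>
    using that islimpt_minkowski_minus[OF that(1,2)] by (auto simp: iso_points_def acc_points_def spec)
  \<comment> \<open>Shifting moves \<alpha> - \<beta> to 0, where isolation supplies the two
    resolvent sequences.\<close>
  have pole: "\<alpha> \<in> poles A" "\<beta> \<in> poles B"
    if \<alpha>: "\<alpha> \<in> iso_points (spectrum A)" and \<beta>: "\<beta> \<in> iso_points (spectrum B)"
      and dr: "drazin (Endo \<rho> - (\<alpha> - \<beta>) *\<^sub>C 1)" for \<alpha> \<beta>
  proof -
    obtain \<mu> R where R: "\<mu> \<longlonglongrightarrow> 0" "\<And>k. inverse_pair (Endo (A - \<alpha> *\<^sub>C cid) - \<mu> k *\<^sub>C 1) (R k)"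
      using iso_point_resolvent_sequence[OF \<alpha>] by blast
    obtain \<nu> Q where Q: "\<nu> \<longlonglongrightarrow> 0" "\<And>k. inverse_pair (Endo (B - \<beta> *\<^sub>C cid) - \<nu> k *\<^sub>C 1) (Q k)"
      using iso_point_resolvent_sequence[OF \<beta>] by blast
    have "drazin (Endo (gen_derivation (A - \<alpha> *\<^sub>C cid) (B - \<beta> *\<^sub>C cid)))"
      using dr unfolding assms(3) by (simp add: Endo_shift[symmetric] gen_derivation_shift)
    from drazin_of_gen_derivation[OF this _ R _ Q]
    show "\<alpha> \<in> poles A" "\<beta> \<in> poles B"
      using iso_sub[OF \<alpha>] iso_sub[OF \<beta>] by (auto simp: poles_iff spectrum_def Endo_shift)
  qed
  have "\<mu> \<in> iso_nonpoles \<rho> \<longleftrightarrow> \<mu> \<in> ((iso_nonpoles A \<ominus> iso_points (spectrum B))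
      \<union> (iso_points (spectrum A) \<ominus> iso_nonpoles B)) - acc_points (spectrum \<rho>)" (is "?L \<longleftrightarrow> ?R") for \<mu>
  proof
    assume ?L
    then have \<mu>: "\<mu> \<in> iso_points (spectrum \<rho>)" "\<not> drazin (Endo \<rho> - \<mu> *\<^sub>C 1)"
      using iso_sub by (auto simp: iso_nonpoles_def poles_iff)
    \<comment> \<open>If both shifts were Drazin invertible in every decomposition of \<mu>, then
      \<rho> - \<mu> would be as well; some decomposition must fail.\<close>
    then obtain \<alpha> \<beta> where \<alpha>\<beta>: "\<alpha> \<in> spectrum A" "\<beta> \<in> spectrum B" "\<alpha> - \<beta> = \<mu>"
      "\<not> (drazin (Endo A - \<alpha> *\<^sub>C 1) \<and> drazin (Endo B - \<beta> *\<^sub>C 1))"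
      using drazin_gen_derivation[of A B \<mu>] unfolding assms(3) by blast
    then have "\<alpha> \<in> iso_points (spectrum A)" "\<beta> \<in> iso_points (spectrum B)"
      using iso \<mu>(1) by blast+
    moreover from this have "\<alpha> \<in> iso_nonpoles A \<or> \<beta> \<in> iso_nonpoles B"
      using \<alpha>\<beta>(4) by (auto simp: iso_nonpoles_def poles_iff)
    moreover have "\<mu> \<notin> acc_points (spectrum \<rho>)" using \<mu>(1) by (simp add: iso_points_def)
    ultimately show ?R using \<alpha>\<beta>(3) unfolding minkowski_minus_def by blast
  next
    assume R: ?R
    then obtain \<alpha> \<beta> where \<alpha>\<beta>: "\<alpha> \<in> iso_points (spectrum A)" "\<beta> \<in> iso_points (spectrum B)" "\<mu> = \<alpha> - \<beta>"
      "\<alpha> \<notin> poles A \<or> \<beta> \<notin> poles B"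
      by (auto simp: minkowski_minus_def iso_nonpoles_def)
    have "\<mu> \<in> spectrum \<rho>"
      unfolding spec minkowski_minus_def using \<alpha>\<beta>(3) iso_sub[OF \<alpha>\<beta>(1)] iso_sub[OF \<alpha>\<beta>(2)] by blast
    then have "\<mu> \<in> iso_points (spectrum \<rho>)"
      using R by (simp add: iso_points_def)
    moreover have "\<mu> \<notin> poles \<rho>"
      using pole[OF \<alpha>\<beta>(1,2)] \<alpha>\<beta>(3,4) by (auto simp: poles_iff)
    ultimately show ?L by (simp add: iso_nonpoles_def)
  qed
  moreover have "\<mu> \<in> poles \<rho> \<longleftrightarrow> \<mu> \<in> (poles A \<ominus> poles B) - drazin_spectrum \<rho>" for \<mu>
  proof
    assume p: "\<mu> \<in> poles \<rho>"
    then have \<mu>: "\<mu> \<in> iso_points (spectrum \<rho>)" "drazin (Endo \<rho> - \<mu> *\<^sub>C 1)"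
      using subsetD[OF poles_subset_iso_points] by (simp_all add: poles_iff)
    then obtain \<alpha> \<beta> where \<alpha>\<beta>: "\<alpha> \<in> spectrum A" "\<beta> \<in> spectrum B" "\<mu> = \<alpha> - \<beta>"
      using iso_sub unfolding spec minkowski_minus_def by blast
    then have "\<alpha> \<in> poles A" "\<beta> \<in> poles B"
      using pole[OF iso[OF \<alpha>\<beta>(1,2)]] \<mu> by blast+
    then show "\<mu> \<in> (poles A \<ominus> poles B) - drazin_spectrum \<rho>"
      using \<alpha>\<beta>(3) \<mu>(2) drsp unfolding minkowski_minus_def by blast
  next
    assume "\<mu> \<in> (poles A \<ominus> poles B) - drazin_spectrum \<rho>"
    then have "\<mu> \<in> spectrum A \<ominus> spectrum B" "drazin (Endo \<rho> - \<mu> *\<^sub>C 1)"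
      by (auto simp: minkowski_minus_def poles_iff drsp)
    then show "\<mu> \<in> poles \<rho>" by (simp add: poles_iff spec)
  qed
  ultimately show ?thesis by blast
qed

end
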